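(* The Fourier-Wigner transform $A\mapsto \mathcal{F}_{\mathrm{W}}(A)$, $\mathcal{F}_{\mathrm{W}}(A)(x)=\mathrm{tr}(A\mathcal{D}\pi(x))$, defined on $\mathcal{S}^1\mathcal{D}^{-1}\cap\mathcal{S}^2$ (the operators $A\in\mathcal{S}^2(\mathcal{H})$ for which $A\mathcal{D}$ extends to a trace class operator) with values in $L^2_r(G)$, can be continuously extended to all of $\mathcal{S}^2(\mathcal{H})$ as an injective isometry, meaning that $$\Vert A\Vert_{\mathcal{S}^2}=\Vert\mathcal{F}_{\mathrm{W}}(A)\Vert_{L^2_r}\qquad\text{for all }A\in\mathcal{S}^2(\mathcal{H}).$$
   Context: $G$ is a connected exponential Lie group with Lie algebra $\mathfrak{g}$ ($\exp:\mathfrak{g}\to G$ is a diffeomorphism, with inverse $\log$). The co-adjoint map $K$ is $\langle K(g)Y,X\rangle=\langle Y,\mathrm{Ad}_{g^{-1}}X\rangle$ for $Y\in\mathfrak g^*$. Fix $F\in\mathfrak{g}^*$ with trivial stabilizer $\{g\in G:K(g)F=F\}=\{e\}$. $(\pi,\mathcal{H})$ is the irreducible unitary representation attached to the orbit $\mathcal{O}_F=K(G)F$ by the Kirillov orbit method: $\pi=\mathrm{ind}_H^G\chi_F$ with $H=\exp\mathfrak{h}$, $\mathfrak{h}$ a subalgebra of maximal dimension with $\langle F,[\mathfrak{h},\mathfrak{h}]\rangle=0$ satisfying the Pukanszky condition $K(H)F=F+\mathfrak{h}^{\perp}$, and $\chi_F(\exp X)=e^{-2\pi i\langle F,X\rangle}$;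 it is square integrable. $\mu_r$ is a right Haar measure and $L^2_r(G)=L^2(G,\mu_r)$. Inner products are linear in the first variable. With $\mathcal{W}_\phi\psi(x)=\langle\psi,\pi(x)^*\phi\rangle_{\mathcal H}$, the Duflo-Moore operator $\mathcal{D}^{-1}$ is the unique positive densely defined operator on $\mathcal{H}$ with $\langle \mathcal{W}_{\phi_1}\psi_1,\mathcal{W}_{\phi_2}\psi_2\rangle_{L^2_r}=\langle\psi_1,\psi_2\rangle\overline{\langle\mathcal{D}^{-1}\phi_1,\mathcal{D}^{-1}\phi_2\rangle}$ for $\phi_i\in\mathrm{Dom}(\mathcal{D}^{-1})$, $\psi_i\in\mathcal H$; $\mathcal{D}$ is its inverse. $\mathcal{S}^1,\mathcal{S}^2$ are the trace class and Hilbert-Schmidt operators on $\mathcal H$. In $\mathrm{tr}(A\mathcal D\pi(x))$, $A\mathcal D$ denotes its trace class extension. *)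

theory Defs
  imports "HOL-Analysis.Analysis" "HOL-Algebra.Coset"
begin

section \<open>Complex Hilbert spaces and operators\<close>

text \<open>The inner product is linear in the first variable.\<close>

class complex_hilbert_space = banach +
  fixes scaleC :: "complex \<Rightarrow> 'a \<Rightarrow> 'a" (infixr "*\<^sub>C" 75)
    and cinner :: "'a \<Rightarrow> 'a \<Rightarrow> complex"
  assumes scaleC_add_right: "a *\<^sub>C (x + y) = a *\<^sub>C x + a *\<^sub>C y"
    and scaleC_add_left: "(a + b) *\<^sub>C x = a *\<^sub>C x + b *\<^sub>C x"
    and scaleC_scaleC: "a *\<^sub>C b *\<^sub>C x = (a * b) *\<^sub>C x"
    and scaleC_of_real: "complex_of_real r *\<^sub>C x = r *\<^sub>R x"
    and cinner_commute: "cinner x y = cnj (cinner y x)"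
    and cinner_add_left: "cinner (x + y) z = cinner x z + cinner y z"
    and cinner_scaleC_left: "cinner (a *\<^sub>C x) y = a * cinner x y"
    and cinner_self: "cinner x x = complex_of_real ((norm x)\<^sup>2)"

instantiation complex :: complex_hilbert_space
begin
definition scaleC_complex :: "complex \<Rightarrow> complex \<Rightarrow> complex" where "scaleC_complex a x = a * x"
definition cinner_complex :: "complex \<Rightarrow> complex \<Rightarrow> complex" where "cinner_complex x y = x * cnj y"
instance
  by standard
    (simp_all add: scaleC_complex_def cinner_complex_def algebra_simps scaleR_conv_of_real
      complex_norm_square del: of_real_power)
end

definition csubspace :: "'h::complex_hilbert_space set \<Rightarrow> bool" where
  "csubspace V \<longleftrightarrow> 0 \<in> V \<and> (\<forall>x\<in>V. \<forall>y\<in>V. x + y \<in> V) \<and> (\<forall>c. \<forall>x\<in>V. c *\<^sub>C x \<in> V)"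

definition clinear_on :: "'h::complex_hilbert_space set \<Rightarrow> ('h \<Rightarrow> 'h) \<Rightarrow> bool" where
  "clinear_on V T \<longleftrightarrow>
     (\<forall>x\<in>V. \<forall>y\<in>V. T (x + y) = T x + T y) \<and> (\<forall>c. \<forall>x\<in>V. T (c *\<^sub>C x) = c *\<^sub>C T x)"

definition bounded_clinear :: "('h::complex_hilbert_space \<Rightarrow> 'h) \<Rightarrow> bool" where
  "bounded_clinear T \<longleftrightarrow> clinear_on UNIV T \<and> (\<exists>C. \<forall>x. norm (T x) \<le> C * norm x)"

definition adj :: "('h::complex_hilbert_space \<Rightarrow> 'h) \<Rightarrow> 'h \<Rightarrow> 'h" where
  "adj T = (THE S. \<forall>x y. cinner (T x) y = cinner x (S y))"

definition positive_on :: "'h::complex_hilbert_space set \<Rightarrow> ('h \<Rightarrow> 'h) \<Rightarrow> bool" where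
  "positive_on V T \<longleftrightarrow> (\<forall>x\<in>V. cinner (T x) x \<in> \<real> \<and> 0 \<le> Re (cinner (T x) x))"

definition is_onb :: "'h::complex_hilbert_space set \<Rightarrow> bool" where
  "is_onb B \<longleftrightarrow> (\<forall>e\<in>B. \<forall>f\<in>B. cinner e f = (if e = f then 1 else 0)) \<and>
               (\<forall>x. (\<forall>e\<in>B. cinner x e = 0) \<longrightarrow> x = 0)"

text \<open>A reference orthonormal basis; the notions defined from it do not depend on the choice.\<close>

definition onb :: "'h::complex_hilbert_space set" where
  "onb = (SOME B. is_onb B)"

definition hilbert_schmidt :: "('h::complex_hilbert_space \<Rightarrow> 'h) set" where
  "hilbert_schmidt = {A. bounded_clinear A \<and> (\<lambda>e. (norm (A e))\<^sup>2) summable_on onb}"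

definition hs_norm :: "('h::complex_hilbert_space \<Rightarrow> 'h) \<Rightarrow> real" where
  "hs_norm A = sqrt (\<Sum>\<^sub>\<infinity>e\<in>onb. (norm (A e))\<^sup>2)"

definition is_operator_abs :: "('h::complex_hilbert_space \<Rightarrow> 'h) \<Rightarrow> ('h \<Rightarrow> 'h) \<Rightarrow> bool" where
  "is_operator_abs A P \<longleftrightarrow> bounded_clinear P \<and> positive_on UNIV P \<and> P \<circ> P = adj A \<circ> A"

definition trace_class :: "('h::complex_hilbert_space \<Rightarrow> 'h) set" where
  "trace_class = {A. bounded_clinear A \<and>
     (\<exists>P. is_operator_abs A P \<and> (\<lambda>e. cinner (P e) e) summable_on onb)}"

definition op_trace :: "('h::complex_hilbert_space \<Rightarrow> 'h) \<Rightarrow> complex" where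
  "op_trace A = (\<Sum>\<^sub>\<infinity>e\<in>onb. cinner (A e) e)"

text \<open>Unbounded operators are given by their domain together with a function whose values outside
  the domain are irrelevant.  ``Positive operator'' is meant in the sense usual for unbounded
  operators, i.e.\ positive and self-adjoint; without self-adjointness the Duflo--Moore operator
  would not be unique, since it could be restricted to a smaller dense domain.\<close>

definition positive_selfadjoint :: "'h::complex_hilbert_space set \<Rightarrow> ('h \<Rightarrow> 'h) \<Rightarrow> bool" where
  "positive_selfadjoint V T \<longleftrightarrow>
     csubspace V \<and> closure V = UNIV \<and> clinear_on V T \<and> positive_on V T \<and>
     (\<forall>y z. (y \<in> V \<and> T y = z) \<longleftrightarrow> (\<forall>x\<in>V. cinner (T x) y = cinner x z))"

section \<open>Square integrable functions\<close>

text \<open>Elements of \<open>L\<^sup>2\<close> are represented by functions; equality in \<open>L\<^sup>2\<close> is equality almost everywhere.\<close>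

definition L2_fun :: "'g measure \<Rightarrow> ('g \<Rightarrow> complex) set" where
  "L2_fun M = {f. f \<in> borel_measurable M \<and> integrable M (\<lambda>x. (cmod (f x))\<^sup>2)}"

definition L2_inner :: "'g measure \<Rightarrow> ('g \<Rightarrow> complex) \<Rightarrow> ('g \<Rightarrow> complex) \<Rightarrow> complex" where
  "L2_inner M f g = (LINT x|M. f x * cnj (g x))"

definition L2_norm :: "'g measure \<Rightarrow> ('g \<Rightarrow> complex) \<Rightarrow> real" where
  "L2_norm M f = sqrt (LINT x|M. (cmod (f x))\<^sup>2)"

section \<open>Exponential Lie groups\<close>

fun times_cont_differentiable ::
    "nat \<Rightarrow> ('a::real_normed_vector \<Rightarrow> 'b::real_normed_vector) \<Rightarrow> bool" where
  "times_cont_differentiable 0 f \<longleftrightarrow> continuous_on UNIV f"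
| "times_cont_differentiable (Suc k) f \<longleftrightarrow> (\<forall>x. f differentiable (at x)) \<and>
     (\<forall>v. times_cont_differentiable k (\<lambda>x. frechet_derivative f (at x) v))"

definition smooth_map :: "('a::real_normed_vector \<Rightarrow> 'b::real_normed_vector) \<Rightarrow> bool" where
  "smooth_map f \<longleftrightarrow> (\<forall>k. times_cont_differentiable k f)"

definition Log :: "('a \<Rightarrow> 'g) \<Rightarrow> 'g \<Rightarrow> 'a" where
  "Log Exp = the_inv_into UNIV Exp"

text \<open>The type \<open>'a\<close> is the underlying vector space of the Lie algebra (its norm only serves to name
  the topology; dimension 0 is allowed).  As the exponential map is a diffeomorphism, the manifold
  structure of the group is the one given by the global chart \<open>Log Exp\<close>, the tangent space at the
  identity is \<open>'a\<close>, and \<open>Exp\<close> is the exponential map precisely because \<open>t \<mapsto> Exp (t X)\<close> is the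
  one-parameter group with velocity \<open>X\<close>.  Inversion is \<open>X \<mapsto> -X\<close> in this chart, hence smooth,
  and the group is connected, being homeomorphic to \<open>'a\<close>.\<close>

definition exponential_Lie_group :: "('g, 'm) monoid_scheme \<Rightarrow> ('a::real_normed_vector \<Rightarrow> 'g) \<Rightarrow> bool" where
  "exponential_Lie_group G Exp \<longleftrightarrow>
     group G \<and> (\<exists>B::'a set. finite B \<and> span B = UNIV) \<and>
     bij_betw Exp UNIV (carrier G) \<and>
     (\<forall>s t X. Exp ((s + t) *\<^sub>R X) = Exp (s *\<^sub>R X) \<otimes>\<^bsub>G\<^esub> Exp (t *\<^sub>R X)) \<and>
     smooth_map (\<lambda>(X, Y). Log Exp (Exp X \<otimes>\<^bsub>G\<^esub> Exp Y))"

definition Ad :: "('g, 'm) monoid_scheme \<Rightarrow> ('a::real_normed_vector \<Rightarrow> 'g) \<Rightarrow> 'g \<Rightarrow> 'a \<Rightarrow> 'a" where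
  "Ad G Exp g X =
     vector_derivative (\<lambda>t. Log Exp (g \<otimes>\<^bsub>G\<^esub> Exp (t *\<^sub>R X) \<otimes>\<^bsub>G\<^esub> inv\<^bsub>G\<^esub> g)) (at 0)"

definition Lie_bracket :: "('g, 'm) monoid_scheme \<Rightarrow> ('a::real_normed_vector \<Rightarrow> 'g) \<Rightarrow> 'a \<Rightarrow> 'a \<Rightarrow> 'a" where
  "Lie_bracket G Exp X Y = vector_derivative (\<lambda>t. Ad G Exp (Exp (t *\<^sub>R X)) Y) (at 0)"

text \<open>Elements of the dual of the Lie algebra are the \<open>linear\<close> functions \<open>'a \<Rightarrow> real\<close>.\<close>

definition coadjoint ::
    "('g, 'm) monoid_scheme \<Rightarrow> ('a::real_normed_vector \<Rightarrow> 'g) \<Rightarrow> 'g \<Rightarrow> ('a \<Rightarrow> real) \<Rightarrow> 'a \<Rightarrow> real" where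
  "coadjoint G Exp g Y = (\<lambda>X. Y (Ad G Exp (inv\<^bsub>G\<^esub> g) X))"

definition isotropic_subalgebra ::
    "('g, 'm) monoid_scheme \<Rightarrow> ('a::real_normed_vector \<Rightarrow> 'g) \<Rightarrow> ('a \<Rightarrow> real) \<Rightarrow> 'a set \<Rightarrow> bool" where
  "isotropic_subalgebra G Exp F \<hh> \<longleftrightarrow> subspace \<hh> \<and>
     (\<forall>X\<in>\<hh>. \<forall>Y\<in>\<hh>. Lie_bracket G Exp X Y \<in> \<hh> \<and> F (Lie_bracket G Exp X Y) = 0)"

definition Pukanszky_condition ::
    "('g, 'm) monoid_scheme \<Rightarrow> ('a::real_normed_vector \<Rightarrow> 'g) \<Rightarrow> ('a \<Rightarrow> real) \<Rightarrow> 'a set \<Rightarrow> bool" where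
  "Pukanszky_condition G Exp F \<hh> \<longleftrightarrow>
     {coadjoint G Exp h F | h. h \<in> Exp ` \<hh>} =
     {\<lambda>X. F X + Y X | Y. linear Y \<and> (\<forall>X\<in>\<hh>. Y X = 0)}"

definition Pukanszky_polarization ::
    "('g, 'm) monoid_scheme \<Rightarrow> ('a::real_normed_vector \<Rightarrow> 'g) \<Rightarrow> ('a \<Rightarrow> real) \<Rightarrow> 'a set \<Rightarrow> bool" where
  "Pukanszky_polarization G Exp F \<hh> \<longleftrightarrow>
     isotropic_subalgebra G Exp F \<hh> \<and>
     (\<forall>\<hh>'. isotropic_subalgebra G Exp F \<hh>' \<longrightarrow> dim \<hh>' \<le> dim \<hh>) \<and>
     Pukanszky_condition G Exp F \<hh>"

definition orbit_character :: "('a \<Rightarrow> 'g) \<Rightarrow> ('a \<Rightarrow> real) \<Rightarrow> 'g \<Rightarrow> complex" where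
  "orbit_character Exp F g = exp (- 2 * of_real pi * \<i> * of_real (F (Log Exp g)))"

section \<open>Haar measures\<close>

definition group_borel :: "('g, 'm) monoid_scheme \<Rightarrow> ('a::real_normed_vector \<Rightarrow> 'g) \<Rightarrow> 'g measure" where
  "group_borel G Exp = vimage_algebra (carrier G) (Log Exp) borel"

text \<open>Right Haar measure on a closed subgroup \<open>H\<close>.  Borel measures on these spaces that are finite
  on compact sets are automatically regular.\<close>

definition right_Haar ::
    "('g, 'm) monoid_scheme \<Rightarrow> ('a::real_normed_vector \<Rightarrow> 'g) \<Rightarrow> 'g set \<Rightarrow> 'g measure \<Rightarrow> bool" where
  "right_Haar G Exp H \<nu> \<longleftrightarrow>
     space \<nu> = H \<and> sets \<nu> = sets (restrict_space (group_borel G Exp) H) \<and>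
     emeasure \<nu> H \<noteq> 0 \<and>
     (\<forall>C. compact C \<and> Exp ` C \<subseteq> H \<longrightarrow> emeasure \<nu> (Exp ` C) < \<infinity>) \<and>
     (\<forall>E\<in>sets \<nu>. \<forall>h\<in>H. emeasure \<nu> (E #>\<^bsub>G\<^esub> h) = emeasure \<nu> E)"

text \<open>If \<open>\<nu>\<close> is a right Haar measure, then \<open>\<nu>(h\<^sup>-\<^sup>1E) = \<Delta>(h) \<nu>(E)\<close>, with the modular function
  \<open>\<Delta>\<close> normalised by \<open>\<lambda>(Eh) = \<Delta>(h) \<lambda>(E)\<close> for left Haar measures \<open>\<lambda>\<close>.\<close>

definition modular_fun :: "('g, 'm) monoid_scheme \<Rightarrow> 'g measure \<Rightarrow> 'g \<Rightarrow> real" where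
  "modular_fun G \<nu> h =
     (THE c. 0 < c \<and> (\<forall>E\<in>sets \<nu>. emeasure \<nu> ((inv\<^bsub>G\<^esub> h) <#\<^bsub>G\<^esub> E) = ennreal c * emeasure \<nu> E))"

section \<open>Unitary representations\<close>

definition unitary_representation ::
    "('g, 'm) monoid_scheme \<Rightarrow> ('a::real_normed_vector \<Rightarrow> 'g) \<Rightarrow> ('g \<Rightarrow> 'h::complex_hilbert_space \<Rightarrow> 'h) \<Rightarrow> bool" where
  "unitary_representation G Exp \<pi> \<longleftrightarrow>
     (\<forall>g\<in>carrier G. clinear_on UNIV (\<pi> g) \<and> surj (\<pi> g) \<and>
        (\<forall>\<psi> \<phi>. cinner (\<pi> g \<psi>) (\<pi> g \<phi>) = cinner \<psi> \<phi>)) \<and>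
     (\<forall>g\<in>carrier G. \<forall>h\<in>carrier G. \<pi> (g \<otimes>\<^bsub>G\<^esub> h) = \<pi> g \<circ> \<pi> h) \<and>
     (\<forall>\<psi>. continuous_on UNIV (\<lambda>X. \<pi> (Exp X) \<psi>))"

definition irreducible_representation ::
    "('g, 'm) monoid_scheme \<Rightarrow> ('g \<Rightarrow> 'h::complex_hilbert_space \<Rightarrow> 'h) \<Rightarrow> bool" where
  "irreducible_representation G \<pi> \<longleftrightarrow>
     (\<exists>\<psi>::'h. \<psi> \<noteq> 0) \<and>
     (\<forall>V. csubspace V \<and> closed V \<and> (\<forall>g\<in>carrier G. \<pi> g ` V \<subseteq> V) \<longrightarrow> V = {0} \<or> V = UNIV)"

text \<open>Induction in the sense of Mackey.  The space of \<open>ind\<^sub>H\<^sup>G \<sigma>\<close> consists of the functions \<open>f\<close> on \<open>G\<close>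
  with \<open>f(hx) = (\<Delta>\<^sub>G(h)/\<Delta>\<^sub>H(h))\<^sup>1\<^sup>/\<^sup>2 \<sigma>(h) f(x)\<close> for which \<open>|f|\<^sup>2\<close> has finite integral over
  \<open>H\G\<close>, and \<open>G\<close> acts by right translation.  (The substitution \<open>x \<mapsto> x\<^sup>-\<^sup>1\<close> turns this into the
  realisation on \<open>G/H\<close> with left translations.)  The right invariant integral over \<open>H\G\<close> of
  \<open>p\<close> with \<open>p(hx) = \<Delta>\<^sub>G(h)/\<Delta>\<^sub>H(h) p(x)\<close> is expressed as the integral of \<open>p w\<close> over \<open>G\<close>, where \<open>w\<close> is
  a Bruhat weight; it does not depend on \<open>w\<close>.\<close>

definition Bruhat_weight :: "('g, 'm) monoid_scheme \<Rightarrow> 'g measure \<Rightarrow> 'g measure \<Rightarrow> ('g \<Rightarrow> real) \<Rightarrow> bool" where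
  "Bruhat_weight G \<mu> \<nu> w \<longleftrightarrow>
     w \<in> borel_measurable \<mu> \<and> (\<forall>x\<in>carrier G. 0 \<le> w x) \<and>
     (\<forall>x\<in>carrier G. (\<integral>\<^sup>+h. ennreal (w (h \<otimes>\<^bsub>G\<^esub> x)) \<partial>\<nu>) = 1)"

definition induced_space ::
    "('g, 'm) monoid_scheme \<Rightarrow> 'g measure \<Rightarrow> 'g measure \<Rightarrow> ('g \<Rightarrow> real) \<Rightarrow> ('g \<Rightarrow> complex) \<Rightarrow> ('g \<Rightarrow> complex) set" where
  "induced_space G \<mu> \<nu> w \<sigma> = {f. f \<in> borel_measurable \<mu> \<and>
     (\<forall>h\<in>space \<nu>. \<forall>x\<in>carrier G.
        f (h \<otimes>\<^bsub>G\<^esub> x) = of_real (sqrt (modular_fun G \<mu> h / modular_fun G \<nu> h)) * \<sigma> h * f x) \<and>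
     integrable \<mu> (\<lambda>x. (cmod (f x))\<^sup>2 * w x)}"

text \<open>\<open>\<pi>\<close> is unitarily equivalent to \<open>ind\<^sub>H\<^sup>G \<sigma>\<close>, with intertwining operator \<open>U\<close>.\<close>

definition is_induced_representation ::
    "('g, 'm) monoid_scheme \<Rightarrow> ('a::real_normed_vector \<Rightarrow> 'g) \<Rightarrow> 'g measure \<Rightarrow> 'g set \<Rightarrow> ('g \<Rightarrow> complex) \<Rightarrow>
      ('g \<Rightarrow> 'h::complex_hilbert_space \<Rightarrow> 'h) \<Rightarrow> bool" where
  "is_induced_representation G Exp \<mu> H \<sigma> \<pi> \<longleftrightarrow>
     (\<exists>\<nu> w (U :: 'h \<Rightarrow> 'g \<Rightarrow> complex).
        right_Haar G Exp H \<nu> \<and> Bruhat_weight G \<mu> \<nu> w \<and>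
        (\<forall>\<psi>. U \<psi> \<in> induced_space G \<mu> \<nu> w \<sigma>) \<and>
        (\<forall>c \<psi> \<phi>. AE x in \<mu>. U (c *\<^sub>C \<psi> + \<phi>) x = c * U \<psi> x + U \<phi> x) \<and>
        (\<forall>\<psi> \<phi>. (LINT x|\<mu>. U \<psi> x * cnj (U \<phi> x) * of_real (w x)) = cinner \<psi> \<phi>) \<and>
        (\<forall>f\<in>induced_space G \<mu> \<nu> w \<sigma>. \<exists>\<psi>. AE x in \<mu>. U \<psi> x = f x) \<and>
        (\<forall>g\<in>carrier G. \<forall>\<psi>. AE x in \<mu>. U (\<pi> g \<psi>) x = U \<psi> (x \<otimes>\<^bsub>G\<^esub> g)))"

definition wavelet :: "('g \<Rightarrow> 'h::complex_hilbert_space \<Rightarrow> 'h) \<Rightarrow> 'h \<Rightarrow> 'h \<Rightarrow> 'g \<Rightarrow> complex" where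
  "wavelet \<pi> \<phi> \<psi> x = cinner \<psi> (adj (\<pi> x) \<phi>)"

definition square_integrable_representation ::
    "'g measure \<Rightarrow> ('g \<Rightarrow> 'h::complex_hilbert_space \<Rightarrow> 'h) \<Rightarrow> bool" where
  "square_integrable_representation \<mu> \<pi> \<longleftrightarrow>
     (\<exists>\<phi> \<psi>. \<phi> \<noteq> 0 \<and> \<psi> \<noteq> 0 \<and> wavelet \<pi> \<phi> \<psi> \<in> L2_fun \<mu>)"

text \<open>\<open>T\<close> with domain \<open>V\<close> is the Duflo--Moore operator \<open>\<D>\<^sup>-\<^sup>1\<close>.\<close>

definition is_Duflo_Moore ::
    "'g measure \<Rightarrow> ('g \<Rightarrow> 'h::complex_hilbert_space \<Rightarrow> 'h) \<Rightarrow> 'h set \<Rightarrow> ('h \<Rightarrow> 'h) \<Rightarrow> bool" where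
  "is_Duflo_Moore \<mu> \<pi> V T \<longleftrightarrow>
     positive_selfadjoint V T \<and>
     (\<forall>\<phi>\<in>V. \<forall>\<psi>. wavelet \<pi> \<phi> \<psi> \<in> L2_fun \<mu>) \<and>
     (\<forall>\<phi>\<^sub>1\<in>V. \<forall>\<phi>\<^sub>2\<in>V. \<forall>\<psi>\<^sub>1 \<psi>\<^sub>2.
        L2_inner \<mu> (wavelet \<pi> \<phi>\<^sub>1 \<psi>\<^sub>1) (wavelet \<pi> \<phi>\<^sub>2 \<psi>\<^sub>2) =
        cinner \<psi>\<^sub>1 \<psi>\<^sub>2 * cnj (cinner (T \<phi>\<^sub>1) (T \<phi>\<^sub>2)))"

section \<open>The Fourier--Wigner transform\<close>

text \<open>In the following, \<open>T\<close> with domain \<open>V\<close> stands for \<open>\<D>\<^sup>-\<^sup>1\<close>, so that \<open>\<D>\<close> is \<open>inv_into V T\<close> with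
  domain \<open>T ` V\<close>.\<close>

definition extends_AD ::
    "'h::complex_hilbert_space set \<Rightarrow> ('h \<Rightarrow> 'h) \<Rightarrow> ('h \<Rightarrow> 'h) \<Rightarrow> ('h \<Rightarrow> 'h) \<Rightarrow> bool" where
  "extends_AD V T A S \<longleftrightarrow> S \<in> trace_class \<and> (\<forall>\<eta>\<in>T ` V. S \<eta> = A (inv_into V T \<eta>))"

definition FW_domain ::
    "'h::complex_hilbert_space set \<Rightarrow> ('h \<Rightarrow> 'h) \<Rightarrow> ('h \<Rightarrow> 'h) set" where
  "FW_domain V T = {A \<in> hilbert_schmidt. \<exists>S. extends_AD V T A S}"

definition Fourier_Wigner ::
    "('g \<Rightarrow> 'h::complex_hilbert_space \<Rightarrow> 'h) \<Rightarrow> 'h set \<Rightarrow> ('h \<Rightarrow> 'h) \<Rightarrow> ('h \<Rightarrow> 'h) \<Rightarrow> 'g \<Rightarrow> complex" where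
  "Fourier_Wigner \<pi> V T A x = op_trace ((THE S. extends_AD V T A S) \<circ> \<pi> x)"

text \<open>\<open>\<Phi>\<close> induces a continuous map from the Hilbert--Schmidt operators to \<open>L\<^sup>2\<close> that extends the
  Fourier--Wigner transform.\<close>

definition continuous_FW_extension ::
    "'g measure \<Rightarrow> ('g \<Rightarrow> 'h::complex_hilbert_space \<Rightarrow> 'h) \<Rightarrow> 'h set \<Rightarrow> ('h \<Rightarrow> 'h) \<Rightarrow>
      (('h \<Rightarrow> 'h) \<Rightarrow> 'g \<Rightarrow> complex) \<Rightarrow> bool" where
  "continuous_FW_extension \<mu> \<pi> V T \<Phi> \<longleftrightarrow>
     (\<forall>A\<in>hilbert_schmidt. \<Phi> A \<in> L2_fun \<mu>) \<and>
     (\<forall>A\<in>FW_domain V T. AE x in \<mu>. \<Phi> A x = Fourier_Wigner \<pi> V T A x) \<and>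
     (\<forall>A\<in>hilbert_schmidt. \<forall>\<epsilon>>0. \<exists>\<delta>>0. \<forall>B\<in>hilbert_schmidt.
        hs_norm (\<lambda>\<psi>. B \<psi> - A \<psi>) < \<delta> \<longrightarrow> L2_norm \<mu> (\<lambda>x. \<Phi> B x - \<Phi> A x) < \<epsilon>)"

end

theory Submission
  imports Defs
begin

text \<open>Let \<open>S\<close> be the trace class extension of \<open>A \<D>\<close>.  As \<open>\<D>\<^sup>-\<^sup>1\<close> is self-adjoint, \<open>S\<^sup>*\<close> maps into the domain
  of \<open>\<D>\<^sup>-\<^sup>1\<close> and \<open>\<D>\<^sup>-\<^sup>1 S\<^sup>* = A\<^sup>*\<close>.  Hence \<open>tr (S \<pi>(x)) = \<Sum>e. \<langle>\<pi>(x) e, S\<^sup>* e\<rangle>\<close> is a series of wavelet transforms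
  \<open>W\<^bsub>S\<^sup>*e\<^esub> e\<close>, which by the Duflo--Moore relations are pairwise orthogonal in \<open>L\<^sup>2\<close> with norms
  \<open>\<parallel>A\<^sup>* e\<parallel>\<close>, so that the \<open>L\<^sup>2\<close> norm of the sum is the Hilbert--Schmidt norm of \<open>A\<close>.  Operators of the
  form \<open>\<Sum>i. \<langle>\<cdot>, \<D>\<^sup>-\<^sup>1 v\<^sub>i\<rangle> u\<^sub>i\<close> lie in the domain and are dense, because \<open>\<D>\<^sup>-\<^sup>1\<close> has dense range; the isometry
  therefore extends uniquely.\<close>

section \<open>Complex inner products\<close>

text \<open>Three obstacles shape the proof. Separability is not part of the Hilbert space class,
  yet an orthogonal series of functions has to be summed along a sequence, and countably many almost
  everywhere statements have to be combined; a countable basis is therefore extracted from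
  irreducibility.

  Membership in \<open>trace_class\<close> is expressed by the diagonal of the absolute value of an
  operator. The construction of enough trace class operators thus needs square roots of positive
  operators, and the convergence of \<open>tr(S \<pi>(x))\<close> needs a form of polar
  decomposition. The square root comes from the binomial series of \<open>sqrt(1 - x)\<close>, which
  still converges absolutely at the boundary.

  Finally, \<open>\<D>\<close> makes sense only if \<open>\<D>^{-1}\<close> is injective. This
  follows from the orthogonality relations: a vector killed by \<open>\<D>^{-1}\<close> has null
  wavelet transforms, and unitarity then forces it to vanish. Injectivity and self-adjointness
  together yield the dense range.\<close>

lemma cinner_add_right: "cinner x (y + z) = cinner x y + cinner x (z::'h::complex_hilbert_space)"
  by (metis cinner_add_left cinner_commute complex_cnj_add)

lemma cinner_scaleC_right: "cinner x (a *\<^sub>C y) = cnj a * cinner x (y::'h::complex_hilbert_space)"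
  by (metis cinner_scaleC_left cinner_commute complex_cnj_mult)

lemma cinner_zero_left [simp]: "cinner 0 (y::'h::complex_hilbert_space) = 0"
  by (metis add_0 add_cancel_right_left cinner_add_left)

lemma cinner_zero_right [simp]: "cinner y (0::'h::complex_hilbert_space) = 0"
  by (metis add_0 add_cancel_right_left cinner_add_right)

lemma cinner_minus_left [simp]: "cinner (- x) y = - cinner x (y::'h::complex_hilbert_space)"
  by (metis add.right_inverse add_eq_0_iff cinner_add_left cinner_zero_left)

lemma cinner_minus_right [simp]: "cinner x (- y) = - cinner x (y::'h::complex_hilbert_space)"
  by (metis add.right_inverse add_eq_0_iff cinner_add_right cinner_zero_right)

lemma cinner_diff_left: "cinner (x - y) z = cinner x z - cinner y (z::'h::complex_hilbert_space)"
  by (metis cinner_add_left cinner_minus_left uminus_add_conv_diff add.commute)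

lemma cinner_diff_right: "cinner x (y - z) = cinner x y - cinner x (z::'h::complex_hilbert_space)"
  by (metis cinner_add_right cinner_minus_right uminus_add_conv_diff add.commute)

lemma cinner_scaleR_left: "cinner (r *\<^sub>R x) y = of_real r * cinner x (y::'h::complex_hilbert_space)"
  by (metis cinner_scaleC_left scaleC_of_real)

lemma cinner_scaleR_right: "cinner x (r *\<^sub>R y) = of_real r * cinner x (y::'h::complex_hilbert_space)"
  by (metis cinner_scaleC_right scaleC_of_real complex_cnj_complex_of_real)

lemma cinner_sum_left: "cinner (sum f A) y = (\<Sum>i\<in>A. cinner (f i) (y::'h::complex_hilbert_space))"
  by (induct A rule: infinite_finite_induct) (auto simp: cinner_add_left)

lemma cinner_sum_right: "cinner y (sum f A) = (\<Sum>i\<in>A. cinner (y::'h::complex_hilbert_space) (f i))"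
  by (induct A rule: infinite_finite_induct) (auto simp: cinner_add_right)

lemma scaleC_zero_left [simp]: "0 *\<^sub>C (x::'h::complex_hilbert_space) = 0"
  by (metis of_real_0 scaleC_of_real scaleR_zero_left)

lemma scaleC_zero_right [simp]: "c *\<^sub>C (0::'h::complex_hilbert_space) = 0"
  by (metis add_cancel_right_left add_0 scaleC_add_right)

lemma scaleC_one [simp]: "1 *\<^sub>C (x::'h::complex_hilbert_space) = x"
  by (metis of_real_1 scaleC_of_real scaleR_one)

lemma scaleC_minus_one: "(- 1) *\<^sub>C (x::'h::complex_hilbert_space) = - x"
  by (metis of_real_1 of_real_minus scaleC_of_real scaleR_minus1_left)

lemma scaleC_minus_right: "c *\<^sub>C (- x) = - (c *\<^sub>C (x::'h::complex_hilbert_space))"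
  by (metis mult.commute scaleC_minus_one scaleC_scaleC)

lemma scaleC_diff_right: "c *\<^sub>C (x - y) = c *\<^sub>C x - c *\<^sub>C (y::'h::complex_hilbert_space)"
  by (metis scaleC_add_right scaleC_minus_right uminus_add_conv_diff add.commute)

lemma norm_sq_eq_cinner: "(norm (x::'h::complex_hilbert_space))\<^sup>2 = Re (cinner x x)"
  by (simp add: cinner_self)

lemma norm_scaleC [simp]: "norm (c *\<^sub>C (x::'h::complex_hilbert_space)) = cmod c * norm x"
proof -
  have "complex_of_real ((norm (c *\<^sub>C x))\<^sup>2) = (c * cnj c) * cinner x x"
    by (metis cinner_scaleC_left cinner_scaleC_right cinner_self mult.assoc)
  also have "\<dots> = complex_of_real ((cmod c * norm x)\<^sup>2)"
    by (simp only: cinner_self power_mult_distrib of_real_mult complex_norm_square)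
  finally have "(norm (c *\<^sub>C x))\<^sup>2 = (cmod c * norm x)\<^sup>2"
    using of_real_eq_iff by blast
  then show ?thesis by simp
qed

lemma cinner_eq_zero_iff: "cinner x x = 0 \<longleftrightarrow> (x::'h::complex_hilbert_space) = 0"
  by (simp add: cinner_self)

lemma cmod_cinner_commute: "cmod (cinner x y) = cmod (cinner y (x::'h::complex_hilbert_space))"
  by (metis cinner_commute complex_mod_cnj)

lemma cinner_eqI': "(\<And>z. cinner z x = cinner z y) \<Longrightarrow> x = (y::'h::complex_hilbert_space)"
  by (metis cinner_diff_right cinner_eq_zero_iff right_minus_eq)

lemma pythagoras:
  assumes "cinner x y = 0"
  shows "(norm (x + y))\<^sup>2 = (norm x)\<^sup>2 + (norm (y::'h::complex_hilbert_space))\<^sup>2"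
proof -
  have "cinner y x = 0" using assms by (metis cinner_commute complex_cnj_zero)
  then show ?thesis using assms
    by (simp add: norm_sq_eq_cinner cinner_add_left cinner_add_right)
qed

lemma semi_inner_Cauchy_Schwarz:
  fixes s :: "'h::complex_hilbert_space \<Rightarrow> 'h \<Rightarrow> complex"
  assumes add: "\<And>x y z. s (x + y) z = s x z + s y z"
    and scale: "\<And>c x y. s (c *\<^sub>C x) y = c * s x y"
    and herm: "\<And>x y. s x y = cnj (s y x)"
    and pos: "\<And>x. 0 \<le> Re (s x x)"
  shows "(cmod (s x y))\<^sup>2 \<le> Re (s x x) * Re (s y y)"
proof -
  have addr: "s z (x + y) = s z x + s z y" for x y z
    by (metis add herm complex_cnj_add)
  have scaler: "s z (c *\<^sub>C x) = cnj c * s z x" for c x z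
    by (metis scale herm complex_cnj_mult)
  have re: "s z z = of_real (Re (s z z))" for z
    using herm[of z z] by (simp add: complex_eq_iff)
  have key: "0 \<le> Re (s x x) + 2 * t * (cmod (s x y))\<^sup>2 + t\<^sup>2 * (cmod (s x y))\<^sup>2 * Re (s y y)" for t :: real
  proof -
    \<comment> \<open>The factor \<open>s x y\<close> aligns the phase, so that both cross terms
      become \<open>t\<close> times the squared modulus and a real quadratic in \<open>t\<close>
      remains.\<close>
    define c where "c = of_real t * s x y"
    have "s (x + c *\<^sub>C y) (x + c *\<^sub>C y) = s x x + cnj c * s x y + c * cnj (s x y) + c * cnj c * s y y"
      using herm[of y x] by (simp add: add addr scale scaler algebra_simps)
    also have "\<dots> = s x x + of_real (2 * t) * (s x y * cnj (s x y)) + of_real (t\<^sup>2) * (s x y * cnj (s x y)) * s y y"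
      by (simp add: c_def algebra_simps power2_eq_square)
    also have "Re \<dots> = Re (s x x) + 2 * t * (cmod (s x y))\<^sup>2 + t\<^sup>2 * (cmod (s x y))\<^sup>2 * Re (s y y)"
      unfolding complex_norm_square[symmetric]
      by (subst (1 3) re) (simp flip: of_real_power of_real_mult)
    finally show ?thesis using pos by metis
  qed
  show ?thesis
  proof (cases "Re (s y y) = 0")
    case True
    have "cmod (s x y) = 0"
    proof (rule ccontr)
      assume "cmod (s x y) \<noteq> 0"
      \<comment> \<open>When \<open>s y y\<close> vanishes the quadratic is affine in
        \<open>t\<close>; this \<open>t\<close> gives it the value \<open>- Re (s x x) - 2\<close>,
        which is negative.\<close>
      define t where "t = - (Re (s x x) + 1) / (cmod (s x y))\<^sup>2"
      have t: "t * (cmod (s x y))\<^sup>2 = - (Re (s x x) + 1)"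
        using \<open>cmod (s x y) \<noteq> 0\<close> by (simp add: t_def)
      have "0 \<le> Re (s x x) + 2 * (t * (cmod (s x y))\<^sup>2)"
        using key[of t] True by (simp add: mult.assoc)
      then show False using pos[of x] unfolding t by simp
    qed
    then show ?thesis using True by simp
  next
    case False
    then have p: "Re (s y y) > 0" using pos[of y] by simp
    \<comment> \<open>The minimiser of the quadratic.\<close>
    show ?thesis using key[of "- 1 / Re (s y y)"] p
      by (simp add: field_simps power2_eq_square)
  qed
qed

lemma cinner_Cauchy_Schwarz: "cmod (cinner x y) \<le> norm x * norm (y::'h::complex_hilbert_space)"
proof -
  have "(cmod (cinner x y))\<^sup>2 \<le> (norm x * norm y)\<^sup>2"
    using semi_inner_Cauchy_Schwarz[of cinner x y, OF cinner_add_left cinner_scaleC_left cinner_commute]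
    by (simp add: cinner_self power_mult_distrib)
  then show ?thesis by (rule power2_le_imp_le) simp
qed

lemma bounded_bilinear_cinner: "bounded_bilinear (cinner :: 'h::complex_hilbert_space \<Rightarrow> _)"
  by (rule bounded_bilinear.intro)
    (auto simp: cinner_add_left cinner_add_right cinner_scaleR_left cinner_scaleR_right
      scaleR_conv_of_real intro!: exI[of _ 1] cinner_Cauchy_Schwarz)

lemma bounded_linear_cinner_left: "bounded_linear (\<lambda>x. cinner x (y::'h::complex_hilbert_space))"
  by (rule bounded_bilinear.bounded_linear_left[OF bounded_bilinear_cinner])

lemma bounded_linear_cinner_right: "bounded_linear (\<lambda>y. cinner (x::'h::complex_hilbert_space) y)"
  by (rule bounded_bilinear.bounded_linear_right[OF bounded_bilinear_cinner])

lemmas tendsto_cinner [tendsto_intros] = bounded_bilinear.tendsto[OF bounded_bilinear_cinner]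
lemmas continuous_on_cinner [continuous_intros] =
  bounded_bilinear.continuous_on[OF bounded_bilinear_cinner]

lemma bounded_linear_scaleC_right: "bounded_linear (\<lambda>x. c *\<^sub>C (x::'h::complex_hilbert_space))"
proof (rule bounded_linear_intro[of _ "cmod c"])
  show "c *\<^sub>C (r *\<^sub>R x) = r *\<^sub>R (c *\<^sub>C x)" for r and x :: 'h
    by (metis mult.commute scaleC_of_real scaleC_scaleC)
qed (simp_all add: scaleC_add_right mult.commute)

section \<open>Orthonormal sets\<close>

text \<open>Split off from totality in \<open>is_onb\<close>, because finite subsets of a basis and
  bases of proper subspaces are needed as well.\<close>

definition orthonormal :: "'h::complex_hilbert_space set \<Rightarrow> bool" where
  "orthonormal B \<longleftrightarrow> (\<forall>e\<in>B. \<forall>f\<in>B. cinner e f = (if e = f then 1 else 0))"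

lemma orthonormal_subset: "orthonormal B \<Longrightarrow> C \<subseteq> B \<Longrightarrow> orthonormal C"
  unfolding orthonormal_def by blast

lemma orthonormal_cinner_sum:
  assumes "orthonormal F" "finite F" "e \<in> F"
  shows "cinner (\<Sum>f\<in>F. a f *\<^sub>C f) e = a e"
proof -
  have "cinner (\<Sum>f\<in>F. a f *\<^sub>C f) e = (\<Sum>f\<in>F. if f = e then a f else 0)"
    unfolding cinner_sum_left cinner_scaleC_left
    by (rule sum.cong) (use assms in \<open>auto simp: orthonormal_def\<close>)
  then show ?thesis using assms by simp
qed

lemma norm_orthonormal_sum:
  assumes "orthonormal F" "finite F"
  shows "(norm (\<Sum>f\<in>F. a f *\<^sub>C f))\<^sup>2 = (\<Sum>f\<in>F. (cmod (a f))\<^sup>2)"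
proof -
  have "cinner (\<Sum>f\<in>F. a f *\<^sub>C f) (\<Sum>f\<in>F. a f *\<^sub>C f) = (\<Sum>f\<in>F. cnj (a f) * a f)"
    unfolding cinner_sum_right[of _ _ F] cinner_scaleC_right
    by (rule sum.cong) (use assms in \<open>auto simp: orthonormal_cinner_sum\<close>)
  also have "\<dots> = of_real (\<Sum>f\<in>F. (cmod (a f))\<^sup>2)"
    by (simp only: complex_norm_square of_real_sum mult.commute[of "cnj _"])
  finally show ?thesis by (metis Re_complex_of_real norm_sq_eq_cinner)
qed

text \<open>The residual is orthogonal to every \<open>f\<close> and so to the partial sum;
  Pythagoras then gives Bessel's inequality together with its defect.\<close>

lemma orthonormal_residual:
  assumes "orthonormal F" "finite F"
  shows "(norm x)\<^sup>2 = (\<Sum>f\<in>F. (cmod (cinner x f))\<^sup>2) + (norm (x - (\<Sum>f\<in>F. cinner x f *\<^sub>C f)))\<^sup>2"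
proof -
  let ?p = "\<Sum>f\<in>F. cinner x f *\<^sub>C f"
  have "cinner (x - ?p) f = 0" if "f \<in> F" for f
    using that assms by (simp add: cinner_diff_left orthonormal_cinner_sum)
  then have "cinner (x - ?p) ?p = 0"
    unfolding cinner_sum_right[of _ _ F] by (simp add: cinner_scaleC_right)
  then have "cinner ?p (x - ?p) = 0"
    by (metis cinner_commute complex_cnj_zero)
  from pythagoras[OF this] show ?thesis
    using norm_orthonormal_sum[OF assms] by simp
qed

lemma Bessel_finite:
  assumes "orthonormal F" "finite F"
  shows "(\<Sum>f\<in>F. (cmod (cinner x f))\<^sup>2) \<le> (norm x)\<^sup>2"
  using orthonormal_residual[OF assms, of x] by simp

lemma Bessel_summable:
  assumes "orthonormal B"
  shows "(\<lambda>e. (cmod (cinner x e))\<^sup>2) summable_on B"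
proof (rule nonneg_bdd_above_summable_on)
  show "bdd_above (sum (\<lambda>e. (cmod (cinner x e))\<^sup>2) ` {F. F \<subseteq> B \<and> finite F})"
    by (rule bdd_aboveI2) (use assms in \<open>auto intro!: Bessel_finite[of _ x] intro: orthonormal_subset\<close>)
qed simp

section \<open>Unordered summation in Banach spaces\<close>

lemma summable_on_Cauchy_criterion:
  fixes f :: "'i \<Rightarrow> 'b::banach"
  assumes "\<And>e. e > 0 \<Longrightarrow> \<exists>F. finite F \<and> F \<subseteq> A \<and> (\<forall>G. finite G \<and> G \<subseteq> A - F \<longrightarrow> norm (sum f G) < e)"
  shows "f summable_on A"
proof -
  have "\<exists>P. eventually P (finite_subsets_at_top A) \<and>
      (\<forall>F F'. P F \<and> P F' \<longrightarrow> dist (sum f F) (sum f F') < e)" if e: "e > 0" for e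
  proof -
    obtain F where F: "finite F" "F \<subseteq> A"
      and small: "\<And>G. finite G \<Longrightarrow> G \<subseteq> A - F \<Longrightarrow> norm (sum f G) < e / 2"
      using assms[of "e / 2"] e by auto
    define P where "P H \<longleftrightarrow> finite H \<and> F \<subseteq> H \<and> H \<subseteq> A" for H
    \<comment> \<open>Finite sets containing \<open>F\<close> form a neighbourhood of infinity, and
      the sums over two of them differ only by sums over sets disjoint from \<open>F\<close>. The
      net of partial sums is therefore Cauchy.\<close>
    have "eventually P (finite_subsets_at_top A)"
      unfolding eventually_finite_subsets_at_top P_def using F by auto
    moreover have "dist (sum f H) (sum f H') < e" if "P H \<and> P H'" for H H'
    proof -
      have "sum f K = sum f (K - F) + sum f F" if "P K" for K
        using that by (simp add: P_def sum.subset_diff)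
      then have "dist (sum f H) (sum f H') = norm (sum f (H - F) - sum f (H' - F))"
        using that by (simp add: dist_norm)
      also have "\<dots> \<le> norm (sum f (H - F)) + norm (sum f (H' - F))"
        by (rule norm_triangle_ineq4)
      also have "\<dots> < e / 2 + e / 2"
        by (intro add_strict_mono small) (use that in \<open>auto simp: P_def\<close>)
      finally show ?thesis by simp
    qed
    ultimately show ?thesis by blast
  qed
  then have "cauchy_filter (filtermap (sum f) (finite_subsets_at_top A))"
    by (simp add: cauchy_filter_metric_filtermap)
  then obtain L where "(sum f \<longlongrightarrow> L) (finite_subsets_at_top A)"
    using complete_uniform[where S=UNIV] complete_UNIV_cuspace by (force simp add: filterlim_def)
  then show ?thesis
    using summable_on_def has_sum_def by blast
qed

lemma summable_on_tail_small:
  fixes f :: "'i \<Rightarrow> real"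
  assumes "f summable_on A" "\<And>x. x \<in> A \<Longrightarrow> 0 \<le> f x" "e > 0"
  shows "\<exists>F. finite F \<and> F \<subseteq> A \<and> (\<forall>G. finite G \<and> G \<subseteq> A - F \<longrightarrow> sum f G < e)"
proof -
  obtain F where F: "finite F" "F \<subseteq> A" "dist (sum f F) (infsum f A) \<le> e / 2"
    using infsum_finite_approximation[OF assms(1), of "e / 2"] assms(3) by auto
  have "sum f G < e" if "finite G" "G \<subseteq> A - F" for G
  proof -
    have "sum f F + sum f G = sum f (F \<union> G)"
      by (rule sum.union_disjoint[symmetric]) (use F that in auto)
    also have "\<dots> \<le> infsum f A"
      by (rule finite_sum_le_infsum) (use F that assms in auto)
    finally show ?thesis using F(3) assms(3) unfolding dist_real_def by linarith
  qed
  then show ?thesis using F by blast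
qed

text \<open>The Riesz-Fischer theorem: by orthonormality the squared norm of a finite tail equals
  the tail of the squared coefficients.\<close>

lemma orthonormal_series_summable:
  fixes B :: "'h::complex_hilbert_space set"
  assumes B: "orthonormal B" and a: "(\<lambda>e. (cmod (a e))\<^sup>2) summable_on B"
  shows "(\<lambda>e. a e *\<^sub>C e) summable_on B"
proof (rule summable_on_Cauchy_criterion)
  fix \<epsilon> :: real assume "\<epsilon> > 0"
  then obtain F where F: "finite F" "F \<subseteq> B"
    and small: "\<And>G. finite G \<Longrightarrow> G \<subseteq> B - F \<Longrightarrow> (\<Sum>e\<in>G. (cmod (a e))\<^sup>2) < \<epsilon>\<^sup>2"
    using summable_on_tail_small[OF a, of "\<epsilon>\<^sup>2"] by auto
  have "norm (\<Sum>e\<in>G. a e *\<^sub>C e) < \<epsilon>" if "finite G" "G \<subseteq> B - F" for G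
  proof -
    have "orthonormal G" using B that by (auto intro: orthonormal_subset)
    then have "(norm (\<Sum>e\<in>G. a e *\<^sub>C e))\<^sup>2 < \<epsilon>\<^sup>2"
      using small[OF that] that by (simp add: norm_orthonormal_sum)
    then show ?thesis using \<open>\<epsilon> > 0\<close> by (simp add: power2_less_imp_less)
  qed
  then show "\<exists>F. finite F \<and> F \<subseteq> B \<and> (\<forall>G. finite G \<and> G \<subseteq> B - F \<longrightarrow> norm (\<Sum>e\<in>G. a e *\<^sub>C e) < \<epsilon>)"
    using F by blast
qed

lemma cinner_orthonormal_infsum:
  fixes B :: "'h::complex_hilbert_space set"
  assumes B: "orthonormal B" and a: "(\<lambda>e. (cmod (a e))\<^sup>2) summable_on B" and "f \<in> B"
  shows "cinner (\<Sum>\<^sub>\<infinity>e\<in>B. a e *\<^sub>C e) f = a f"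
proof -
  have "((\<lambda>e. cinner (a e *\<^sub>C e) f) has_sum cinner (\<Sum>\<^sub>\<infinity>e\<in>B. a e *\<^sub>C e) f) B"
    using orthonormal_series_summable[OF B a]
    by (intro has_sum_bounded_linear[OF bounded_linear_cinner_left]) simp
  moreover have "((\<lambda>e. cinner (a e *\<^sub>C e) f) has_sum a f) B"
  proof -
    have "((\<lambda>e. cinner (a e *\<^sub>C e) f) has_sum cinner (a f *\<^sub>C f) f) {f}"
      by (simp add: has_sum_finiteI)
    moreover have "cinner (a f *\<^sub>C f) f = a f"
      using B \<open>f \<in> B\<close> by (simp add: cinner_scaleC_left orthonormal_def)
    moreover have "((\<lambda>e. cinner (a e *\<^sub>C e) f) has_sum a f) B \<longleftrightarrow>
        ((\<lambda>e. cinner (a e *\<^sub>C e) f) has_sum a f) {f}"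
      by (rule has_sum_cong_neutral)
        (use B \<open>f \<in> B\<close> in \<open>auto simp: orthonormal_def cinner_scaleC_left\<close>)
    ultimately show ?thesis by simp
  qed
  ultimately show ?thesis using has_sum_unique by blast
qed

section \<open>Closed subspaces and orthogonal projections\<close>

lemma csubspace_diff: "csubspace M \<Longrightarrow> x \<in> M \<Longrightarrow> y \<in> M \<Longrightarrow> x - y \<in> M"
  unfolding csubspace_def by (metis diff_conv_add_uminus scaleC_minus_one)

lemma csubspace_sum: "csubspace M \<Longrightarrow> (\<And>i. i \<in> A \<Longrightarrow> f i \<in> M) \<Longrightarrow> sum f A \<in> M"
  by (induct A rule: infinite_finite_induct) (auto simp: csubspace_def)

lemma closed_csubspace_infsum:
  assumes "csubspace M" "closed M" "f summable_on A" "\<And>i. i \<in> A \<Longrightarrow> f i \<in> M"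
  shows "infsum f A \<in> M"
proof (rule Lim_in_closed_set[OF assms(2) _ _ infsum_tendsto[OF assms(3)]])
  show "\<forall>\<^sub>F F in finite_subsets_at_top A. sum f F \<in> M"
    by (rule eventually_finite_subsets_at_top_weakI) (use assms in \<open>auto intro: csubspace_sum\<close>)
qed simp

lemma csubspace_closure: "csubspace M \<Longrightarrow> csubspace (closure M)"
proof -
  assume M: "csubspace M"
  have "x + y \<in> closure M" if xy: "x \<in> closure M" "y \<in> closure M" for x y
  proof -
    obtain s t where "\<forall>n. s n \<in> M" "s \<longlonglongrightarrow> x" "\<forall>n. t n \<in> M" "t \<longlonglongrightarrow> y"
      using xy unfolding closure_sequential by metis
    then show ?thesis unfolding closure_sequential
      using M by (intro exI[of _ "\<lambda>n. s n + t n"]) (auto intro: tendsto_add simp: csubspace_def)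
  qed
  moreover have "c *\<^sub>C x \<in> closure M" if x: "x \<in> closure M" for c x
  proof -
    obtain s where "\<forall>n. s n \<in> M" "s \<longlonglongrightarrow> x"
      using x unfolding closure_sequential by metis
    then show ?thesis unfolding closure_sequential
      using M by (intro exI[of _ "\<lambda>n. c *\<^sub>C s n"])
       (auto intro: bounded_linear.tendsto[OF bounded_linear_scaleC_right] simp: csubspace_def)
  qed
  moreover have "0 \<in> closure M" using M closure_subset unfolding csubspace_def by blast
  ultimately show ?thesis unfolding csubspace_def by blast
qed

text \<open>Zorn's lemma. A nonzero \<open>x\<close> in \<open>M\<close> orthogonal to a maximal set
  could be normalised and added to it. The relative version serves twice: \<open>M = UNIV\<close>
  gives a basis of the space, closed \<open>M\<close> gives projections.\<close>

lemma ex_maximal_orthonormal: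
  assumes "csubspace (M :: 'h::complex_hilbert_space set)"
  shows "\<exists>B. orthonormal B \<and> B \<subseteq> M \<and> (\<forall>x\<in>M. (\<forall>e\<in>B. cinner x e = 0) \<longrightarrow> x = 0)"
proof -
  define \<A> where "\<A> = {B. orthonormal B \<and> B \<subseteq> M}"
  have "\<exists>B\<in>\<A>. \<forall>X\<in>\<A>. B \<subseteq> X \<longrightarrow> X = B"
  proof (rule subset_Zorn')
    fix C assume C: "subset.chain \<A> C"
    have "cinner e f = (if e = f then 1 else 0)" if ef: "e \<in> \<Union>C" "f \<in> \<Union>C" for e f
    proof -
      obtain X Y where "X \<in> C" "Y \<in> C" "e \<in> X" "f \<in> Y" using ef by auto
      moreover from this have "X \<subseteq> Y \<or> Y \<subseteq> X" using C by (auto simp: subset_chain_def)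
      ultimately obtain Z where "Z \<in> C" "e \<in> Z" "f \<in> Z" by blast
      moreover from this have "orthonormal Z" using C by (auto simp: subset_chain_def \<A>_def)
      ultimately show ?thesis unfolding orthonormal_def by blast
    qed
    moreover have "\<Union>C \<subseteq> M" using C unfolding subset_chain_def \<A>_def by blast
    ultimately show "\<Union>C \<in> \<A>" unfolding \<A>_def orthonormal_def by blast
  qed
  then obtain B where "B \<in> \<A>" and max: "\<And>X. X \<in> \<A> \<Longrightarrow> B \<subseteq> X \<Longrightarrow> X = B"
    by metis
  then have B: "orthonormal B" "B \<subseteq> M" by (auto simp: \<A>_def)
  have "x = 0" if x: "x \<in> M" "\<forall>e\<in>B. cinner x e = 0" for x
  proof (rule ccontr)
    assume "x \<noteq> 0"
    define u where "u = complex_of_real (1 / norm x) *\<^sub>C x"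
    have "norm u = 1" using \<open>x \<noteq> 0\<close> by (simp add: u_def norm_divide)
    then have uu: "cinner u u = 1" by (simp add: cinner_self)
    have ue: "cinner u e = 0 \<and> cinner e u = 0" if "e \<in> B" for e
    proof -
      have "cinner u e = 0" using x that by (simp add: u_def cinner_scaleC_left)
      then show ?thesis by (metis cinner_commute complex_cnj_zero)
    qed
    have "u \<in> M" using assms x unfolding u_def csubspace_def by blast
    have "u \<notin> B" using ue uu by force
    then have "orthonormal (insert u B)"
      using B(1) uu ue unfolding orthonormal_def by auto
    then have "insert u B \<in> \<A>"
      using B(2) \<open>u \<in> M\<close> unfolding \<A>_def by blast
    then show False using max \<open>u \<notin> B\<close> by blast
  qed
  then show ?thesis using B by blast
qed

lemma is_onb_iff: "is_onb B \<longleftrightarrow> orthonormal B \<and> (\<forall>x. (\<forall>e\<in>B. cinner x e = 0) \<longrightarrow> x = 0)"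
  by (simp add: is_onb_def orthonormal_def)

lemma is_onb_onb: "is_onb (onb :: 'h::complex_hilbert_space set)"
proof -
  have "csubspace (UNIV :: 'h set)" by (simp add: csubspace_def)
  then have "\<exists>B::'h set. is_onb B"
    using ex_maximal_orthonormal[of UNIV] by (auto simp: is_onb_iff)
  then show ?thesis unfolding onb_def by (rule someI_ex)
qed

lemma orthonormal_onb: "orthonormal (onb :: 'h::complex_hilbert_space set)"
  and onb_total: "(\<And>e. e \<in> onb \<Longrightarrow> cinner x e = 0) \<Longrightarrow> x = (0::'h)"
  using is_onb_onb by (auto simp: is_onb_iff)

lemma orthogonal_projection:
  assumes M: "csubspace (M :: 'h::complex_hilbert_space set)" "closed M"
  obtains p where "p \<in> M" "\<And>y. y \<in> M \<Longrightarrow> cinner (x - p) y = 0"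
proof -
  obtain B where B: "orthonormal B" "B \<subseteq> M" and tot: "\<And>x. x \<in> M \<Longrightarrow> (\<forall>e\<in>B. cinner x e = 0) \<Longrightarrow> x = 0"
    using ex_maximal_orthonormal[OF M(1)] by blast
  define p where "p z = (\<Sum>\<^sub>\<infinity>e\<in>B. cinner z e *\<^sub>C e)" for z
  have summ: "(\<lambda>e. cinner z e *\<^sub>C e) summable_on B" for z
    by (rule orthonormal_series_summable[OF B(1) Bessel_summable[OF B(1)]])
  have pM: "p z \<in> M" for z
    unfolding p_def by (rule closed_csubspace_infsum[OF M summ]) (use B M in \<open>auto simp: csubspace_def\<close>)
  have res: "cinner (z - p z) e = 0" if "e \<in> B" for z e
    using cinner_orthonormal_infsum[OF B(1) Bessel_summable[OF B(1)] that]
    by (simp add: p_def cinner_diff_left)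
  \<comment> \<open>For \<open>y\<close> in \<open>M\<close> the residual lies in \<open>M\<close>
    again and is orthogonal to \<open>B\<close>, so totality of \<open>B\<close> inside
    \<open>M\<close> kills it.\<close>
  have p_fix: "p y = y" if "y \<in> M" for y
    using tot[of "y - p y"] res csubspace_diff[OF M(1) that pM] by auto
  have "cinner (x - p x) y = 0" if "y \<in> M" for y
  proof -
    have "((\<lambda>e. cinner (x - p x) (cinner y e *\<^sub>C e)) has_sum cinner (x - p x) (p y)) B"
      unfolding p_def[of y]
      by (intro has_sum_bounded_linear[OF bounded_linear_cinner_right]) (simp add: summ)
    moreover have "((\<lambda>e. cinner (x - p x) (cinner y e *\<^sub>C e)) has_sum 0) B"
      by (rule has_sum_0) (simp add: cinner_scaleC_right res)
    ultimately show ?thesis using has_sum_unique p_fix[OF that] by metis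
  qed
  then show thesis using that pM by blast
qed

text \<open>The residual of the projection onto the closure annihilates \<open>M\<close>, hence is
  zero.\<close>

lemma dense_csubspace:
  assumes "csubspace M" "\<And>x. (\<And>y. y \<in> M \<Longrightarrow> cinner x y = 0) \<Longrightarrow> x = 0"
  shows "closure M = UNIV"
proof -
  have "x \<in> closure M" for x
  proof -
    obtain p where p: "p \<in> closure M" "\<And>y. y \<in> closure M \<Longrightarrow> cinner (x - p) y = 0"
      using orthogonal_projection[OF csubspace_closure[OF assms(1)] closed_closure, of x] by blast
    then have "x - p = 0" using assms(2) closure_subset by blast
    then show ?thesis using p by simp
  qed
  then show ?thesis by blast
qed

section \<open>Fourier expansion and Parseval's identity\<close>

lemma onb_expansion: "((\<lambda>e. cinner x e *\<^sub>C e) has_sum x) (onb :: 'h::complex_hilbert_space set)"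
proof -
  have summ: "(\<lambda>e. cinner x e *\<^sub>C e) summable_on onb"
    by (rule orthonormal_series_summable[OF orthonormal_onb Bessel_summable[OF orthonormal_onb]])
  have "x - (\<Sum>\<^sub>\<infinity>e\<in>onb. cinner x e *\<^sub>C e) = 0"
    by (rule onb_total)
      (simp add: cinner_diff_left cinner_orthonormal_infsum[OF orthonormal_onb Bessel_summable[OF orthonormal_onb]])
  then show ?thesis using summ by (metis has_sum_infsum right_minus_eq)
qed

lemma Parseval_cinner: "((\<lambda>e. cinner x e * cinner e y) has_sum cinner x y) (onb :: 'h::complex_hilbert_space set)"
  using has_sum_bounded_linear[OF bounded_linear_cinner_left onb_expansion] by (simp add: cinner_scaleC_left)

lemma Parseval: "((\<lambda>e. (cmod (cinner x e))\<^sup>2) has_sum (norm x)\<^sup>2) (onb :: 'h::complex_hilbert_space set)"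
proof -
  have "((\<lambda>e. Re (cinner x e * cinner e x)) has_sum Re (cinner x x)) onb"
    by (rule has_sum_Re[OF Parseval_cinner])
  moreover have "Re (cinner x e * cinner e x) = (cmod (cinner x e))\<^sup>2" for e
    by (metis Re_complex_of_real cinner_commute complex_norm_square)
  ultimately show ?thesis by (simp add: norm_sq_eq_cinner)
qed

no_notation Infinite_Set_Sum.abs_summable_on (infix "abs'_summable'_on" 50)

section \<open>Bounded operators and adjoints\<close>

lemma bounded_clinearI:
  assumes "\<And>x y. T (x + y) = T x + T y" "\<And>c x. T (c *\<^sub>C x) = c *\<^sub>C T x"
    "\<And>x. norm (T x) \<le> C * norm x"
  shows "bounded_clinear T"
  using assms by (auto simp: bounded_clinear_def clinear_on_def)

lemma
  assumes "bounded_clinear T"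
  shows bounded_clinear_add: "T (x + y) = T x + T y"
    and bounded_clinear_scaleC: "T (c *\<^sub>C x) = c *\<^sub>C T x"
  using assms by (auto simp: bounded_clinear_def clinear_on_def)

lemma bounded_clinear_bound:
  assumes "bounded_clinear T"
  obtains C where "C > 0" "\<And>x. norm (T x) \<le> C * norm x"
proof -
  obtain C where C: "\<And>x. norm (T x) \<le> C * norm x"
    using assms by (auto simp: bounded_clinear_def)
  have "norm (T x) \<le> (max C 1) * norm x" for x
    using C[of x] by (rule order_trans) (simp add: mult_right_mono)
  then show thesis using that[of "max C 1"] by auto
qed

lemma bounded_clinear_bounded_linear:
  assumes "bounded_clinear T"
  shows "bounded_linear T"
proof -
  obtain C where "\<And>x. norm (T x) \<le> C * norm x"
    using bounded_clinear_bound[OF assms] by blast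
  then show ?thesis
    using bounded_clinear_add[OF assms] bounded_clinear_scaleC[OF assms]
    by (intro bounded_linear_intro[where K=C]) (metis scaleC_of_real mult.commute)+
qed

lemma
  assumes "bounded_clinear T"
  shows bounded_clinear_zero: "T 0 = 0"
    and bounded_clinear_diff: "T (x - y) = T x - T y"
    and bounded_clinear_sum: "T (sum f A) = (\<Sum>i\<in>A. T (f i))"
  using bounded_clinear_bounded_linear[OF assms, THEN bounded_linear.linear]
  by (simp_all add: linear_0 linear_diff linear_sum)

lemma bounded_clinear_comp:
  assumes "bounded_clinear S" "bounded_clinear T"
  shows "bounded_clinear (\<lambda>x. S (T x))"
proof -
  obtain C where C: "C > 0" "\<And>x. norm (S x) \<le> C * norm x" using bounded_clinear_bound[OF assms(1)] by metis
  obtain D where D: "D > 0" "\<And>x. norm (T x) \<le> D * norm x" using bounded_clinear_bound[OF assms(2)] by metis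
  show ?thesis
  proof (rule bounded_clinearI[where C="C * D"])
    fix x
    have "norm (S (T x)) \<le> C * norm (T x)" by (rule C)
    also have "\<dots> \<le> C * (D * norm x)" using C D by simp
    finally show "norm (S (T x)) \<le> C * D * norm x" by simp
  qed (simp_all add: bounded_clinear_add[OF assms(1)] bounded_clinear_add[OF assms(2)]
      bounded_clinear_scaleC[OF assms(1)] bounded_clinear_scaleC[OF assms(2)])
qed

lemma bounded_clinear_plus:
  assumes "bounded_clinear S" "bounded_clinear T"
  shows "bounded_clinear (\<lambda>x. S x + T x)"
proof -
  obtain C where C: "C > 0" "\<And>x. norm (S x) \<le> C * norm x" using bounded_clinear_bound[OF assms(1)] by metis
  obtain D where D: "D > 0" "\<And>x. norm (T x) \<le> D * norm x" using bounded_clinear_bound[OF assms(2)] by metis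
  show ?thesis
  proof (rule bounded_clinearI[where C="C + D"])
    show "norm (S x + T x) \<le> (C + D) * norm x" for x
      using norm_triangle_le[OF add_mono[OF C(2) D(2)]] by (simp add: distrib_right)
  qed (simp_all add: bounded_clinear_add[OF assms(1)] bounded_clinear_add[OF assms(2)]
      bounded_clinear_scaleC[OF assms(1)] bounded_clinear_scaleC[OF assms(2)] scaleC_add_right)
qed

lemma bounded_clinear_id: "bounded_clinear (\<lambda>x. x)"
  by (rule bounded_clinearI[where C=1]) auto

lemma bounded_clinear_scale:
  assumes "bounded_clinear T"
  shows "bounded_clinear (\<lambda>x. c *\<^sub>C T x)"
proof -
  have "bounded_clinear (\<lambda>x::'a. c *\<^sub>C x)"
    by (rule bounded_clinearI[where C="cmod c"]) (auto simp: scaleC_add_right scaleC_scaleC mult.commute)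
  from bounded_clinear_comp[OF this assms] show ?thesis .
qed

lemma bounded_clinear_minus:
  assumes "bounded_clinear S" "bounded_clinear T"
  shows "bounded_clinear (\<lambda>x. S x - T x)"
  using bounded_clinear_plus[OF assms(1) bounded_clinear_scale[OF assms(2), of "-1"]]
  by (simp add: scaleC_minus_one)

lemma bounded_clinear_rank_one: "bounded_clinear (\<lambda>x. cinner x v *\<^sub>C u)"
proof (rule bounded_clinearI[where C="norm v * norm u"])
  show "norm (cinner x v *\<^sub>C u) \<le> norm v * norm u * norm x" for x
    using mult_right_mono[OF cinner_Cauchy_Schwarz[of x v] norm_ge_zero[of u]]
    by (simp add: mult.commute mult.left_commute)
qed (simp_all add: cinner_add_left cinner_scaleC_left scaleC_add_left scaleC_scaleC)

lemma bounded_clinear_finite_rank: "bounded_clinear (\<lambda>x. \<Sum>i\<in>I. cinner x (v i) *\<^sub>C u i)"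
proof (induct I rule: infinite_finite_induct)
  case (insert i I)
  then show ?case
    using bounded_clinear_plus[OF bounded_clinear_rank_one[of "v i" "u i"]] by simp
qed (rule bounded_clinearI[where C=0]; simp)+

text \<open>Riesz representation, with the representing vector given by its Fourier series.\<close>

lemma ex_adj:
  fixes T :: "'h::complex_hilbert_space \<Rightarrow> 'h"
  assumes T: "bounded_clinear T"
  shows "\<exists>S. \<forall>x y. cinner (T x) y = cinner x (S y)"
proof -
  obtain C where C: "C > 0" "\<And>x. norm (T x) \<le> C * norm x"
    using bounded_clinear_bound[OF assms] by blast
  have "\<exists>w. \<forall>x. cinner (T x) y = cinner x w" for y
  proof -
    \<comment> \<open>The coefficients are forced: the representing vector \<open>w\<close> must
      satisfy \<open><w, e> = <y, T e>\<close>.\<close>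
    define a where "a e = cinner y (T e)" for e
    have bound: "(\<Sum>e\<in>F. (cmod (a e))\<^sup>2) \<le> (C * norm y)\<^sup>2" if F: "F \<subseteq> onb" "finite F" for F
    proof -
      define s where "s = (\<Sum>e\<in>F. (cmod (a e))\<^sup>2)"
      \<comment> \<open>With this test vector \<open><T v, y>\<close> equals the squared norm of
        \<open>v\<close>. Cauchy-Schwarz and the bound on \<open>T\<close> then give
        \<open>norm v \<le> C * norm y\<close>, uniformly in \<open>F\<close>.\<close>
      define v where "v = (\<Sum>e\<in>F. a e *\<^sub>C e)"
      have "s \<ge> 0" by (simp add: s_def sum_nonneg)
      have nv: "(norm v)\<^sup>2 = s"
        unfolding v_def s_def using F orthonormal_subset[OF orthonormal_onb]
        by (intro norm_orthonormal_sum) auto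
      have "cinner (T v) y = (\<Sum>e\<in>F. a e * cnj (a e))"
        unfolding v_def bounded_clinear_sum[OF T] bounded_clinear_scaleC[OF T] cinner_sum_left
          cinner_scaleC_left a_def by (metis cinner_commute)
      also have "\<dots> = of_real s"
        by (simp only: s_def of_real_sum complex_norm_square)
      finally have "s = cmod (cinner (T v) y)" using \<open>s \<ge> 0\<close> by simp
      also have "\<dots> \<le> norm (T v) * norm y" by (rule cinner_Cauchy_Schwarz)
      also have "\<dots> \<le> C * norm v * norm y" by (intro mult_right_mono C) simp
      finally have "s \<le> (C * norm y) * norm v" by (simp add: mult.commute mult.left_commute)
      then have "(norm v) * norm v \<le> (C * norm y) * norm v" using nv by (simp add: power2_eq_square)
      then have "norm v \<le> C * norm y"
        using C(1) by (metis mult_nonneg_nonneg less_imp_le mult_le_cancel_right norm_ge_zero norm_le_zero_iff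
            norm_zero not_less zero_less_norm_iff)
      then show ?thesis using nv power_mono[of "norm v" "C * norm y" 2] by (simp add: s_def)
    qed
    have summ: "(\<lambda>e. (cmod (a e))\<^sup>2) summable_on onb"
      by (rule nonneg_bdd_above_summable_on) (auto intro!: bdd_aboveI2 bound)
    define w where "w = (\<Sum>\<^sub>\<infinity>e\<in>onb. a e *\<^sub>C e)"
    have we: "cinner e w = cinner (T e) y" if "e \<in> onb" for e
      using cinner_orthonormal_infsum[OF orthonormal_onb summ that] unfolding w_def a_def
      by (metis cinner_commute)
    have "cinner (T x) y = cinner x w" for x
    proof -
      have "((\<lambda>e. cinner (T (cinner x e *\<^sub>C e)) y) has_sum cinner (T x) y) onb"
        by (intro has_sum_bounded_linear[OF bounded_linear_cinner_left]
            has_sum_bounded_linear[OF bounded_clinear_bounded_linear[OF T]] onb_expansion)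
      moreover have "((\<lambda>e. cinner (cinner x e *\<^sub>C e) w) has_sum cinner x w) onb"
        by (intro has_sum_bounded_linear[OF bounded_linear_cinner_left] onb_expansion)
      moreover have "cinner (T (cinner x e *\<^sub>C e)) y = cinner (cinner x e *\<^sub>C e) w" if "e \<in> onb" for e
        using we[OF that] by (simp add: bounded_clinear_scaleC[OF T] cinner_scaleC_left)
      ultimately show ?thesis using has_sum_cong has_sum_unique by (metis (no_types, lifting))
    qed
    then show ?thesis by blast
  qed
  then show ?thesis by metis
qed

lemma adjI:
  fixes T :: "'h::complex_hilbert_space \<Rightarrow> 'h"
  assumes "\<And>x y. cinner (T x) y = cinner x (S y)"
  shows "adj T = S"
  unfolding adj_def
proof (rule the_equality)
  fix S' assume "\<forall>x y. cinner (T x) y = cinner x (S' y)"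
  then have "cinner z (S' y) = cinner z (S y)" for z y using assms by metis
  then show "S' = S" by (blast intro: ext cinner_eqI')
qed (use assms in blast)

lemma cinner_adj_right: "bounded_clinear T \<Longrightarrow> cinner x (adj T y) = cinner (T x) y"
  using ex_adj[of T] adjI[of T] by metis

lemma cinner_adj_left: "bounded_clinear T \<Longrightarrow> cinner (adj T x) y = cinner x (T y)"
  by (metis cinner_adj_right cinner_commute)

lemma bounded_clinear_adj:
  assumes T: "bounded_clinear T"
  shows "bounded_clinear (adj T)"
proof -
  obtain C where C: "C > 0" "\<And>x. norm (T x) \<le> C * norm x"
    using bounded_clinear_bound[OF assms] by blast
  show ?thesis
  proof (rule bounded_clinearI[where C=C])
    fix x
    have "(norm (adj T x))\<^sup>2 = cmod (cinner (T (adj T x)) x)"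
      by (simp add: cinner_adj_right[OF T, symmetric] cinner_self norm_power)
    also have "\<dots> \<le> norm (T (adj T x)) * norm x" by (rule cinner_Cauchy_Schwarz)
    also have "\<dots> \<le> C * norm (adj T x) * norm x" by (intro mult_right_mono C) simp
    finally have "norm (adj T x) * norm (adj T x) \<le> (C * norm x) * norm (adj T x)"
      by (simp add: power2_eq_square mult.commute mult.left_commute)
    then show "norm (adj T x) \<le> C * norm x"
      using C(1) by (cases "adj T x = 0") auto
  next
    show "adj T (x + y) = adj T x + adj T y" for x y
      by (rule cinner_eqI') (simp add: cinner_adj_right[OF T] cinner_add_right)
    show "adj T (c *\<^sub>C x) = c *\<^sub>C adj T x" for c x
      by (rule cinner_eqI') (simp add: cinner_adj_right[OF T] cinner_scaleC_right)
  qed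
qed

lemma adj_adj: "bounded_clinear T \<Longrightarrow> adj (adj T) = T"
  by (rule adjI) (rule cinner_adj_left)

section \<open>Positive operators and square roots\<close>

text \<open>Polarisation: since diagonal values are real, expansion at \<open>x + y\<close> gives
  equality of imaginary parts, and replacing \<open>x\<close> by \<open>\<i> x\<close> turns
  imaginary parts into real parts.\<close>

lemma positive_selfadj:
  assumes P: "bounded_clinear P" "positive_on UNIV P"
  shows "cinner (P x) y = cinner x (P y)"
proof -
  have im: "Im (cinner (P z) z) = 0" for z
    using P(2) by (auto simp: positive_on_def complex_is_Real_iff)
  have *: "Im (cinner (P x) y) = Im (cinner x (P y))" for x y
  proof -
    have "Im (cinner (P (x + y)) (x + y)) = Im (cinner (P x) y) + Im (cinner (P y) x)"
      using im[of x] im[of y] by (simp add: bounded_clinear_add[OF P(1)] cinner_add_left cinner_add_right)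
    then have "Im (cinner (P x) y) = - Im (cinner (P y) x)" using im[of "x + y"] by simp
    also have "\<dots> = Im (cinner x (P y))" using cinner_commute[of x "P y"] by simp
    finally show ?thesis .
  qed
  have "Re (cinner (P x) y) = Re (cinner x (P y))"
    using *[of "\<i> *\<^sub>C x" y] by (simp add: bounded_clinear_scaleC[OF P(1)] cinner_scaleC_left)
  then show ?thesis using *[of x y] by (simp add: complex_eq_iff)
qed

lemma positive_Cauchy_Schwarz:
  assumes P: "bounded_clinear P" "positive_on UNIV P"
  shows "(cmod (cinner (P x) y))\<^sup>2 \<le> Re (cinner (P x) x) * Re (cinner (P y) y)"
proof (rule semi_inner_Cauchy_Schwarz[of "\<lambda>x y. cinner (P x) y"])
  show "cinner (P x) y = cnj (cinner (P y) x)" for x y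
    using positive_selfadj[OF P] by (metis cinner_commute)
qed (use P(2) in \<open>simp_all add: bounded_clinear_add[OF P(1)] bounded_clinear_scaleC[OF P(1)]
    cinner_add_left cinner_scaleC_left positive_on_def\<close>)

text \<open>Cauchy-Schwarz for the form \<open><P x, y>\<close> at the pair \<open>x\<close>,
  \<open>P x\<close> bounds the fourth power of \<open>norm (P x)\<close> by \<open><P x, x>\<close>
  times \<open><P (P x), P x>\<close>, and the hypothesis controls both factors. A bound on the
  quadratic form thus becomes an operator bound.\<close>

lemma positive_norm_bound:
  assumes P: "bounded_clinear P" "positive_on UNIV P"
    and le: "\<And>x. Re (cinner (P x) x) \<le> (norm x)\<^sup>2"
  shows "norm (P x) \<le> norm x"
proof -
  have "((norm (P x))\<^sup>2)\<^sup>2 = (cmod (cinner (P x) (P x)))\<^sup>2" by (simp add: cinner_self norm_power)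
  also have "\<dots> \<le> Re (cinner (P x) x) * Re (cinner (P (P x)) (P x))"
    by (rule positive_Cauchy_Schwarz[OF P])
  also have "\<dots> \<le> (norm x)\<^sup>2 * (norm (P x))\<^sup>2"
    by (intro mult_mono le) (use P(2) in \<open>auto simp: positive_on_def\<close>)
  finally have "(norm (P x))\<^sup>2 * (norm (P x))\<^sup>2 \<le> (norm x)\<^sup>2 * (norm (P x))\<^sup>2"
    by (simp add: power2_eq_square)
  then have "P x = 0 \<or> (norm (P x))\<^sup>2 \<le> (norm x)\<^sup>2"
    by (metis mult_le_cancel_right_pos zero_less_norm_iff zero_less_power)
  then show ?thesis by (auto intro: power2_le_imp_le)
qed

text \<open>The coefficients of the power series of the square root of \<open>1 - x\<close>.\<close>

definition sqrt_coeff :: "nat \<Rightarrow> real" where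
  "sqrt_coeff n = (- 1) ^ n * ((1 / 2) gchoose n)"

lemma alternating_gbinomial_Suc:
  "(- 1) ^ Suc k * (a gchoose Suc k) = (real k - a) / real (Suc k) * ((- 1) ^ k * (a gchoose k))"
proof -
  have "real (Suc k) * (a gchoose Suc k) = (a - real k) * (a gchoose k)"
    using gbinomial_mult_1[of a k] by (simp add: left_diff_distrib del: of_nat_Suc)
  then have "(a gchoose Suc k) = (a - real k) * (a gchoose k) / real (Suc k)"
    by (simp add: field_simps del: of_nat_Suc)
  moreover have "- (a - real k) = real k - a" by simp
  ultimately show ?thesis by (metis (no_types, lifting) minus_mult_commute mult.commute mult.left_commute
      mult_minus1 power_Suc times_divide_eq_left)
qed

lemma sqrt_coeff_0 [simp]: "sqrt_coeff 0 = 1"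
  by (simp add: sqrt_coeff_def)

text \<open>The first coefficient after the constant is \<open>- 1 / 2\<close>, and from there on
  the ratio of consecutive coefficients is positive.\<close>

lemma sqrt_coeff_Suc_nonpos: "sqrt_coeff (Suc n) \<le> 0"
proof (induct n)
  case 0
  then show ?case by (simp add: sqrt_coeff_def)
next
  case (Suc n)
  have "sqrt_coeff (Suc (Suc n)) = (real (Suc n) - 1 / 2) / real (Suc (Suc n)) * sqrt_coeff (Suc n)"
    unfolding sqrt_coeff_def by (rule alternating_gbinomial_Suc)
  also have "\<dots> \<le> 0" using Suc by (intro mult_nonneg_nonpos divide_nonneg_nonneg) auto
  finally show ?case .
qed

text \<open>A partial alternating sum of the binomial coefficients of \<open>1 / 2\<close> collapses
  to a single signed binomial coefficient of \<open>- 1 / 2\<close>, whose recurrence has only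
  positive factors.\<close>

lemma sum_sqrt_coeff_nonneg: "0 \<le> (\<Sum>k\<le>m. sqrt_coeff k)"
proof -
  have "0 \<le> (- 1) ^ m * ((- 1 / 2 :: real) gchoose m)"
  proof (induct m)
    case (Suc m)
    show ?case unfolding alternating_gbinomial_Suc
      by (rule mult_nonneg_nonneg[OF divide_nonneg_nonneg Suc]) auto
  qed simp
  then show ?thesis
    using gbinomial_sum_lower_neg[of "1 / 2 :: real" m] by (simp add: sqrt_coeff_def mult.commute)
qed

text \<open>The constant term \<open>1\<close> is the only positive coefficient, so the absolute sum
  is \<open>2\<close> minus the plain sum, which is nonnegative.\<close>

lemma sum_abs_sqrt_coeff: "(\<Sum>k\<le>m. \<bar>sqrt_coeff k\<bar>) \<le> 2"
proof -
  have "(\<Sum>k\<le>m. \<bar>sqrt_coeff k\<bar>) = 2 - (\<Sum>k\<le>m. sqrt_coeff k)"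
    by (induct m) (use sqrt_coeff_Suc_nonpos in \<open>simp_all add: abs_of_nonpos\<close>)
  then show ?thesis using sum_sqrt_coeff_nonneg[of m] by simp
qed

lemma sqrt_coeff_abs_summable: "sqrt_coeff abs_summable_on UNIV"
proof (rule nonneg_bdd_above_summable_on)
  show "bdd_above (sum (\<lambda>x. norm (sqrt_coeff x)) ` {F. F \<subseteq> UNIV \<and> finite F})"
  proof (rule bdd_aboveI2[where M=2])
    fix F :: "nat set" assume "F \<in> {F. F \<subseteq> UNIV \<and> finite F}"
    then have "(\<Sum>k\<in>F. norm (sqrt_coeff k)) \<le> (\<Sum>k\<le>Max (insert 0 F). \<bar>sqrt_coeff k\<bar>)"
      by (simp) (rule sum_mono2, auto)
    also have "\<dots> \<le> 2" by (rule sum_abs_sqrt_coeff)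
    finally show "(\<Sum>k\<in>F. norm (sqrt_coeff k)) \<le> 2" .
  qed
qed simp

text \<open>The Cauchy square of the series is \<open>1 - x\<close>, by Vandermonde's identity for
  \<open>1 / 2 + 1 / 2 = 1\<close>.\<close>

lemma sqrt_coeff_convolution:
  "(\<Sum>i\<le>n. sqrt_coeff i * sqrt_coeff (n - i)) = (if n = 0 then 1 else if n = 1 then - 1 else 0)"
proof -
  have "(\<Sum>i\<le>n. sqrt_coeff i * sqrt_coeff (n - i))
      = (\<Sum>i\<le>n. (- 1) ^ n * (((1 / 2) gchoose i) * ((1 / 2) gchoose (n - i))))"
  proof (rule sum.cong[OF refl])
    fix i assume "i \<in> {..n}"
    then have "(- 1 :: real) ^ i * (- 1) ^ (n - i) = (- 1) ^ n"
      by (simp flip: power_add)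
    moreover have "sqrt_coeff i * sqrt_coeff (n - i)
        = ((- 1) ^ i * (- 1) ^ (n - i)) * (((1 / 2) gchoose i) * ((1 / 2) gchoose (n - i)))"
      by (simp only: sqrt_coeff_def ac_simps)
    ultimately show "sqrt_coeff i * sqrt_coeff (n - i)
        = (- 1) ^ n * (((1 / 2) gchoose i) * ((1 / 2) gchoose (n - i)))" by simp
  qed
  also have "\<dots> = (- 1) ^ n * ((1::real) gchoose n)"
    using gbinomial_Vandermonde[of "1/2::real" "1/2" n]
    by (simp add: atMost_atLeast0 flip: sum_distrib_left)
  also have "\<dots> = (if n = 0 then 1 else if n = 1 then - 1 else 0)"
  proof (cases "n \<le> 1")
    case True
    then have "n = 0 \<or> n = 1" by auto
    then show ?thesis by auto
  next
    case False
    have "(1::real) gchoose n = of_nat (1 choose n)"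
      by (simp add: binomial_gbinomial)
    then show ?thesis using False by simp
  qed
  finally show ?thesis .
qed

text \<open>Writing \<open>Q = 1 - R\<close> with \<open>R\<close> positive and contractive, the
  root is the binomial series of \<open>sqrt(1 - x)\<close> at \<open>R\<close>. The norm of
  \<open>R\<close> may be \<open>1\<close>, so convergence rests on the summability of the
  coefficients instead of geometric decay.\<close>

lemma ex_positive_sqrt_contraction:
  fixes Q :: "'h::complex_hilbert_space \<Rightarrow> 'h"
  assumes Q: "bounded_clinear Q" "positive_on UNIV Q"
    and le: "\<And>x. Re (cinner (Q x) x) \<le> (norm x)\<^sup>2"
  shows "\<exists>P. bounded_clinear P \<and> positive_on UNIV P \<and> P \<circ> P = Q"
proof -
  define R where "R x = x - Q x" for x
  have bR: "bounded_clinear R"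
    unfolding R_def by (rule bounded_clinear_minus[OF bounded_clinear_id Q(1)])
  have pR: "positive_on UNIV R"
    using Q(2) le unfolding positive_on_def R_def cinner_diff_left cinner_self complex_is_Real_iff
    by simp
  have nR: "norm (R x) \<le> norm x" for x
  proof (rule positive_norm_bound[OF bR pR])
    show "Re (cinner (R x) x) \<le> (norm x)\<^sup>2" for x
      using Q(2) by (simp add: R_def cinner_diff_left norm_sq_eq_cinner positive_on_def)
  qed
  have bRn: "bounded_clinear (R ^^ n)" for n
    by (induct n) (simp_all add: bounded_clinear_id bounded_clinear_comp[OF bR] o_def id_def)
  have nRn: "norm ((R ^^ n) x) \<le> norm x" for n x
    by (induct n) (auto intro: order_trans[OF nR])
  have sRn: "cinner ((R ^^ n) x) y = cinner x ((R ^^ n) y)" for n x y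
  proof (induct n arbitrary: x)
    case (Suc n)
    then show ?case using positive_selfadj[OF bR pR] by (metis comp_apply funpow.simps(2) funpow_swap1)
  qed simp
  define t where "t x n = sqrt_coeff n *\<^sub>R (R ^^ n) x" for x n
  have t_le: "norm (t x n) \<le> norm (norm x * sqrt_coeff n)" for x n
    using mult_left_mono[OF nRn[of n x] abs_ge_zero[of "sqrt_coeff n"]]
    by (simp add: t_def mult.commute abs_mult)
  have t_abs: "t x abs_summable_on UNIV" for x
  proof (rule Infinite_Sum.abs_summable_on_comparison_test)
    show "(\<lambda>n. norm x * sqrt_coeff n) abs_summable_on UNIV"
      using summable_on_cmult_right[OF sqrt_coeff_abs_summable, of "norm x"] by (simp add: abs_mult)
  qed (rule t_le)
  then have t_sum: "(t x has_sum infsum (t x) UNIV) UNIV" for x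
    by (simp add: abs_summable_summable)
  define P where "P x = infsum (t x) UNIV" for x
  have P_sum: "(t x has_sum P x) UNIV" for x using t_sum by (simp add: P_def)
  have t_add: "t (x + y) n = t x n + t y n" for x y n
    by (simp add: t_def bounded_clinear_add[OF bRn] scaleR_add_right)
  have t_scale: "t (c *\<^sub>C x) n = c *\<^sub>C t x n" for c x n
    unfolding t_def bounded_clinear_scaleC[OF bRn] by (metis mult.commute scaleC_of_real scaleC_scaleC)
  have bP: "bounded_clinear P"
  proof (rule bounded_clinearI)
    show "P (x + y) = P x + P y" for x y
    proof (rule has_sum_unique)
      show "(t (x + y) has_sum P (x + y)) UNIV" by (rule P_sum)
      show "(t (x + y) has_sum P x + P y) UNIV"
        using has_sum_add[OF P_sum P_sum] by (simp add: t_add[abs_def])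
    qed
    show "P (c *\<^sub>C x) = c *\<^sub>C P x" for c x
    proof (rule has_sum_unique)
      show "(t (c *\<^sub>C x) has_sum P (c *\<^sub>C x)) UNIV" by (rule P_sum)
      show "(t (c *\<^sub>C x) has_sum c *\<^sub>C P x) UNIV"
        using has_sum_bounded_linear[OF bounded_linear_scaleC_right P_sum] by (simp add: t_scale[abs_def])
    qed
    show "norm (P x) \<le> (\<Sum>\<^sub>\<infinity>n. norm (sqrt_coeff n)) * norm x" for x
    proof -
      have "norm (P x) \<le> (\<Sum>\<^sub>\<infinity>n. norm (t x n))"
        unfolding P_def by (rule norm_infsum_bound[OF t_abs])
      also have "\<dots> \<le> (\<Sum>\<^sub>\<infinity>n. norm (sqrt_coeff n) * norm x)"
        by (rule infsum_mono[OF t_abs summable_on_cmult_left[OF sqrt_coeff_abs_summable]])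
          (use t_le in \<open>simp add: abs_mult mult.commute\<close>)
      also have "\<dots> = (\<Sum>\<^sub>\<infinity>n. norm (sqrt_coeff n)) * norm x"
        by (rule infsum_cmult_left) (use sqrt_coeff_abs_summable in simp)
      finally show ?thesis .
    qed
  qed
  have "cinner (P x) x \<in> \<real> \<and> 0 \<le> Re (cinner (P x) x)" for x
  proof -
    define r where "r n = Re (cinner ((R ^^ n) x) x)" for n
    have real: "cinner ((R ^^ n) x) x = of_real (r n)" for n
      using sRn[of n x x] unfolding r_def
      by (metis cinner_commute Reals_cnj_iff complex_is_Real_iff of_real_Re)
    have r_le: "r n \<le> r 0" for n
    proof -
      have "r n \<le> cmod (cinner ((R ^^ n) x) x)" unfolding r_def by (rule complex_Re_le_cmod)
      also have "\<dots> \<le> norm x * norm x"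
        by (rule order_trans[OF cinner_Cauchy_Schwarz mult_right_mono[OF nRn norm_ge_zero]])
      finally show ?thesis by (simp add: r_def norm_sq_eq_cinner[symmetric] power2_eq_square)
    qed
    have S: "((\<lambda>n. of_real (sqrt_coeff n * r n)) has_sum cinner (P x) x) UNIV"
      using has_sum_bounded_linear[OF bounded_linear_cinner_left P_sum, of x x]
      by (simp add: t_def cinner_scaleR_left real)
    have "Im (cinner (P x) x) = 0"
      using has_sum_unique[OF has_sum_Im[OF S] ] by (simp add: has_sum_0)
    moreover have "(\<lambda>n. sqrt_coeff n * r n) sums Re (cinner (P x) x)"
      using has_sum_Re[OF S] by (intro has_sum_imp_sums) simp
    then have lim: "(\<lambda>m. \<Sum>n\<le>m. sqrt_coeff n * r n) \<longlonglongrightarrow> Re (cinner (P x) x)"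
      by (simp add: sums_def_le)
    \<comment> \<open>All coefficients but the first are nonpositive and
      \<open>r n \<le> r 0\<close>, so replacing every \<open>r n\<close> by \<open>r 0\<close> can
      only decrease the sum. What is left is \<open>r 0\<close> times a nonnegative partial
      sum.\<close>
    have "0 \<le> (\<Sum>n\<le>m. sqrt_coeff n * r n)" for m
    proof -
      have "0 \<le> (\<Sum>n\<le>m. sqrt_coeff n) * r 0"
        using sum_sqrt_coeff_nonneg by (simp add: r_def flip: norm_sq_eq_cinner)
      also have "\<dots> = (\<Sum>n\<le>m. sqrt_coeff n * r 0)" by (rule sum_distrib_right)
      also have "\<dots> \<le> (\<Sum>n\<le>m. sqrt_coeff n * r n)"
      proof (rule sum_mono)
        fix n show "sqrt_coeff n * r 0 \<le> sqrt_coeff n * r n"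
          using sqrt_coeff_Suc_nonpos r_le by (cases n) (auto intro: mult_left_mono_neg)
      qed
      finally show ?thesis .
    qed
    then have "0 \<le> Re (cinner (P x) x)"
      by (intro LIMSEQ_le_const[OF lim]) auto
    ultimately show ?thesis by (simp add: complex_is_Real_iff)
  qed
  then have pP: "positive_on UNIV P" by (simp add: positive_on_def)
  have "P (P x) = Q x" for x
  proof -
    \<comment> \<open>The terms of \<open>P (P x)\<close> as a double family. It is dominated by a
      product of absolutely summable families, which permits regrouping along
      \<open>n + m = k\<close>; the convolution identity leaves only \<open>k = 0\<close> and
      \<open>k = 1\<close>.\<close>
    define f where "f = (\<lambda>(n, m). (sqrt_coeff n * sqrt_coeff m) *\<^sub>R (R ^^ (n + m)) x)"
    have f_abs: "f abs_summable_on UNIV \<times> UNIV"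
    proof (rule Infinite_Sum.abs_summable_on_comparison_test)
      show "(\<lambda>(n, m). norm x * (sqrt_coeff n * sqrt_coeff m)) abs_summable_on UNIV \<times> UNIV"
        unfolding Infinite_Sum.abs_summable_on_Sigma_iff
      proof (intro conjI ballI)
        show "(\<lambda>m. case (n, m) of (n, m) \<Rightarrow> norm x * (sqrt_coeff n * sqrt_coeff m)) abs_summable_on UNIV" for n
          using summable_on_cmult_right[OF sqrt_coeff_abs_summable, of "norm x * \<bar>sqrt_coeff n\<bar>"]
          by (simp add: abs_mult mult.assoc)
        have "(\<Sum>\<^sub>\<infinity>m. norm (norm x * (sqrt_coeff n * sqrt_coeff m)))
            = norm x * \<bar>sqrt_coeff n\<bar> * (\<Sum>\<^sub>\<infinity>m. norm (sqrt_coeff m))" for n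
          using infsum_cmult_right[OF sqrt_coeff_abs_summable, of "norm x * \<bar>sqrt_coeff n\<bar>"]
          by (simp add: abs_mult mult.assoc)
        then show "(\<lambda>n. \<Sum>\<^sub>\<infinity>m. norm (case (n, m) of (n, m) \<Rightarrow> norm x * (sqrt_coeff n * sqrt_coeff m)))
            abs_summable_on UNIV"
          using summable_on_cmult_right[OF sqrt_coeff_abs_summable, of "norm x * (\<Sum>\<^sub>\<infinity>m. norm (sqrt_coeff m))"]
          by (simp add: abs_mult infsum_nonneg mult.assoc mult.commute[of _ "infsum _ _"] mult.left_commute[of _ "infsum _ _"])
      qed
      show "norm (f p) \<le> norm (case p of (n, m) \<Rightarrow> norm x * (sqrt_coeff n * sqrt_coeff m))" for p
      proof (cases p)
        case (Pair n m)
        show ?thesis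
          using mult_right_mono[OF nRn[of "n + m" x] abs_ge_zero[of "sqrt_coeff n * sqrt_coeff m"]]
          by (simp add: Pair f_def abs_mult mult.commute)
      qed
    qed
    have f_summ: "f summable_on UNIV \<times> UNIV" using f_abs by (rule abs_summable_summable)
    have "P (P x) = (\<Sum>\<^sub>\<infinity>n. \<Sum>\<^sub>\<infinity>m. f (n, m))"
    proof -
      have "t (P x) n = (\<Sum>\<^sub>\<infinity>m. f (n, m))" for n
      proof -
        have "((\<lambda>m. sqrt_coeff n *\<^sub>R (R ^^ n) (t x m)) has_sum t (P x) n) UNIV"
          unfolding t_def[of "P x"]
          by (rule has_sum_scaleR[OF has_sum_bounded_linear[OF bounded_clinear_bounded_linear[OF bRn] P_sum]])
        moreover have "sqrt_coeff n *\<^sub>R (R ^^ n) (t x m) = f (n, m)" for m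
          by (simp add: f_def t_def linear_scale[OF bounded_linear.linear[OF bounded_clinear_bounded_linear[OF bRn]]] funpow_add)
        ultimately show ?thesis by (simp add: infsumI)
      qed
      then have "t (P x) = (\<lambda>n. \<Sum>\<^sub>\<infinity>m. f (n, m))" by (rule ext)
      then show ?thesis by (simp add: P_def[of "P x"])
    qed
    also have "\<dots> = infsum f (UNIV \<times> UNIV)"
      by (rule infsum_Sigma'_banach[of "\<lambda>n m. f (n, m)", simplified]) (use f_summ in simp)
    also have "\<dots> = infsum (\<lambda>(k, i). f (i, k - i)) (SIGMA k:UNIV. {..k})"
      by (rule infsum_reindex_bij_witness[where i="\<lambda>(k, i). (i, k - i)" and j="\<lambda>(n, m). (n + m, n)"]) auto
    also have "\<dots> = (\<Sum>\<^sub>\<infinity>k. \<Sum>i\<le>k. f (i, k - i))"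
    proof -
      have "(\<lambda>(k, i). f (i, k - i)) summable_on (SIGMA k:UNIV. {..k})"
        using f_summ
        by (subst summable_on_reindex_bij_witness[where i="\<lambda>(n, m). (n + m, n)" and j="\<lambda>(k, i). (i, k - i)"
              and h=f and T="UNIV \<times> UNIV"]) auto
      from infsum_Sigma'_banach[OF this] show ?thesis by simp
    qed
    also have "\<dots> = (\<Sum>\<^sub>\<infinity>k\<in>{0, 1}. \<Sum>i\<le>k. f (i, k - i))"
    proof (rule infsum_cong_neutral)
      fix k :: nat assume "k \<in> UNIV - {0, 1}"
      have "(\<Sum>i\<le>k. f (i, k - i)) = (\<Sum>i\<le>k. sqrt_coeff i * sqrt_coeff (k - i)) *\<^sub>R (R ^^ k) x"
        by (simp add: f_def scaleR_sum_left)
      then show "(\<Sum>i\<le>k. f (i, k - i)) = 0"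
        using \<open>k \<in> _\<close> by (simp add: sqrt_coeff_convolution)
    qed auto
    also have "\<dots> = x - R x"
    proof -
      have "sqrt_coeff 1 = - 1 / 2" by (simp add: sqrt_coeff_def)
      moreover have "(1 / 2) *\<^sub>R R x + (1 / 2) *\<^sub>R R x = R x" by (simp flip: scaleR_add_left)
      ultimately show ?thesis by (simp add: f_def) (metis add_uminus_conv_diff minus_add_distrib)
    qed
    finally show ?thesis by (simp add: R_def)
  qed
  then show ?thesis using bP pP by (intro exI[of _ P]) auto
qed

text \<open>Division by an operator bound \<open>C\<close> reduces to a form bounded by the squared
  norm; the root is rescaled by \<open>sqrt C\<close>.\<close>

lemma ex_positive_sqrt:
  fixes Q :: "'h::complex_hilbert_space \<Rightarrow> 'h"
  assumes Q: "bounded_clinear Q" "positive_on UNIV Q"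
  shows "\<exists>P. bounded_clinear P \<and> positive_on UNIV P \<and> P \<circ> P = Q"
proof -
  obtain C where C: "C > 0" "\<And>x. norm (Q x) \<le> C * norm x"
    using bounded_clinear_bound[OF Q(1)] by blast
  define Q' where "Q' x = complex_of_real (1 / C) *\<^sub>C Q x" for x
  have "bounded_clinear Q'" unfolding Q'_def by (rule bounded_clinear_scale[OF Q(1)])
  moreover have "positive_on UNIV Q'"
    using Q(2) C(1) by (simp add: positive_on_def Q'_def cinner_scaleC_left complex_is_Real_iff)
  moreover have "Re (cinner (Q' x) x) \<le> (norm x)\<^sup>2" for x
  proof -
    have "Re (cinner (Q x) x) \<le> cmod (cinner (Q x) x)" by (rule complex_Re_le_cmod)
    also have "\<dots> \<le> norm (Q x) * norm x" by (rule cinner_Cauchy_Schwarz)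
    also have "\<dots> \<le> C * norm x * norm x" by (intro mult_right_mono C) simp
    finally show ?thesis using C(1)
      by (simp add: Q'_def cinner_scaleC_left power2_eq_square field_simps)
  qed
  ultimately obtain P where P: "bounded_clinear P" "positive_on UNIV P" "P \<circ> P = Q'"
    using ex_positive_sqrt_contraction[of Q'] by blast
  define P' where "P' x = complex_of_real (sqrt C) *\<^sub>C P x" for x
  have "bounded_clinear P'" unfolding P'_def by (rule bounded_clinear_scale[OF P(1)])
  moreover have "positive_on UNIV P'"
    using P(2) C(1) by (simp add: positive_on_def P'_def cinner_scaleC_left complex_is_Real_iff)
  moreover have "P' (P' x) = Q x" for x
  proof -
    have "P' (P' x) = (complex_of_real (sqrt C) * complex_of_real (sqrt C)) *\<^sub>C P (P x)"
      by (simp add: P'_def bounded_clinear_scaleC[OF P(1)] scaleC_scaleC)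
    also have "complex_of_real (sqrt C) * complex_of_real (sqrt C) = complex_of_real C"
      using C(1) by (simp flip: of_real_mult)
    also have "P (P x) = Q' x" using P(3) by (metis comp_apply)
    finally show ?thesis using C(1) by (simp add: Q'_def scaleC_scaleC)
  qed
  ultimately show ?thesis by (intro exI[of _ P']) auto
qed

section \<open>Hilbert--Schmidt operators\<close>

text \<open>The mixed term is split with a free weight \<open>t\<close>. The estimate is linear in
  the squares, so it survives summation and integration, and \<open>t\<close> is optimised only
  afterwards. This gives Minkowski's inequality for the Hilbert-Schmidt norm and the
  \<open>L2\<close> norm alike.\<close>

lemma norm_add_sq_le:
  fixes a b :: "'b::real_normed_vector"
  assumes "t > 0"
  shows "(norm (a + b))\<^sup>2 \<le> (1 + t) * (norm a)\<^sup>2 + (1 + 1 / t) * (norm b)\<^sup>2"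
proof -
  have "0 \<le> (sqrt t * norm a - norm b / sqrt t)\<^sup>2" by simp
  also have "\<dots> = t * (norm a)\<^sup>2 - 2 * norm a * norm b + (norm b)\<^sup>2 / t"
    using assms by (simp add: power2_diff power_mult_distrib power_divide field_simps)
  finally have "(norm a + norm b)\<^sup>2 \<le> (1 + t) * (norm a)\<^sup>2 + (1 + 1 / t) * (norm b)\<^sup>2"
    by (simp add: power2_sum algebra_simps)
  then show ?thesis
    using power_mono[OF norm_triangle_ineq[of a b] norm_ge_zero, of 2] by linarith
qed

text \<open>The optimal weight is \<open>t = sqrt (Y / X)\<close>, which turns the right-hand side
  into the square of \<open>sqrt X + sqrt Y\<close>.\<close>

lemma sqrt_le_add_sqrt:
  assumes "X \<ge> 0" "Y \<ge> 0" and le: "\<And>t. t > 0 \<Longrightarrow> Z \<le> (1 + t) * X + (1 + 1 / t) * Y"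
  shows "sqrt Z \<le> sqrt X + sqrt Y"
proof -
  \<comment> \<open>Adding \<open>\<epsilon>\<close> keeps the weight \<open>b / a\<close> defined
    and positive even when \<open>X\<close> or \<open>Y\<close> is zero; afterwards
    \<open>\<epsilon>\<close> tends to zero.\<close>
  have main: "sqrt Z \<le> sqrt (X + \<epsilon>) + sqrt (Y + \<epsilon>)" if "\<epsilon> > 0" for \<epsilon>
  proof -
    define a b where "a = sqrt (X + \<epsilon>)" and "b = sqrt (Y + \<epsilon>)"
    have pos: "a > 0" "b > 0" and sq: "X + \<epsilon> = a\<^sup>2" "Y + \<epsilon> = b\<^sup>2"
      using assms that by (auto simp: a_def b_def)
    have "Z \<le> (1 + b / a) * X + (1 + 1 / (b / a)) * Y" by (rule le) (use pos in simp)
    also have "\<dots> \<le> (1 + b / a) * (X + \<epsilon>) + (1 + 1 / (b / a)) * (Y + \<epsilon>)"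
      by (intro add_mono mult_left_mono) (use pos that in auto)
    also have "\<dots> = (a + b)\<^sup>2"
      unfolding sq using pos by (simp add: field_simps power2_eq_square)
    finally have "sqrt Z \<le> sqrt ((a + b)\<^sup>2)" by (rule real_sqrt_le_mono)
    then show ?thesis using pos by (simp add: a_def b_def)
  qed
  have "((\<lambda>\<epsilon>. sqrt (X + \<epsilon>) + sqrt (Y + \<epsilon>)) \<longlongrightarrow> sqrt (X + 0) + sqrt (Y + 0)) (at_right 0)"
    by (intro tendsto_intros)
  then have "sqrt Z \<le> sqrt (X + 0) + sqrt (Y + 0)"
    by (rule tendsto_lowerbound) (auto simp: eventually_at_right_less main intro!: eventually_mono[OF eventually_at_right_less])
  then show ?thesis by simp
qed

lemma
  assumes "A \<in> hilbert_schmidt"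
  shows hilbert_schmidt_bounded_clinear: "bounded_clinear A"
    and hilbert_schmidt_summable: "(\<lambda>e. (norm (A e))\<^sup>2) summable_on onb"
  using assms by (auto simp: hilbert_schmidt_def)

lemma hs_norm_nonneg: "0 \<le> hs_norm A"
  by (simp add: hs_norm_def infsum_nonneg)

lemma hs_norm_sq: "(hs_norm A)\<^sup>2 = (\<Sum>\<^sub>\<infinity>e\<in>onb. (norm (A e))\<^sup>2)"
  by (simp add: hs_norm_def infsum_nonneg)

lemma hilbert_schmidt_scale_add:
  assumes A: "A \<in> hilbert_schmidt" and B: "B \<in> hilbert_schmidt"
  shows "(\<lambda>x. c *\<^sub>C A x + B x) \<in> hilbert_schmidt"
  unfolding hilbert_schmidt_def
proof (intro CollectI conjI)
  show "bounded_clinear (\<lambda>x. c *\<^sub>C A x + B x)"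
    by (intro bounded_clinear_plus bounded_clinear_scale hilbert_schmidt_bounded_clinear A B)
  show "(\<lambda>e. (norm (c *\<^sub>C A e + B e))\<^sup>2) summable_on onb"
  proof (rule summable_on_comparison_test)
    show "(\<lambda>e. (2 * (cmod c)\<^sup>2) * (norm (A e))\<^sup>2 + 2 * (norm (B e))\<^sup>2) summable_on onb"
      by (intro summable_on_add summable_on_cmult_right hilbert_schmidt_summable A B)
    show "(norm (c *\<^sub>C A e + B e))\<^sup>2 \<le> (2 * (cmod c)\<^sup>2) * (norm (A e))\<^sup>2 + 2 * (norm (B e))\<^sup>2" for e
      using norm_add_sq_le[of 1 "c *\<^sub>C A e" "B e"] by (simp add: power_mult_distrib)
  qed simp
qed

lemma hilbert_schmidt_add:
  "A \<in> hilbert_schmidt \<Longrightarrow> B \<in> hilbert_schmidt \<Longrightarrow> (\<lambda>x. A x + B x) \<in> hilbert_schmidt"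
  using hilbert_schmidt_scale_add[of A B 1] by simp

lemma hilbert_schmidt_diff:
  "A \<in> hilbert_schmidt \<Longrightarrow> B \<in> hilbert_schmidt \<Longrightarrow> (\<lambda>x. A x - B x) \<in> hilbert_schmidt"
  using hilbert_schmidt_scale_add[of B A "-1"] by (simp add: scaleC_minus_one)

lemma hilbert_schmidt_zero: "(\<lambda>x. 0) \<in> hilbert_schmidt"
  by (auto simp: hilbert_schmidt_def intro: bounded_clinearI[where C=0])

lemma hilbert_schmidt_scale:
  "A \<in> hilbert_schmidt \<Longrightarrow> (\<lambda>x. c *\<^sub>C A x) \<in> hilbert_schmidt"
  using hilbert_schmidt_scale_add[OF _ hilbert_schmidt_zero] by simp

lemma hs_norm_triangle:
  assumes A: "A \<in> hilbert_schmidt" and B: "B \<in> hilbert_schmidt"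
  shows "hs_norm (\<lambda>x. A x + B x) \<le> hs_norm A + hs_norm B"
  unfolding hs_norm_def
proof (rule sqrt_le_add_sqrt)
  fix t :: real assume "t > 0"
  note sA = hilbert_schmidt_summable[OF A] and sB = hilbert_schmidt_summable[OF B]
  have "(\<Sum>\<^sub>\<infinity>e\<in>onb. (norm (A e + B e))\<^sup>2)
      \<le> (\<Sum>\<^sub>\<infinity>e\<in>onb. (1 + t) * (norm (A e))\<^sup>2 + (1 + 1 / t) * (norm (B e))\<^sup>2)"
    by (intro infsum_mono summable_on_add summable_on_cmult_right sA sB
        hilbert_schmidt_summable[OF hilbert_schmidt_add[OF A B]] norm_add_sq_le[OF \<open>t > 0\<close>])
  also have "\<dots> = (1 + t) * (\<Sum>\<^sub>\<infinity>e\<in>onb. (norm (A e))\<^sup>2) + (1 + 1 / t) * (\<Sum>\<^sub>\<infinity>e\<in>onb. (norm (B e))\<^sup>2)"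
    by (simp add: infsum_add infsum_cmult_right' summable_on_cmult_right sA sB)
  finally show "(\<Sum>\<^sub>\<infinity>e\<in>onb. (norm (A e + B e))\<^sup>2)
      \<le> (1 + t) * (\<Sum>\<^sub>\<infinity>e\<in>onb. (norm (A e))\<^sup>2) + (1 + 1 / t) * (\<Sum>\<^sub>\<infinity>e\<in>onb. (norm (B e))\<^sup>2)" .
qed (simp_all add: infsum_nonneg)

lemma hs_norm_scale: "hs_norm (\<lambda>x. c *\<^sub>C A x) = cmod c * hs_norm A"
  by (simp add: hs_norm_def power_mult_distrib infsum_cmult_right' real_sqrt_mult)

lemma hs_norm_minus_commute: "hs_norm (\<lambda>x. A x - B x) = hs_norm (\<lambda>x. B x - A x)"
  by (simp add: hs_norm_def norm_minus_commute)

lemma hs_norm_diff_le: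
  assumes "A \<in> hilbert_schmidt" "B \<in> hilbert_schmidt"
  shows "\<bar>hs_norm A - hs_norm B\<bar> \<le> hs_norm (\<lambda>x. A x - B x)"
  using hs_norm_triangle[OF hilbert_schmidt_diff[OF assms] assms(2)]
    hs_norm_triangle[OF hilbert_schmidt_diff[OF assms(2,1)] assms(1)] hs_norm_minus_commute[of A B]
  by simp

lemma hs_norm_zero_imp_eq:
  assumes A: "A \<in> hilbert_schmidt" and B: "B \<in> hilbert_schmidt"
    and zero: "hs_norm (\<lambda>x. A x - B x) = 0"
  shows "A = B"
proof
  fix x
  have D: "(\<lambda>x. A x - B x) \<in> hilbert_schmidt" by (rule hilbert_schmidt_diff[OF A B])
  have "(\<Sum>\<^sub>\<infinity>e\<in>onb. (norm (A e - B e))\<^sup>2) = 0" using hs_norm_sq[of "\<lambda>x. A x - B x"] zero by simp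
  then have *: "A e - B e = 0" if "e \<in> onb" for e
    using nonneg_infsum_le_0D[OF _ hilbert_schmidt_summable[OF D] _ that] by simp
  have "((\<lambda>e. (\<lambda>x. A x - B x) (cinner x e *\<^sub>C e)) has_sum A x - B x) onb"
    using has_sum_bounded_linear[OF bounded_clinear_bounded_linear[OF hilbert_schmidt_bounded_clinear[OF D]] onb_expansion]
    by simp
  moreover have "((\<lambda>e. (\<lambda>x. A x - B x) (cinner x e *\<^sub>C e)) has_sum 0) onb"
    by (rule has_sum_0)
      (use * in \<open>simp add: bounded_clinear_scaleC[OF hilbert_schmidt_bounded_clinear] A B\<close>)
  ultimately show "A x = B x" using has_sum_unique by fastforce
qed

text \<open>Both sides are iterated sums of the squared matrix entries of \<open>A\<close>, taken in
  the two possible orders; nonnegativity allows the interchange. The adjoint appears because the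
  wavelet terms later have norms \<open>norm (adj A e)\<close>.\<close>

lemma hs_adj:
  fixes A :: "'h::complex_hilbert_space \<Rightarrow> 'h"
  assumes A: "A \<in> hilbert_schmidt"
  shows "((\<lambda>e. (norm (adj A e))\<^sup>2) has_sum (hs_norm A)\<^sup>2) onb"
proof -
  note bA = hilbert_schmidt_bounded_clinear[OF A]
  define f where "f = (\<lambda>(e, d). (cmod (cinner (A e) d))\<^sup>2)"
  have row: "((\<lambda>d. f (e, d)) has_sum (norm (A e))\<^sup>2) onb" for e
    using Parseval[of "A e"] by (simp add: f_def)
  have summ: "f summable_on onb \<times> onb"
    by (rule summable_on_SigmaI[OF row hilbert_schmidt_summable[OF A]]) (auto simp: f_def)
  then have tot: "(f has_sum infsum f (onb \<times> onb)) (onb \<times> onb)" by simp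
  have "((\<lambda>e. (norm (A e))\<^sup>2) has_sum infsum f (onb \<times> onb)) onb"
    by (rule has_sum_SigmaD[OF tot row])
  then have *: "infsum f (onb \<times> onb) = (hs_norm A)\<^sup>2" by (simp add: hs_norm_sq infsumI)
  have "((\<lambda>(x, y). f (y, x)) has_sum (hs_norm A)\<^sup>2) (onb \<times> onb)"
    using tot * has_sum_swap[of f] by simp
  then show ?thesis
  proof (rule has_sum_SigmaD)
    fix d :: 'h
    have "cmod (cinner (A e) d) = cmod (cinner (adj A d) e)" for e
      by (metis cinner_adj_right[OF bA] cmod_cinner_commute)
    then show "((\<lambda>y. case (d, y) of (x, y) \<Rightarrow> f (y, x)) has_sum (norm (adj A d))\<^sup>2) onb"
      using Parseval[of "adj A d"] by (simp add: f_def)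
  qed
qed

lemma
  fixes u v :: "'h::complex_hilbert_space"
  shows hilbert_schmidt_rank_one: "(\<lambda>x. cinner x v *\<^sub>C u) \<in> hilbert_schmidt"
    and hs_norm_rank_one: "hs_norm (\<lambda>x. cinner x v *\<^sub>C u) = norm v * norm u"
proof -
  have "((\<lambda>e. (cmod (cinner v e))\<^sup>2 * (norm u)\<^sup>2) has_sum (norm v)\<^sup>2 * (norm u)\<^sup>2) onb"
    by (rule has_sum_cmult_left[OF Parseval])
  then have *: "((\<lambda>e. (norm (cinner e v *\<^sub>C u))\<^sup>2) has_sum (norm v)\<^sup>2 * (norm u)\<^sup>2) onb"
    by (simp add: power_mult_distrib cmod_cinner_commute[of v])
  then show "(\<lambda>x. cinner x v *\<^sub>C u) \<in> hilbert_schmidt"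
    by (auto simp: hilbert_schmidt_def bounded_clinear_rank_one has_sum_imp_summable)
  show "hs_norm (\<lambda>x. cinner x v *\<^sub>C u) = norm v * norm u"
    using infsumI[OF *] by (simp add: hs_norm_def real_sqrt_mult)
qed

lemma finite_rank_hs:
  fixes u v :: "'i \<Rightarrow> 'h::complex_hilbert_space"
  assumes "finite I"
  shows "(\<lambda>x. \<Sum>i\<in>I. cinner x (v i) *\<^sub>C u i) \<in> hilbert_schmidt \<and>
    hs_norm (\<lambda>x. \<Sum>i\<in>I. cinner x (v i) *\<^sub>C u i) \<le> (\<Sum>i\<in>I. norm (v i) * norm (u i))"
  using assms
proof induct
  case empty
  then show ?case by (simp add: hilbert_schmidt_zero hs_norm_def)
next
  case (insert i I)
  then have IH: "(\<lambda>x. \<Sum>i\<in>I. cinner x (v i) *\<^sub>C u i) \<in> hilbert_schmidt"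
    "hs_norm (\<lambda>x. \<Sum>i\<in>I. cinner x (v i) *\<^sub>C u i) \<le> (\<Sum>i\<in>I. norm (v i) * norm (u i))" by auto
  have "hs_norm (\<lambda>x. cinner x (v i) *\<^sub>C u i + (\<Sum>i\<in>I. cinner x (v i) *\<^sub>C u i))
      \<le> norm (v i) * norm (u i) + (\<Sum>i\<in>I. norm (v i) * norm (u i))"
    using hs_norm_triangle[OF hilbert_schmidt_rank_one IH(1)] IH(2)
    by (fastforce simp: hs_norm_rank_one intro: order_trans)
  then show ?case
    using insert hilbert_schmidt_add[OF hilbert_schmidt_rank_one IH(1)] by simp
qed

text \<open>Two approximations: \<open>A\<close> is cut off outside finitely many basis vectors, and
  each remaining basis vector \<open>e\<close> in the functional \<open><x, e>\<close> is moved to a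
  nearby element of \<open>W\<close>. The vectors \<open>A e\<close> stay fixed.\<close>

lemma finite_rank_dense_hs:
  fixes A :: "'h::complex_hilbert_space \<Rightarrow> 'h"
  assumes A: "A \<in> hilbert_schmidt" and W: "closure W = UNIV" and "\<epsilon> > 0"
  obtains F v where "finite F" "\<And>e. e \<in> F \<Longrightarrow> v e \<in> W"
    "hs_norm (\<lambda>x. A x - (\<Sum>e\<in>F. cinner x (v e) *\<^sub>C A e)) < \<epsilon>"
proof -
  note bA = hilbert_schmidt_bounded_clinear[OF A]
  obtain F where F: "finite F" "F \<subseteq> onb"
    and dist: "dist (\<Sum>e\<in>F. (norm (A e))\<^sup>2) (\<Sum>\<^sub>\<infinity>e\<in>onb. (norm (A e))\<^sup>2) \<le> (\<epsilon> / 4)\<^sup>2"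
    using infsum_finite_approximation[OF hilbert_schmidt_summable[OF A], of "(\<epsilon> / 4)\<^sup>2"] \<open>\<epsilon> > 0\<close> by auto
  define AF where "AF x = (\<Sum>e\<in>F. cinner x e *\<^sub>C A e)" for x
  have AF: "AF \<in> hilbert_schmidt"
    unfolding AF_def using finite_rank_hs[OF F(1), of "\<lambda>e. e" A] by blast
  have AF_onb: "AF e = (if e \<in> F then A e else 0)" if "e \<in> onb" for e
  proof -
    have "AF e = (\<Sum>d\<in>F. if d = e then A d else 0)"
      unfolding AF_def
      by (rule sum.cong) (use that F orthonormal_onb in \<open>auto simp: orthonormal_def subset_iff\<close>)
    then show ?thesis using F by simp
  qed
  have "(hs_norm (\<lambda>x. A x - AF x))\<^sup>2 = (\<Sum>\<^sub>\<infinity>e\<in>onb - F. (norm (A e))\<^sup>2)"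
    unfolding hs_norm_sq by (rule infsum_cong_neutral) (auto simp: AF_onb)
  also have "\<dots> = (\<Sum>\<^sub>\<infinity>e\<in>onb. (norm (A e))\<^sup>2) - (\<Sum>e\<in>F. (norm (A e))\<^sup>2)"
    using infsum_Diff[OF hilbert_schmidt_summable[OF A] _ F(2)] F by simp
  also have "\<dots> \<le> (\<epsilon> / 4)\<^sup>2" using dist unfolding dist_real_def by linarith
  finally have 1: "hs_norm (\<lambda>x. A x - AF x) \<le> \<epsilon> / 4"
    by (rule power2_le_imp_le) (use \<open>\<epsilon> > 0\<close> in simp)
  \<comment> \<open>The summand \<open>1\<close> makes \<open>K\<close> positive, so that division
    by it is safe even if \<open>A\<close> vanishes on \<open>F\<close>.\<close>
  define K where "K = (\<Sum>e\<in>F. norm (A e)) + 1"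
  have "K > 0" by (simp add: K_def add_nonneg_pos sum_nonneg)
  have "\<exists>w\<in>W. dist w e < \<epsilon> / (4 * K)" for e
    using W \<open>\<epsilon> > 0\<close> \<open>K > 0\<close> closure_approachable[of e W] by simp
  then obtain v where v: "\<And>e. v e \<in> W" "\<And>e. dist (v e) e < \<epsilon> / (4 * K)" by metis
  define B where "B x = (\<Sum>e\<in>F. cinner x (v e) *\<^sub>C A e)" for x
  have B: "B \<in> hilbert_schmidt"
    unfolding B_def using finite_rank_hs[OF F(1), of v A] by blast
  have "AF x - B x = (\<Sum>e\<in>F. cinner x (e - v e) *\<^sub>C A e)" for x
    unfolding AF_def B_def sum_subtractf[symmetric] cinner_diff_right
    by (rule sum.cong[OF refl]) (metis diff_add_cancel eq_diff_eq scaleC_add_left)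
  then have "hs_norm (\<lambda>x. AF x - B x) \<le> (\<Sum>e\<in>F. norm (e - v e) * norm (A e))"
    using finite_rank_hs[OF F(1), of "\<lambda>e. e - v e" A] by simp
  also have "\<dots> \<le> (\<Sum>e\<in>F. \<epsilon> / (4 * K) * norm (A e))"
    by (intro sum_mono mult_right_mono) (use v(2) in \<open>auto simp: dist_norm norm_minus_commute less_imp_le\<close>)
  also have "\<dots> \<le> \<epsilon> / (4 * K) * K"
    unfolding sum_distrib_left[symmetric] using \<open>K > 0\<close> \<open>\<epsilon> > 0\<close>
    by (intro mult_left_mono) (auto simp: K_def)
  also have "\<dots> = \<epsilon> / 4" using \<open>K > 0\<close> by simp
  finally have 2: "hs_norm (\<lambda>x. AF x - B x) \<le> \<epsilon> / 4" .
  have "hs_norm (\<lambda>x. A x - B x) \<le> hs_norm (\<lambda>x. A x - AF x) + hs_norm (\<lambda>x. AF x - B x)"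
    using hs_norm_triangle[OF hilbert_schmidt_diff[OF A AF] hilbert_schmidt_diff[OF AF B]] by simp
  then have "hs_norm (\<lambda>x. A x - B x) < \<epsilon>" using 1 2 \<open>\<epsilon> > 0\<close> by linarith
  then show thesis using that[of F v] F v unfolding B_def by blast
qed

section \<open>Trace class operators\<close>

text \<open>\<open><P x, P x> = <P (P x), x>\<close>, and \<open>P\<close> squared is
  \<open>adj S\<close> after \<open>S\<close>. Convergence and vanishing of values of
  \<open>S\<close> can therefore be tested on \<open>P\<close>.\<close>

lemma operator_abs_norm:
  assumes S: "bounded_clinear S" and P: "is_operator_abs S P"
  shows "norm (P x) = norm (S x)"
proof -
  have bP: "bounded_clinear P" and pP: "positive_on UNIV P" and PP: "P (P x) = adj S (S x)" for x
    using P by (auto simp: is_operator_abs_def dest: fun_cong)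
  have "cinner (P x) (P x) = cinner (S x) (S x)"
    by (metis PP bP cinner_adj_left[OF S] pP positive_selfadj)
  then have "(norm (P x))\<^sup>2 = (norm (S x))\<^sup>2" by (simp add: norm_sq_eq_cinner)
  then show ?thesis by simp
qed

lemma ex_operator_abs:
  assumes S: "bounded_clinear S"
  shows "\<exists>P. is_operator_abs S P"
proof -
  have "positive_on UNIV (\<lambda>x. adj S (S x))"
    by (simp add: positive_on_def cinner_adj_left[OF S] cinner_self)
  then show ?thesis
    using ex_positive_sqrt[OF bounded_clinear_comp[OF bounded_clinear_adj[OF S] S]]
    by (auto simp: is_operator_abs_def o_def)
qed

text \<open>With \<open>Q = \<bar>S\<bar>\<^sup>1\<^sup>/\<^sup>2\<close> and \<open>S = W \<bar>S\<bar>\<close> the polar decomposition, the vectors below are \<open>g e = Q e\<close> and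
  \<open>h e = W Q e\<close>.  The partial isometry \<open>W\<close> is only needed on the closure of the range of \<open>\<bar>S\<bar>\<close>, where it
  is obtained by passing to limits.\<close>

lemma trace_class_expansion:
  fixes S :: "'h::complex_hilbert_space \<Rightarrow> 'h"
  assumes S: "S \<in> trace_class"
  obtains g h :: "'h \<Rightarrow> 'h" where "(\<lambda>e. (norm (g e))\<^sup>2) summable_on onb" "\<And>e. norm (h e) = norm (g e)"
    "\<And>x. ((\<lambda>e. cinner x (g e) *\<^sub>C h e) has_sum S x) onb"
proof -
  obtain P where bS: "bounded_clinear S" and P: "is_operator_abs S P"
    and tr: "(\<lambda>e. cinner (P e) e) summable_on onb"
    using S by (auto simp: trace_class_def)
  have bP: "bounded_clinear P" and pP: "positive_on UNIV P"
    using P by (auto simp: is_operator_abs_def)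
  have nP: "norm (P x) = norm (S x)" for x by (rule operator_abs_norm[OF bS P])
  obtain Q where bQ: "bounded_clinear Q" and pQ: "positive_on UNIV Q" and QQ: "\<And>x. Q (Q x) = P x"
    using ex_positive_sqrt[OF bP pP] by (metis comp_apply)
  note sQ = positive_selfadj[OF bQ pQ] and sP = positive_selfadj[OF bP pP]
  define M where "M = closure (range P)"
  have "csubspace (range P)"
    unfolding csubspace_def
    using bounded_clinear_zero[OF bP] bounded_clinear_add[OF bP] bounded_clinear_scaleC[OF bP]
    by (safe; metis rangeI)
  then have M: "csubspace M" "closed M" unfolding M_def by (auto intro: csubspace_closure)
  \<comment> \<open>The residual \<open>q\<close> is orthogonal to the range of \<open>P\<close>, so
    \<open>P q = 0\<close> and hence \<open>Q q = 0\<close>. Then \<open>q\<close> is orthogonal to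
    \<open>Q e\<close> as well as to its projection, and so to itself.\<close>
  have "Q e \<in> M" for e
  proof -
    obtain p where p: "p \<in> M" "\<And>y. y \<in> M \<Longrightarrow> cinner (Q e - p) y = 0"
      using orthogonal_projection[OF M] by blast
    define q where "q = Q e - p"
    have q: "cinner q y = 0" if "y \<in> M" for y using p(2)[OF that] by (simp add: q_def)
    have "cinner (P q) x = 0" for x
      using q[of "P x"] subsetD[OF closure_subset rangeI[of P x]] by (simp add: sP M_def)
    then have "P q = 0" using cinner_eq_zero_iff by blast
    then have "cinner (Q q) (Q q) = 0" using QQ[of q] by (metis cinner_zero_left sQ)
    then have "Q q = 0" by (simp add: cinner_eq_zero_iff)
    then have "cinner (Q e) q = 0" by (simp add: sQ)
    then have "cinner q (Q e) = 0" by (metis cinner_commute complex_cnj_zero)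
    then have "cinner q q = 0"
      using q[OF p(1)] cinner_diff_right[of q "Q e" p] by (simp add: q_def[symmetric])
    then have "Q e = p" by (simp add: cinner_eq_zero_iff q_def)
    then show ?thesis using p(1) by simp
  qed
  then have "\<exists>h y. (\<lambda>n. P (y n)) \<longlonglongrightarrow> Q e \<and> (\<lambda>n. S (y n)) \<longlonglongrightarrow> h" for e
  proof -
    have "Q e \<in> closure (range P)" using \<open>\<And>e. Q e \<in> M\<close> by (simp add: M_def)
    then obtain z where z: "\<And>n. z n \<in> range P" "z \<longlonglongrightarrow> Q e"
      unfolding closure_sequential by metis
    have "\<forall>n. \<exists>y. z n = P y" using z(1) by blast
    then obtain y where y: "\<And>n. z n = P (y n)" by metis
    \<comment> \<open>\<open>S\<close> and \<open>P\<close> have equal norms at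
      \<open>y m - y n\<close>, so convergence of the values of \<open>P\<close> makes those of
      \<open>S\<close> Cauchy. The limit plays the part of \<open>W Q e\<close>.\<close>
    have "dist (S (y m)) (S (y n)) = dist (z m) (z n)" for m n
      by (simp add: dist_norm y nP bounded_clinear_diff[OF bS, symmetric] bounded_clinear_diff[OF bP, symmetric])
    then have "Cauchy (\<lambda>n. S (y n))"
      using LIMSEQ_imp_Cauchy[OF z(2)] by (simp add: Cauchy_def)
    then obtain h where "(\<lambda>n. S (y n)) \<longlonglongrightarrow> h" using Cauchy_convergent convergent_def by blast
    moreover have "(\<lambda>n. P (y n)) \<longlonglongrightarrow> Q e" using z(2) y by (simp flip: y)
    ultimately show ?thesis by blast
  qed
  then obtain h y where hP: "\<And>e. (\<lambda>n. P (y e n)) \<longlonglongrightarrow> Q e" and hS: "\<And>e. (\<lambda>n. S (y e n)) \<longlonglongrightarrow> h e"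
    by metis
  have "(\<lambda>e. (norm (Q e))\<^sup>2) summable_on onb"
  proof -
    have "(\<lambda>e. Re (cinner (P e) e)) summable_on onb" using tr by (rule summable_on_Re)
    moreover have "Re (cinner (P e) e) = (norm (Q e))\<^sup>2" for e
      using sQ[of "Q e" e] by (simp add: QQ norm_sq_eq_cinner)
    ultimately show ?thesis by simp
  qed
  moreover have "norm (h e) = norm (Q e)" for e
  proof -
    have "(\<lambda>n. norm (P (y e n))) \<longlonglongrightarrow> norm (h e)" unfolding nP by (rule tendsto_norm[OF hS])
    then show ?thesis using tendsto_norm[OF hP] LIMSEQ_unique by blast
  qed
  moreover have "((\<lambda>e. cinner x (Q e) *\<^sub>C h e) has_sum S x) onb" for x
  proof -
    have "((\<lambda>e. Q (cinner (Q x) e *\<^sub>C e)) has_sum Q (Q x)) onb"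
      by (rule has_sum_bounded_linear[OF bounded_clinear_bounded_linear[OF bQ] onb_expansion])
    then have "((\<lambda>e. cinner x (Q e) *\<^sub>C Q e) has_sum P x) onb"
      by (simp add: bounded_clinear_scaleC[OF bQ] sQ QQ)
    \<comment> \<open>Before the limit in \<open>n\<close>, the two distances are the norms of
      \<open>S\<close> and \<open>P\<close> at one and the same vector, hence equal. The expansion
      of \<open>P x\<close> thus carries over to \<open>S x\<close>.\<close>
    moreover have "dist (\<Sum>e\<in>F. cinner x (Q e) *\<^sub>C h e) (S x) = dist (\<Sum>e\<in>F. cinner x (Q e) *\<^sub>C Q e) (P x)" for F
    proof (rule LIMSEQ_unique)
      have eq: "dist (\<Sum>e\<in>F. cinner x (Q e) *\<^sub>C S (y e n)) (S x)
          = dist (\<Sum>e\<in>F. cinner x (Q e) *\<^sub>C P (y e n)) (P x)" for n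
        by (simp add: dist_norm nP flip: bounded_clinear_scaleC[OF bS] bounded_clinear_sum[OF bS]
            bounded_clinear_diff[OF bS] bounded_clinear_scaleC[OF bP] bounded_clinear_sum[OF bP]
            bounded_clinear_diff[OF bP])
      show "(\<lambda>n. dist (\<Sum>e\<in>F. cinner x (Q e) *\<^sub>C S (y e n)) (S x))
          \<longlonglongrightarrow> dist (\<Sum>e\<in>F. cinner x (Q e) *\<^sub>C h e) (S x)"
        by (intro tendsto_intros bounded_linear.tendsto[OF bounded_linear_scaleC_right] hS)
      show "(\<lambda>n. dist (\<Sum>e\<in>F. cinner x (Q e) *\<^sub>C S (y e n)) (S x))
          \<longlonglongrightarrow> dist (\<Sum>e\<in>F. cinner x (Q e) *\<^sub>C Q e) (P x)"
        unfolding eq by (intro tendsto_intros bounded_linear.tendsto[OF bounded_linear_scaleC_right] hP)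
    qed
    ultimately show ?thesis unfolding has_sum_def tendsto_iff by simp
  qed
  ultimately show thesis using that[of Q h] by blast
qed

text \<open>The expansion turns \<open><S (U e), e>\<close> into a sum over \<open>k\<close> of
  \<open><U e, g k> <h k, e>\<close>. Each product is at most a sum of two squares; Parseval in
  \<open>e\<close> and contractivity of \<open>adj U\<close> leave twice the squared norm of
  \<open>g k\<close>, which is summable. The double family is then absolutely summable and may be
  summed over \<open>k\<close> first.\<close>

lemma trace_class_comp_summable:
  fixes S U :: "'h::complex_hilbert_space \<Rightarrow> 'h"
  assumes S: "S \<in> trace_class" and U: "bounded_clinear U" "\<And>x. norm (adj U x) \<le> norm x"
  shows "(\<lambda>e. cinner (S (U e)) e) summable_on onb"
proof -
  obtain g h :: "'h \<Rightarrow> 'h" where g: "(\<lambda>e. (norm (g e))\<^sup>2) summable_on onb" and h: "\<And>e. norm (h e) = norm (g e)"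
    and Sx: "\<And>x. ((\<lambda>e. cinner x (g e) *\<^sub>C h e) has_sum S x) onb"
    by (rule trace_class_expansion[OF S]) (rule that)
  define f where "f k e = cinner (U e) (g k) * cinner (h k) e" for k e
  define b where "b k e = (cmod (cinner (adj U (g k)) e))\<^sup>2 + (cmod (cinner (h k) e))\<^sup>2" for k e
  have fb: "norm (f k e) \<le> b k e" for k e
  proof -
    have "cmod (cinner (U e) (g k)) = cmod (cinner (adj U (g k)) e)"
      by (metis cinner_adj_right[OF U(1)] cmod_cinner_commute)
    moreover have "x * y \<le> x\<^sup>2 + y\<^sup>2" if "x \<ge> 0" "y \<ge> 0" for x y :: real
      using sum_squares_bound[of x y] mult_nonneg_nonneg[OF that] by simp
    ultimately show ?thesis by (simp only: f_def b_def norm_mult norm_ge_zero)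
  qed
  have b_sum: "(b k has_sum (norm (adj U (g k)))\<^sup>2 + (norm (h k))\<^sup>2) onb" for k
    unfolding b_def by (intro has_sum_add Parseval)
  have "(\<lambda>k. (norm (adj U (g k)))\<^sup>2 + (norm (h k))\<^sup>2) summable_on onb"
  proof (rule summable_on_comparison_test)
    show "(\<lambda>k. (norm (g k))\<^sup>2 + (norm (g k))\<^sup>2) summable_on onb" by (intro summable_on_add g)
    show "(norm (adj U (g k)))\<^sup>2 + (norm (h k))\<^sup>2 \<le> (norm (g k))\<^sup>2 + (norm (g k))\<^sup>2" for k
      unfolding h using U(2) by (simp add: power_mono)
  qed simp
  then have "(\<lambda>(k, e). b k e) summable_on onb \<times> onb"
    by (intro summable_on_SigmaI[where g="\<lambda>k. (norm (adj U (g k)))\<^sup>2 + (norm (h k))\<^sup>2"])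
      (simp_all add: b_sum, simp add: b_def)
  then have "(\<lambda>p. norm (case p of (k, e) \<Rightarrow> f k e)) summable_on onb \<times> onb"
    by (rule summable_on_comparison_test) (use fb in auto)
  then have "(\<lambda>(k, e). f k e) summable_on onb \<times> onb" by (rule Infinite_Sum.abs_summable_summable)
  then have "(\<lambda>(e, k). f k e) summable_on onb \<times> onb"
    using summable_on_swap[of "\<lambda>(k, e). f k e" onb onb] by simp
  from summable_on_Sigma_banach[OF this]
  have "(\<lambda>e. \<Sum>\<^sub>\<infinity>k\<in>onb. f k e) summable_on onb" .
  moreover have "(\<Sum>\<^sub>\<infinity>k\<in>onb. f k e) = cinner (S (U e)) e" for e
    using has_sum_bounded_linear[OF bounded_linear_cinner_left Sx[of "U e"], of e]
    by (intro infsumI) (simp add: f_def cinner_scaleC_left)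
  ultimately show ?thesis by simp
qed

section \<open>Finite rank operators are of trace class\<close>

lemma Gram_Schmidt:
  fixes v :: "'i \<Rightarrow> 'h::complex_hilbert_space"
  assumes "finite I"
  shows "\<exists>F. finite F \<and> orthonormal F \<and>
    (\<forall>x. (\<forall>i\<in>I. cinner x (v i) = 0) \<longleftrightarrow> (\<forall>f\<in>F. cinner x f = 0))"
  using assms
proof induct
  case empty
  then show ?case by (intro exI[of _ "{}"]) (simp add: orthonormal_def)
next
  case (insert i I)
  then obtain F where F: "finite F" "orthonormal F"
    and F1: "\<And>x. (\<forall>i\<in>I. cinner x (v i) = 0) \<Longrightarrow> (\<forall>f\<in>F. cinner x f = 0)"
    and F2: "\<And>x. (\<forall>f\<in>F. cinner x f = 0) \<Longrightarrow> (\<forall>i\<in>I. cinner x (v i) = 0)" by blast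
  define r where "r = v i - (\<Sum>f\<in>F. cinner (v i) f *\<^sub>C f)"
  have rF: "cinner r f = 0" if "f \<in> F" for f
    using that F by (simp add: r_def cinner_diff_left orthonormal_cinner_sum)
  have vr: "cinner x (v i) = cinner x r" if "\<forall>f\<in>F. cinner x f = 0" for x
    using that by (simp add: r_def cinner_diff_right cinner_sum_right cinner_scaleC_right)
  show ?case
  proof (cases "r = 0")
    case True
    then have "cinner x (v i) = 0" if "\<forall>f\<in>F. cinner x f = 0" for x using vr[OF that] by simp
    then show ?thesis using F F1 F2 by (intro exI[of _ F]) blast
  next
    case False
    define u where "u = complex_of_real (1 / norm r) *\<^sub>C r"
    have "norm u = 1" using False by (simp add: u_def norm_divide)
    then have uu: "cinner u u = 1" by (simp add: cinner_self)
    have uF: "cinner u f = 0 \<and> cinner f u = 0" if "f \<in> F" for f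
    proof -
      have "cinner u f = 0" using rF[OF that] by (simp add: u_def cinner_scaleC_left)
      then show ?thesis by (metis cinner_commute complex_cnj_zero)
    qed
    have xu: "cinner x u = 0 \<longleftrightarrow> cinner x r = 0" for x
      using False by (simp add: u_def cinner_scaleC_right)
    have "u \<notin> F" using uF uu by force
    then have "orthonormal (insert u F)" using F(2) uu uF unfolding orthonormal_def by auto
    moreover have "cinner x f = 0" if "\<forall>j\<in>insert i I. cinner x (v j) = 0" "f \<in> insert u F" for x f
      using that F1[of x] vr[of x] xu[of x] by auto
    moreover have "cinner x (v j) = 0" if "\<forall>f\<in>insert u F. cinner x f = 0" "j \<in> insert i I" for x j
      using that F2[of x] vr[of x] xu[of x] by auto
    ultimately show ?thesis using F(1) by (intro exI[of _ "insert u F"]) blast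
  qed
qed

text \<open>Since \<open>P\<close> has the norms of the operator, it vanishes on the orthogonal
  complement of all \<open>v i\<close>. It is thus determined by its values on the finite set
  \<open>F\<close> spanning the same complement, and its diagonal is a finite sum of Parseval
  series.\<close>

lemma finite_rank_trace_class:
  fixes u v :: "'i \<Rightarrow> 'h::complex_hilbert_space"
  assumes "finite I"
  shows "(\<lambda>x. \<Sum>i\<in>I. cinner x (v i) *\<^sub>C u i) \<in> trace_class" (is "?S \<in> _")
proof -
  have bS: "bounded_clinear ?S" by (rule bounded_clinear_finite_rank)
  obtain P where P: "is_operator_abs ?S P" using ex_operator_abs[OF bS] by blast
  then have bP: "bounded_clinear P" and pP: "positive_on UNIV P"
    by (auto simp: is_operator_abs_def)
  obtain F where F: "finite F" "orthonormal F"
    and F2: "\<And>x. (\<forall>f\<in>F. cinner x f = 0) \<Longrightarrow> (\<forall>i\<in>I. cinner x (v i) = 0)"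
    using Gram_Schmidt[OF assms, of v] by blast
  have P_F: "P x = (\<Sum>f\<in>F. cinner x f *\<^sub>C P f)" for x
  proof -
    define y where "y = x - (\<Sum>f\<in>F. cinner x f *\<^sub>C f)"
    have "\<forall>f\<in>F. cinner y f = 0"
      using F by (simp add: y_def cinner_diff_left orthonormal_cinner_sum)
    from F2[OF this] have "?S y = 0" by simp
    then have "norm (P y) = 0" using operator_abs_norm[OF bS P, of y] by simp
    then show ?thesis
      by (simp add: y_def bounded_clinear_diff[OF bP] bounded_clinear_sum[OF bP] bounded_clinear_scaleC[OF bP])
  qed
  have "(\<lambda>e. \<Sum>f\<in>G. cinner e f * cinner (P f) e) summable_on onb" if "finite G" for G
    using that
  proof induct
    case (insert f G)
    have "(\<lambda>e. cinner (P f) e * cinner e f) summable_on onb"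
      using Parseval_cinner has_sum_imp_summable by blast
    then show ?case using insert by (simp add: summable_on_add mult.commute)
  qed simp
  moreover have "cinner (P e) e = (\<Sum>f\<in>F. cinner e f * cinner (P f) e)" for e
    by (subst P_F) (simp add: cinner_sum_left cinner_scaleC_left)
  ultimately have "(\<lambda>e. cinner (P e) e) summable_on onb" using F(1) by simp
  then show ?thesis using P bS by (auto simp: trace_class_def)
qed

section \<open>Square integrable functions\<close>

lemma
  assumes "f \<in> L2_fun M"
  shows L2_fun_measurable: "f \<in> borel_measurable M"
    and L2_fun_integrable: "integrable M (\<lambda>x. (cmod (f x))\<^sup>2)"
  using assms by (auto simp: L2_fun_def)

lemma L2_norm_nonneg: "0 \<le> L2_norm M f"
  by (simp add: L2_norm_def)

lemma L2_norm_sq: "(L2_norm M f)\<^sup>2 = (LINT x|M. (cmod (f x))\<^sup>2)"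
  by (simp add: L2_norm_def)

lemma nn_integral_L2_fun:
  assumes "f \<in> L2_fun M"
  shows "(\<integral>\<^sup>+x. ennreal ((cmod (f x))\<^sup>2) \<partial>M) = ennreal ((L2_norm M f)\<^sup>2)"
  unfolding L2_norm_sq by (rule nn_integral_eq_integral[OF L2_fun_integrable[OF assms]]) simp

lemma L2_funI_nn_integral:
  assumes "f \<in> borel_measurable M" "(\<integral>\<^sup>+x. ennreal ((cmod (f x))\<^sup>2) \<partial>M) \<le> ennreal (C\<^sup>2)" "0 \<le> C"
  shows "f \<in> L2_fun M" "L2_norm M f \<le> C"
proof -
  have "integrable M (\<lambda>x. (cmod (f x))\<^sup>2)"
    by (rule integrableI_nonneg) (use assms in \<open>auto intro: le_less_trans\<close>)
  then show f: "f \<in> L2_fun M" using assms(1) by (simp add: L2_fun_def)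
  have "ennreal ((L2_norm M f)\<^sup>2) \<le> ennreal (C\<^sup>2)" using nn_integral_L2_fun[OF f] assms(2) by simp
  then have "(L2_norm M f)\<^sup>2 \<le> C\<^sup>2" by (simp add: ennreal_le_iff)
  then show "L2_norm M f \<le> C" using assms(3) by (rule power2_le_imp_le)
qed

lemma L2_fun_scale_add:
  assumes f: "f \<in> L2_fun M" and g: "g \<in> L2_fun M"
  shows "(\<lambda>x. c * f x + g x) \<in> L2_fun M"
proof -
  note [measurable] = L2_fun_measurable[OF f] L2_fun_measurable[OF g]
  have "integrable M (\<lambda>x. (cmod (c * f x + g x))\<^sup>2)"
  proof (rule Bochner_Integration.integrable_bound)
    show "integrable M (\<lambda>x. (2 * (cmod c)\<^sup>2) * (cmod (f x))\<^sup>2 + 2 * (cmod (g x))\<^sup>2)"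
      by (intro Bochner_Integration.integrable_add integrable_mult_right L2_fun_integrable f g)
    show "AE x in M. norm ((cmod (c * f x + g x))\<^sup>2) \<le> norm ((2 * (cmod c)\<^sup>2) * (cmod (f x))\<^sup>2 + 2 * (cmod (g x))\<^sup>2)"
    proof (rule AE_I2)
      fix x show "norm ((cmod (c * f x + g x))\<^sup>2) \<le> norm ((2 * (cmod c)\<^sup>2) * (cmod (f x))\<^sup>2 + 2 * (cmod (g x))\<^sup>2)"
        using norm_add_sq_le[of 1 "c * f x" "g x"] by (simp add: norm_mult power_mult_distrib)
    qed
  qed simp
  then show ?thesis by (simp add: L2_fun_def)
qed

lemma L2_fun_add: "f \<in> L2_fun M \<Longrightarrow> g \<in> L2_fun M \<Longrightarrow> (\<lambda>x. f x + g x) \<in> L2_fun M"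
  using L2_fun_scale_add[of f M g 1] by simp

lemma L2_fun_diff: "f \<in> L2_fun M \<Longrightarrow> g \<in> L2_fun M \<Longrightarrow> (\<lambda>x. f x - g x) \<in> L2_fun M"
  using L2_fun_scale_add[of g M f "-1"] by simp

lemma L2_fun_zero: "(\<lambda>x. 0) \<in> L2_fun M"
  by (simp add: L2_fun_def)

lemma L2_fun_scale: "f \<in> L2_fun M \<Longrightarrow> (\<lambda>x. c * f x) \<in> L2_fun M"
  using L2_fun_scale_add[OF _ L2_fun_zero] by simp

lemma L2_fun_sum: "(\<And>i. i \<in> I \<Longrightarrow> f i \<in> L2_fun M) \<Longrightarrow> (\<lambda>x. \<Sum>i\<in>I. f i x) \<in> L2_fun M"
  by (induct I rule: infinite_finite_induct) (auto intro: L2_fun_zero L2_fun_add)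

lemma L2_norm_triangle:
  assumes f: "f \<in> L2_fun M" and g: "g \<in> L2_fun M"
  shows "L2_norm M (\<lambda>x. f x + g x) \<le> L2_norm M f + L2_norm M g"
  unfolding L2_norm_def
proof (rule sqrt_le_add_sqrt)
  fix t :: real assume "t > 0"
  note [simp] = L2_fun_integrable[OF f] L2_fun_integrable[OF g] L2_fun_integrable[OF L2_fun_add[OF f g]]
  have "(LINT x|M. (cmod (f x + g x))\<^sup>2) \<le> (LINT x|M. (1 + t) * (cmod (f x))\<^sup>2 + (1 + 1 / t) * (cmod (g x))\<^sup>2)"
    by (rule integral_mono) (use norm_add_sq_le[OF \<open>t > 0\<close>] in auto)
  then show "(LINT x|M. (cmod (f x + g x))\<^sup>2)
      \<le> (1 + t) * (LINT x|M. (cmod (f x))\<^sup>2) + (1 + 1 / t) * (LINT x|M. (cmod (g x))\<^sup>2)" by simp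
qed simp_all

lemma L2_norm_scale: "L2_norm M (\<lambda>x. c * f x) = cmod c * L2_norm M f"
  by (simp add: L2_norm_def norm_mult power_mult_distrib real_sqrt_mult)

lemma L2_norm_minus_commute: "L2_norm M (\<lambda>x. f x - g x) = L2_norm M (\<lambda>x. g x - f x)"
  by (simp add: L2_norm_def norm_minus_commute)

lemma L2_norm_triangle_diff:
  assumes "f \<in> L2_fun M" "g \<in> L2_fun M" "h \<in> L2_fun M"
  shows "L2_norm M (\<lambda>x. f x - h x) \<le> L2_norm M (\<lambda>x. f x - g x) + L2_norm M (\<lambda>x. g x - h x)"
  using L2_norm_triangle[OF L2_fun_diff[OF assms(1,2)] L2_fun_diff[OF assms(2,3)]] by simp

lemma L2_norm_diff_le:
  assumes "f \<in> L2_fun M" "g \<in> L2_fun M"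
  shows "\<bar>L2_norm M f - L2_norm M g\<bar> \<le> L2_norm M (\<lambda>x. f x - g x)"
  using L2_norm_triangle[OF L2_fun_diff[OF assms] assms(2)]
    L2_norm_triangle[OF L2_fun_diff[OF assms(2,1)] assms(1)] L2_norm_minus_commute[of M f g]
  by simp

lemma L2_norm_cong_AE:
  assumes "f \<in> L2_fun M" "g \<in> L2_fun M" "AE x in M. f x = g x"
  shows "L2_norm M f = L2_norm M g"
  unfolding L2_norm_def using assms
  by (intro arg_cong[where f=sqrt] integral_cong_AE) (auto dest: L2_fun_measurable elim: eventually_mono)

lemma L2_norm_zero_AE:
  assumes f: "f \<in> L2_fun M" and "L2_norm M f = 0"
  shows "AE x in M. f x = 0"
proof -
  have "(LINT x|M. (cmod (f x))\<^sup>2) = 0" using assms(2) L2_norm_sq[of M f] by simp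
  then have "AE x in M. (cmod (f x))\<^sup>2 = 0"
    using integral_nonneg_eq_0_iff_AE[OF L2_fun_integrable[OF f]] by simp
  then show ?thesis by (rule eventually_mono) simp
qed

lemma L2_norm_diff_zero_AE:
  assumes "f \<in> L2_fun M" "g \<in> L2_fun M" "L2_norm M (\<lambda>x. f x - g x) = 0"
  shows "AE x in M. f x = g x"
  using L2_norm_zero_AE[OF L2_fun_diff[OF assms(1,2)] assms(3)] by (rule eventually_mono) simp

text \<open>Fatou's lemma for the squared moduli yields membership and norm bound at once, without a
  dominating function. The bound is asked only from \<open>m\<close> on because it will be applied
  to differences \<open>g n - g m\<close>.\<close>

lemma L2_Fatou:
  assumes g: "\<And>n. g n \<in> L2_fun M" and f: "f \<in> borel_measurable M"
    and lim: "AE x in M. (\<lambda>n. g n x) \<longlonglongrightarrow> f x"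
    and bound: "\<And>n. n \<ge> m \<Longrightarrow> L2_norm M (g n) \<le> C" and "0 \<le> C"
  shows "f \<in> L2_fun M" "L2_norm M f \<le> C"
proof -
  have "(\<integral>\<^sup>+x. ennreal ((cmod (f x))\<^sup>2) \<partial>M) = (\<integral>\<^sup>+x. liminf (\<lambda>n. ennreal ((cmod (g n x))\<^sup>2)) \<partial>M)"
  proof (rule nn_integral_cong_AE, use lim in eventually_elim)
    case (elim x)
    have "(\<lambda>n. ennreal ((cmod (g n x))\<^sup>2)) \<longlonglongrightarrow> ennreal ((cmod (f x))\<^sup>2)"
      by (intro tendsto_ennrealI tendsto_intros elim)
    then show ?case by (intro lim_imp_Liminf[symmetric]) auto
  qed
  also have "\<dots> \<le> liminf (\<lambda>n. \<integral>\<^sup>+x. ennreal ((cmod (g n x))\<^sup>2) \<partial>M)"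
    by (rule nn_integral_liminf) (use L2_fun_measurable[OF g] in measurable)
  also have "\<dots> \<le> liminf (\<lambda>n. ennreal (C\<^sup>2))"
  proof (rule Liminf_mono, rule eventually_sequentiallyI[of m])
    fix n assume "m \<le> n"
    then show "(\<integral>\<^sup>+x. ennreal ((cmod (g n x))\<^sup>2) \<partial>M) \<le> ennreal (C\<^sup>2)"
      using bound[of n] by (simp add: nn_integral_L2_fun[OF g] ennreal_leI power_mono L2_norm_nonneg)
  qed
  also have "\<dots> = ennreal (C\<^sup>2)" by (simp add: Liminf_const)
  finally show "f \<in> L2_fun M" "L2_norm M f \<le> C"
    using L2_funI_nn_integral[OF f _ \<open>0 \<le> C\<close>] by blast+
qed

text \<open>Almost everywhere convergence comes from \<open>2 \<bar>d n\<bar> \<le> 2\<^sup>n \<bar>d n\<bar>\<^sup>2 + 2\<^sup>-\<^sup>n\<close> for the increments \<open>d n\<close>, since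
  \<open>\<Sum>n. 2\<^sup>n \<bar>d n\<bar>\<^sup>2\<close> is integrable.\<close>

lemma L2_rapidly_Cauchy_convergent:
  assumes s: "\<And>n. s n \<in> L2_fun M"
    and cauchy: "\<And>n. L2_norm M (\<lambda>x. s (Suc n) x - s n x) \<le> (1 / 2) ^ n"
  obtains f where "f \<in> L2_fun M" "\<And>n. L2_norm M (\<lambda>x. f x - s n x) \<le> 2 * (1 / 2) ^ n"
proof -
  define d where "d n x = s (Suc n) x - s n x" for n x
  have d: "d n \<in> L2_fun M" for n
    using L2_fun_diff[OF s s] by (simp add: d_def[abs_def])
  note [measurable] = L2_fun_measurable[OF s] L2_fun_measurable[OF d]
  have "(\<integral>\<^sup>+x. (\<Sum>n. ennreal (2 ^ n * (cmod (d n x))\<^sup>2)) \<partial>M) = (\<Sum>n. \<integral>\<^sup>+x. ennreal (2 ^ n * (cmod (d n x))\<^sup>2) \<partial>M)"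
    by (rule nn_integral_suminf) simp
  also have "\<dots> \<le> (\<Sum>n. ennreal ((1 / 2) ^ n))"
  proof (rule suminf_le)
    fix n
    have "(\<integral>\<^sup>+x. ennreal (2 ^ n * (cmod (d n x))\<^sup>2) \<partial>M) = ennreal (2 ^ n) * ennreal ((L2_norm M (d n))\<^sup>2)"
      unfolding nn_integral_L2_fun[OF d, symmetric]
      by (subst nn_integral_cmult[symmetric]) (auto simp: ennreal_mult)
    also have "\<dots> \<le> ennreal (2 ^ n) * ennreal (((1 / 2) ^ n)\<^sup>2)"
      using cauchy[of n] by (intro mult_left_mono ennreal_leI power_mono L2_norm_nonneg) (auto simp: d_def[abs_def])
    also have "\<dots> = ennreal ((1 / 2) ^ n)"
      by (simp add: power2_eq_square power_divide flip: ennreal_mult)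
    finally show "(\<integral>\<^sup>+x. ennreal (2 ^ n * (cmod (d n x))\<^sup>2) \<partial>M) \<le> ennreal ((1 / 2) ^ n)" .
  qed auto
  also have "\<dots> = ennreal (\<Sum>n. (1 / 2) ^ n)"
    by (rule suminf_ennreal2) (auto intro: summable_geometric)
  also have "\<dots> < \<infinity>" by simp
  finally have "AE x in M. (\<Sum>n. ennreal (2 ^ n * (cmod (d n x))\<^sup>2)) \<noteq> \<infinity>"
    by (intro nn_integral_PInf_AE) auto
  then have "AE x in M. convergent (\<lambda>n. s n x)"
  proof eventually_elim
    case (elim x)
    then have "summable (\<lambda>n. 2 ^ n * (cmod (d n x))\<^sup>2)"
      by (intro summable_suminf_not_top) auto
    then have "summable (\<lambda>n. 2 ^ n * (cmod (d n x))\<^sup>2 + (1 / 2) ^ n)"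
      by (intro summable_add summable_geometric) auto
    then have "summable (\<lambda>n. d n x)"
    proof (rule summable_comparison_test')
      fix n
      have "0 \<le> (2 ^ n * cmod (d n x) - 1)\<^sup>2" by simp
      then have "2 * (2 ^ n * cmod (d n x)) \<le> (2 ^ n * cmod (d n x))\<^sup>2 + 1"
        by (simp add: power2_diff)
      moreover have "0 \<le> 2 ^ n * cmod (d n x)" by simp
      ultimately have "2 ^ n * cmod (d n x) \<le> (2 ^ n * cmod (d n x))\<^sup>2 + 1" by linarith
      also have "\<dots> = 2 ^ n * (2 ^ n * (cmod (d n x))\<^sup>2 + (1 / 2) ^ n)"
        by (simp add: power2_eq_square algebra_simps power_divide)
      finally have "2 ^ n * cmod (d n x) \<le> 2 ^ n * (2 ^ n * (cmod (d n x))\<^sup>2 + (1 / 2) ^ n)" .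
      then show "norm (d n x) \<le> 2 ^ n * (cmod (d n x))\<^sup>2 + (1 / 2) ^ n"
        by (simp add: mult_le_cancel_left_pos)
    qed
    then have "convergent (\<lambda>n. s 0 x + (\<Sum>k<n. d k x))"
      by (intro convergent_add convergent_const) (simp add: summable_iff_convergent)
    moreover have "s 0 x + (\<Sum>k<n. d k x) = s n x" for n
      unfolding d_def by (simp add: sum_lessThan_telescope[of "\<lambda>n. s n x" n])
    ultimately show ?case by simp
  qed
  then have lim: "AE x in M. (\<lambda>n. s n x) \<longlonglongrightarrow> lim (\<lambda>n. s n x)"
    by (simp add: convergent_LIMSEQ_iff)
  \<comment> \<open>On the null set of divergence \<open>lim\<close> takes a value without meaning,
    but \<open>f\<close> is measurable everywhere.\<close>
  define f where "f x = lim (\<lambda>n. s n x)" for x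
  have f: "f \<in> borel_measurable M" unfolding f_def by measurable
  \<comment> \<open>The subtracted term makes the induction close: each increment
    \<open>(1 / 2) ^ (n + k)\<close> is exactly the gain in the telescoping bound.\<close>
  have dist: "L2_norm M (\<lambda>x. s (n + k) x - s n x) \<le> 2 * (1 / 2) ^ n - 2 * (1 / 2) ^ (n + k)" for n k
  proof (induct k)
    case 0
    then show ?case by (simp add: L2_norm_def)
  next
    case (Suc k)
    have "L2_norm M (\<lambda>x. s (n + Suc k) x - s n x)
        \<le> L2_norm M (\<lambda>x. s (Suc (n + k)) x - s (n + k) x) + L2_norm M (\<lambda>x. s (n + k) x - s n x)"
      using L2_norm_triangle_diff[OF s s s] by simp
    then show ?case using cauchy[of "n + k"] Suc by simp
  qed
  have lim_n: "AE x in M. (\<lambda>k. s k x - s n x) \<longlonglongrightarrow> f x - s n x" for n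
    using lim unfolding f_def by eventually_elim (intro tendsto_intros)
  have bound: "L2_norm M (\<lambda>x. s k x - s n x) \<le> 2 * (1 / 2) ^ n" if "k \<ge> n" for n k
  proof -
    have "L2_norm M (\<lambda>x. s k x - s n x) \<le> 2 * (1 / 2) ^ n - 2 * (1 / 2) ^ k"
      using dist[of n "k - n"] that by simp
    also have "\<dots> \<le> 2 * (1 / 2) ^ n" by simp
    finally show ?thesis .
  qed
  have fs: "(\<lambda>x. f x - s n x) \<in> L2_fun M" "L2_norm M (\<lambda>x. f x - s n x) \<le> 2 * (1 / 2) ^ n" for n
  proof -
    have m: "(\<lambda>x. f x - s n x) \<in> borel_measurable M" using f by measurable
    show "(\<lambda>x. f x - s n x) \<in> L2_fun M" "L2_norm M (\<lambda>x. f x - s n x) \<le> 2 * (1 / 2) ^ n"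
      using L2_Fatou[OF L2_fun_diff[OF s s] m lim_n bound] by simp_all
  qed
  have "f \<in> L2_fun M" using L2_fun_add[OF fs(1)[of 0] s[of 0]] by simp
  then show thesis using fs(2) that by blast
qed

section \<open>Orthogonal series of square integrable functions\<close>

lemma integrable_L2_product:
  assumes f: "f \<in> L2_fun M" and g: "g \<in> L2_fun M"
  shows "integrable M (\<lambda>x. f x * cnj (g x))"
proof (rule Bochner_Integration.integrable_bound)
  show "integrable M (\<lambda>x. (cmod (f x))\<^sup>2 + (cmod (g x))\<^sup>2)"
    by (intro Bochner_Integration.integrable_add L2_fun_integrable f g)
  show "AE x in M. norm (f x * cnj (g x)) \<le> norm ((cmod (f x))\<^sup>2 + (cmod (g x))\<^sup>2)"
  proof (rule AE_I2)
    fix x show "norm (f x * cnj (g x)) \<le> norm ((cmod (f x))\<^sup>2 + (cmod (g x))\<^sup>2)"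
      using sum_squares_bound[of "cmod (f x)" "cmod (g x)"] mult_nonneg_nonneg[OF norm_ge_zero norm_ge_zero, of "f x" "g x"]
      by (simp add: norm_mult del: mult_nonneg_nonneg)
  qed
  show "(\<lambda>x. f x * cnj (g x)) \<in> borel_measurable M"
    using L2_fun_measurable[OF f]
      measurable_compose[OF L2_fun_measurable[OF g] borel_measurable_continuous_onI[OF continuous_on_cnj[OF continuous_on_id]]]
    by measurable
qed

lemma L2_norm_orthogonal_sum:
  assumes "finite F" and w: "\<And>e. e \<in> F \<Longrightarrow> w e \<in> L2_fun M"
    and orth: "\<And>e d. e \<in> F \<Longrightarrow> d \<in> F \<Longrightarrow> L2_inner M (w e) (w d) = (if e = d then complex_of_real (N e) else 0)"
  shows "(L2_norm M (\<lambda>x. \<Sum>e\<in>F. w e x))\<^sup>2 = (\<Sum>e\<in>F. N e)"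
proof -
  have "complex_of_real ((L2_norm M (\<lambda>x. \<Sum>e\<in>F. w e x))\<^sup>2) = (LINT x|M. complex_of_real ((cmod (\<Sum>e\<in>F. w e x))\<^sup>2))"
    unfolding L2_norm_sq by (rule integral_complex_of_real[symmetric])
  also have "\<dots> = (LINT x|M. (\<Sum>e\<in>F. \<Sum>d\<in>F. w e x * cnj (w d x)))"
    by (simp only: complex_norm_square cnj_sum sum_product)
  also have "\<dots> = (\<Sum>e\<in>F. \<Sum>d\<in>F. L2_inner M (w e) (w d))"
    unfolding L2_inner_def
    by (simp add: integral_sum integrable_sum integrable_L2_product w)
  also have "\<dots> = (\<Sum>e\<in>F. \<Sum>d\<in>F. if e = d then complex_of_real (N e) else 0)"
    by (intro sum.cong refl orth)
  also have "\<dots> = complex_of_real (\<Sum>e\<in>F. N e)" using assms(1) by simp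
  finally show ?thesis using of_real_eq_iff by blast
qed

text \<open>Turns an unordered sum into a limit along a sequence, as measurability of limits and
  Fatou's lemma require.\<close>

lemma countable_exhaustion:
  assumes "countable B"
  obtains F :: "nat \<Rightarrow> 'i set" where "\<And>n. finite (F n)" "\<And>n. F n \<subseteq> B" "\<And>m n. m \<le> n \<Longrightarrow> F m \<subseteq> F n"
    "filterlim F (finite_subsets_at_top B) sequentially"
proof -
  define F where "F n = {e \<in> B. to_nat_on B e < n}" for n
  have fin: "finite (F n)" for n
  proof (rule inj_on_finite)
    show "inj_on (to_nat_on B) (F n)"
      by (rule inj_on_subset[OF inj_on_to_nat_on[OF assms]]) (auto simp: F_def)
    show "to_nat_on B ` F n \<subseteq> {..<n}" by (auto simp: F_def)
  qed simp
  have "filterlim F (finite_subsets_at_top B) sequentially"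
    unfolding filterlim_finite_subsets_at_top
  proof (intro allI impI)
    fix X assume X: "finite X \<and> X \<subseteq> B"
    have "finite (F y) \<and> X \<subseteq> F y \<and> F y \<subseteq> B" if y: "y \<ge> Suc (Max (insert 0 (to_nat_on B ` X)))" for y
    proof -
      have "to_nat_on B e < y" if "e \<in> X" for e
      proof -
        have "to_nat_on B e \<le> Max (insert 0 (to_nat_on B ` X))"
          by (rule Max_ge) (use X that in auto)
        then show ?thesis using y by simp
      qed
      then show ?thesis using fin X by (auto simp: F_def)
    qed
    then show "\<forall>\<^sub>F y in sequentially. finite (F y) \<and> X \<subseteq> F y \<and> F y \<subseteq> B"
      by (rule eventually_sequentiallyI)
  qed
  then show thesis using fin by (intro that[of F]) (auto simp: F_def)
qed

text \<open>The pointwise sum \<open>f\<close> is given in advance, so the task is to identify it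
  with the mean-square limit. Orthogonality bounds the distance of later partial sums from the
  \<open>m\<close>-th by the remainder of \<open>N\<close>; Fatou's lemma carries this bound over to
  \<open>f\<close>.\<close>

lemma L2_orthogonal_series:
  fixes B :: "'i set"
  assumes B: "countable B" and w: "\<And>e. e \<in> B \<Longrightarrow> w e \<in> L2_fun M"
    and orth: "\<And>e d. e \<in> B \<Longrightarrow> d \<in> B \<Longrightarrow> L2_inner M (w e) (w d) = (if e = d then complex_of_real (N e) else 0)"
    and N: "(N has_sum S) B" and N_nonneg: "\<And>e. e \<in> B \<Longrightarrow> 0 \<le> N e"
    and f: "\<And>x. x \<in> space M \<Longrightarrow> ((\<lambda>e. w e x) has_sum f x) B"
  shows "f \<in> L2_fun M" "(L2_norm M f)\<^sup>2 = S"
proof -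
  obtain F where F: "\<And>n. finite (F n)" "\<And>n. F n \<subseteq> B" "\<And>m n. m \<le> n \<Longrightarrow> F m \<subseteq> F n"
    and F_lim: "filterlim F (finite_subsets_at_top B) sequentially"
    using countable_exhaustion[OF B] by metis
  define s where "s n x = (\<Sum>e\<in>F n. w e x)" for n x
  have s: "s n \<in> L2_fun M" for n
    using L2_fun_sum[of "F n" w M] w F(2) by (auto simp: s_def[abs_def])
  note [measurable] = L2_fun_measurable[OF s]
  have s_lim: "(\<lambda>n. s n x) \<longlonglongrightarrow> f x" if "x \<in> space M" for x
    using filterlim_compose[OF f[OF that, unfolded has_sum_def] F_lim] by (simp add: s_def)
  have N_lim: "(\<lambda>n. \<Sum>e\<in>F n. N e) \<longlonglongrightarrow> S"
    using filterlim_compose[OF N[unfolded has_sum_def] F_lim] .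
  have f_meas: "f \<in> borel_measurable M"
    by (rule borel_measurable_LIMSEQ_metric[OF _ s_lim]) simp_all
  have s_norm: "(L2_norm M (s n))\<^sup>2 = (\<Sum>e\<in>F n. N e)" for n
    unfolding s_def using F(1,2) w orth by (intro L2_norm_orthogonal_sum) (auto simp: subset_iff)
  \<comment> \<open>The remainder bounds the squared distances uniformly in \<open>n\<close> and
    tends to zero.\<close>
  define r where "r m = S - (\<Sum>e\<in>F m. N e)" for m
  have part_le: "(\<Sum>e\<in>G. N e) \<le> S" if "finite G" "G \<subseteq> B" for G
    using finite_sum_le_has_sum[OF N that] N_nonneg by auto
  have r_nonneg: "r m \<ge> 0" for m using part_le[OF F(1,2)] by (simp add: r_def)
  have diff: "L2_norm M (\<lambda>x. s n x - s m x) \<le> sqrt (r m)" if "m \<le> n" for m n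
  proof -
    have "s n x - s m x = (\<Sum>e\<in>F n - F m. w e x)" for x
      unfolding s_def using sum_diff[OF F(1) F(3)[OF that]] by metis
    moreover have "(L2_norm M (\<lambda>x. \<Sum>e\<in>F n - F m. w e x))\<^sup>2 = (\<Sum>e\<in>F n - F m. N e)"
      using F(1)[of n] F(2)[of n] w orth by (intro L2_norm_orthogonal_sum) (auto simp: subset_iff)
    moreover have "(\<Sum>e\<in>F n - F m. N e) \<le> r m"
      using sum_diff[OF F(1) F(3)[OF that], of N] part_le[OF F(1,2), of n] by (simp add: r_def)
    ultimately show ?thesis by (simp add: real_le_rsqrt)
  qed
  have fs: "(\<lambda>x. f x - s m x) \<in> L2_fun M" "L2_norm M (\<lambda>x. f x - s m x) \<le> sqrt (r m)" for m
  proof -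
    have m: "(\<lambda>x. f x - s m x) \<in> borel_measurable M" using f_meas by measurable
    have lim: "AE x in M. (\<lambda>n. s n x - s m x) \<longlonglongrightarrow> f x - s m x"
      by (rule AE_I2) (intro tendsto_intros s_lim)
    show "(\<lambda>x. f x - s m x) \<in> L2_fun M" "L2_norm M (\<lambda>x. f x - s m x) \<le> sqrt (r m)"
      using L2_Fatou[OF L2_fun_diff[OF s s] m lim diff] r_nonneg by auto
  qed
  show fL: "f \<in> L2_fun M" using L2_fun_add[OF fs(1)[of 0] s[of 0]] by simp
  have "r \<longlonglongrightarrow> S - S" unfolding r_def by (intro tendsto_intros N_lim)
  then have r0: "(\<lambda>m. sqrt (r m)) \<longlonglongrightarrow> 0" using tendsto_real_sqrt by fastforce
  have "(\<lambda>m. L2_norm M (s m)) \<longlonglongrightarrow> L2_norm M f"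
  proof (rule LIM_zero_cancel, rule Lim_null_comparison[OF _ r0])
    show "\<forall>\<^sub>F m in sequentially. norm (L2_norm M (s m) - L2_norm M f) \<le> sqrt (r m)"
    proof (rule always_eventually, rule allI)
      fix m show "norm (L2_norm M (s m) - L2_norm M f) \<le> sqrt (r m)"
        using L2_norm_diff_le[OF fL s, of m] fs(2)[of m] by simp
    qed
  qed
  then have "(\<lambda>m. (L2_norm M (s m))\<^sup>2) \<longlonglongrightarrow> (L2_norm M f)\<^sup>2" by (intro tendsto_intros)
  then show "(L2_norm M f)\<^sup>2 = S" using N_lim LIMSEQ_unique unfolding s_norm by blast
qed

section \<open>Separability of the representation space\<close>

lemma countable_dense_span:
  fixes B :: "'a::real_normed_vector set"
  assumes B: "finite B" "span B = UNIV"
  obtains D :: "'a set" where "countable D" "closure D = UNIV"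
proof -
  \<comment> \<open>The coefficient functions are taken from an extensional product over the finite
    set \<open>B\<close>, which keeps the family countable.\<close>
  define D where "D = (\<lambda>q. \<Sum>b\<in>B. q b *\<^sub>R b) ` (PiE B (\<lambda>_. \<rat>))"
  have "countable D"
    unfolding D_def by (intro countable_image countable_PiE B countable_rat)
  moreover have "X \<in> closure D" for X
  proof -
    have "X \<in> span B" using B by simp
    then obtain r where r: "X = (\<Sum>b\<in>B. r b *\<^sub>R b)" unfolding span_finite[OF B(1)] by auto
    have "\<exists>q\<in>\<rat>. r b < q \<and> q < r b + 1 / real (Suc n)" for b n
      by (rule Rats_dense_in_real) simp
    then obtain q where q: "\<And>b n. q b n \<in> \<rat>" "\<And>b n. r b < q b n" "\<And>b n. q b n < r b + 1 / real (Suc n)"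
      by metis
    have "(\<lambda>n. q b n) \<longlonglongrightarrow> r b" for b
    proof (rule tendsto_sandwich)
      show "(\<lambda>n. r b) \<longlonglongrightarrow> r b" by simp
      have "(\<lambda>n. r b + 1 / real (Suc n)) \<longlonglongrightarrow> r b + 0"
        by (intro tendsto_intros LIMSEQ_Suc[OF lim_1_over_n])
      then show "(\<lambda>n. r b + 1 / real (Suc n)) \<longlonglongrightarrow> r b" by simp
    qed (use q in \<open>simp_all add: less_imp_le always_eventually\<close>)
    then have "(\<lambda>n. \<Sum>b\<in>B. q b n *\<^sub>R b) \<longlonglongrightarrow> X" unfolding r by (intro tendsto_intros)
    moreover have "(\<Sum>b\<in>B. q b n *\<^sub>R b) \<in> D" for n
      unfolding D_def
      by (rule image_eqI[where x="restrict (\<lambda>b. q b n) B"]) (use q in auto)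
    ultimately show ?thesis
      unfolding closure_sequential by (intro exI[of _ "\<lambda>n. \<Sum>b\<in>B. q b n *\<^sub>R b"]) blast
  qed
  ultimately show thesis using that by blast
qed

text \<open>By Bessel the squared coefficients are summable, and a summable real family has
  countable support.\<close>

lemma countable_not_orthogonal:
  assumes "orthonormal B"
  shows "countable {e \<in> B. cinner x e \<noteq> 0}"
  using summable_countable_real[OF Bessel_summable[OF assms, of x]] by simp

text \<open>The orbit of any nonzero vector is separable because the group is, and by irreducibility no vector
  is orthogonal to it.\<close>

lemma countable_onb:
  fixes \<pi> :: "'g \<Rightarrow> 'h::complex_hilbert_space \<Rightarrow> 'h" and Exp :: "'a::real_normed_vector \<Rightarrow> 'g"
    and G :: "('g, 'm) monoid_scheme"
  assumes G: "exponential_Lie_group G Exp" and U: "unitary_representation G Exp \<pi>"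
    and I: "irreducible_representation G \<pi>"
  shows "countable (onb :: 'h set)"
proof -
  interpret group G using G by (simp add: exponential_Lie_group_def)
  have Exp: "Exp ` UNIV = carrier G"
    using G by (simp add: exponential_Lie_group_def bij_betw_def)
  obtain B :: "'a set" where "finite B" "span B = UNIV"
    using G by (auto simp: exponential_Lie_group_def)
  then obtain D :: "'a set" where D: "countable D" "closure D = UNIV"
    using countable_dense_span by metis
  obtain \<psi> :: 'h where "\<psi> \<noteq> 0" using I by (auto simp: irreducible_representation_def)
  have inner: "cinner (\<pi> g x) (\<pi> g y) = cinner x y" if "g \<in> carrier G" for g x y
    using U that by (simp add: unitary_representation_def)
  have mult: "\<pi> (g \<otimes>\<^bsub>G\<^esub> h) x = \<pi> g (\<pi> h x)" if "g \<in> carrier G" "h \<in> carrier G" for g h x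
    using U that by (simp add: unitary_representation_def)
  \<comment> \<open>The orthogonal complement of the orbit of \<open>\<psi>\<close>: closed,
    invariant by unitarity, and not the whole space since it misses \<open>\<psi>\<close> itself.
    Irreducibility makes it trivial.\<close>
  define M where "M = {x. \<forall>g\<in>carrier G. cinner (\<pi> g \<psi>) x = 0}"
  have "csubspace M"
    by (auto simp: M_def csubspace_def cinner_add_right cinner_scaleC_right)
  moreover have "closed M"
    unfolding M_def Ball_def
    by (intro closed_Collect_all closed_Collect_imp closed_Collect_eq open_Collect_const)
      (auto intro!: continuous_intros)
  moreover have "\<pi> g ` M \<subseteq> M" if g: "g \<in> carrier G" for g
  proof
    fix z assume "z \<in> \<pi> g ` M"
    then obtain x where x: "x \<in> M" "z = \<pi> g x" by blast
    have "cinner (\<pi> k \<psi>) (\<pi> g x) = 0" if k: "k \<in> carrier G" for k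
    proof -
      have "\<pi> k \<psi> = \<pi> (g \<otimes>\<^bsub>G\<^esub> (inv\<^bsub>G\<^esub> g \<otimes>\<^bsub>G\<^esub> k)) \<psi>"
        using g k by (simp add: m_assoc[symmetric])
      also have "\<dots> = \<pi> g (\<pi> (inv\<^bsub>G\<^esub> g \<otimes>\<^bsub>G\<^esub> k) \<psi>)" using g k by (intro mult) auto
      finally show ?thesis using x(1) g k by (simp add: inner M_def)
    qed
    then show "z \<in> M" by (simp add: M_def x(2))
  qed
  ultimately have "M = {0} \<or> M = UNIV" using I unfolding irreducible_representation_def by blast
  moreover have "\<pi> \<one>\<^bsub>G\<^esub> \<psi> \<notin> M"
    using \<open>\<psi> \<noteq> 0\<close> by (auto simp: M_def inner cinner_eq_zero_iff intro!: bexI[of _ "\<one>\<^bsub>G\<^esub>"])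
  ultimately have M: "M = {0}" by blast
  \<comment> \<open>Orthogonality to the orbit along \<open>D\<close> would extend to all of it by
    continuity and put \<open>e\<close> into \<open>M\<close>. The basis is hence covered by
    countably many sets, each countable by Bessel.\<close>
  have "\<exists>X\<in>D. cinner (\<pi> (Exp X) \<psi>) e \<noteq> 0" if e: "e \<in> onb" for e :: 'h
  proof (rule ccontr)
    assume "\<not> ?thesis"
    then have D0: "D \<subseteq> {X. cinner (\<pi> (Exp X) \<psi>) e = 0}" by blast
    have "continuous_on UNIV (\<lambda>X. \<pi> (Exp X) \<psi>)" using U by (simp add: unitary_representation_def)
    then have "closed {X. cinner (\<pi> (Exp X) \<psi>) e = 0}"
      by (intro closed_Collect_eq continuous_intros)
    then have "UNIV \<subseteq> {X. cinner (\<pi> (Exp X) \<psi>) e = 0}" using closure_minimal[OF D0] D(2) by simp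
    then have "e \<in> M" unfolding M_def Exp[symmetric] by auto
    then have "cinner e e = 0" using M by simp
    then show False using e orthonormal_onb by (auto simp: orthonormal_def)
  qed
  then have "(onb :: 'h set) \<subseteq> (\<Union>X\<in>D. {e \<in> onb. cinner (\<pi> (Exp X) \<psi>) e \<noteq> 0})" by blast
  then show ?thesis
    by (rule countable_subset) (intro countable_UN D countable_not_orthogonal orthonormal_onb)
qed

section \<open>The Fourier--Wigner transform\<close>

text \<open>\<open>onb_countable\<close> allows countably many almost everywhere statements to be
  combined, and \<open>space_nonnull\<close> allows the result to be evaluated at an actual
  point.\<close>

locale Duflo_Moore =
  fixes \<mu> :: "'g measure" and \<pi> :: "'g \<Rightarrow> 'h::complex_hilbert_space \<Rightarrow> 'h"
    and V :: "'h set" and T :: "'h \<Rightarrow> 'h"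
  assumes pi_bounded: "x \<in> space \<mu> \<Longrightarrow> bounded_clinear (\<pi> x)"
    and pi_inner: "x \<in> space \<mu> \<Longrightarrow> cinner (\<pi> x \<psi>) (\<pi> x \<phi>) = cinner \<psi> \<phi>"
    and pi_surj: "x \<in> space \<mu> \<Longrightarrow> surj (\<pi> x)"
    and Duflo_Moore: "is_Duflo_Moore \<mu> \<pi> V T"
    and onb_countable: "countable (onb :: 'h set)"
    and space_nonnull: "emeasure \<mu> (space \<mu>) \<noteq> 0"
begin

lemma wavelet_eq: "x \<in> space \<mu> \<Longrightarrow> wavelet \<pi> \<phi> \<psi> x = cinner (\<pi> x \<psi>) \<phi>"
  by (simp add: wavelet_def cinner_adj_right pi_bounded)

lemma norm_adj_pi:
  assumes x: "x \<in> space \<mu>"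
  shows "norm (adj (\<pi> x) \<phi>) \<le> norm \<phi>"
proof -
  obtain \<psi> where \<psi>: "\<phi> = \<pi> x \<psi>" using pi_surj[OF x] by (metis surjD)
  have "adj (\<pi> x) \<phi> = \<psi>"
    by (rule cinner_eqI') (simp add: \<psi> cinner_adj_right pi_bounded pi_inner x)
  moreover have "(norm \<phi>)\<^sup>2 = (norm \<psi>)\<^sup>2" by (simp add: \<psi> norm_sq_eq_cinner pi_inner x)
  ultimately show ?thesis by simp
qed

section \<open>Kernel and range of the Duflo-Moore operator\<close>

lemma T_selfadjoint: "(y \<in> V \<and> T y = z) \<longleftrightarrow> (\<forall>x\<in>V. cinner (T x) y = cinner x z)"
  using Duflo_Moore unfolding is_Duflo_Moore_def positive_selfadjoint_def by blast

lemma V_csubspace: "csubspace V"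
  using Duflo_Moore unfolding is_Duflo_Moore_def positive_selfadjoint_def by blast

lemma T_add: "x \<in> V \<Longrightarrow> y \<in> V \<Longrightarrow> T (x + y) = T x + T y"
  and T_scaleC: "x \<in> V \<Longrightarrow> T (c *\<^sub>C x) = c *\<^sub>C T x"
  using Duflo_Moore unfolding is_Duflo_Moore_def positive_selfadjoint_def clinear_on_def by blast+

lemma wavelet_L2: "\<phi> \<in> V \<Longrightarrow> wavelet \<pi> \<phi> \<psi> \<in> L2_fun \<mu>"
  using Duflo_Moore unfolding is_Duflo_Moore_def by blast

lemma wavelet_orthogonality:
  "\<phi>\<^sub>1 \<in> V \<Longrightarrow> \<phi>\<^sub>2 \<in> V \<Longrightarrow> L2_inner \<mu> (wavelet \<pi> \<phi>\<^sub>1 \<psi>\<^sub>1) (wavelet \<pi> \<phi>\<^sub>2 \<psi>\<^sub>2) =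
    cinner \<psi>\<^sub>1 \<psi>\<^sub>2 * cnj (cinner (T \<phi>\<^sub>1) (T \<phi>\<^sub>2))"
  using Duflo_Moore unfolding is_Duflo_Moore_def by blast

text \<open>By the orthogonality relation every wavelet transform with window \<open>\<phi>\<close>
  has norm zero. Taking all basis vectors as signals at once yields one point \<open>x\<close> at
  which \<open>adj (\<pi> x) \<phi>\<close> has only zero coefficients; surjectivity of
  \<open>\<pi> x\<close> then gives \<open>\<phi> = 0\<close>.\<close>

lemma T_zero_imp_zero:
  assumes "\<phi> \<in> V" "T \<phi> = 0"
  shows "\<phi> = 0"
proof -
  have "AE x in \<mu>. wavelet \<pi> \<phi> \<psi> x = 0" for \<psi>
  proof (rule L2_norm_zero_AE[OF wavelet_L2[OF assms(1)]])
    have "L2_inner \<mu> (wavelet \<pi> \<phi> \<psi>) (wavelet \<pi> \<phi> \<psi>) = of_real ((L2_norm \<mu> (wavelet \<pi> \<phi> \<psi>))\<^sup>2)"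
      unfolding L2_inner_def L2_norm_sq complex_norm_square[symmetric] by (rule integral_complex_of_real)
    then show "L2_norm \<mu> (wavelet \<pi> \<phi> \<psi>) = 0"
      using wavelet_orthogonality[OF assms(1) assms(1), of \<psi> \<psi>] assms(2) by simp
  qed
  then have AE: "AE x in \<mu>. \<forall>e\<in>onb. wavelet \<pi> \<phi> e x = 0"
    by (simp add: AE_ball_countable onb_countable)
  have "\<exists>x\<in>space \<mu>. \<forall>e\<in>onb. wavelet \<pi> \<phi> e x = 0"
  proof (rule ccontr)
    assume none: "\<not> ?thesis"
    have "AE x in \<mu>. False" using AE AE_space by eventually_elim (use none in blast)
    then show False using space_nonnull by (simp add: AE_iff_measurable[OF sets.top])
  qed
  then obtain x where x: "x \<in> space \<mu>" and e: "\<forall>e\<in>onb. wavelet \<pi> \<phi> e x = 0" by blast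
  have "adj (\<pi> x) \<phi> = 0"
  proof (rule onb_total)
    fix d :: 'h assume "d \<in> onb"
    then have "cinner d (adj (\<pi> x) \<phi>) = 0" using e by (simp add: wavelet_def)
    then show "cinner (adj (\<pi> x) \<phi>) d = 0" by (metis cinner_commute complex_cnj_zero)
  qed
  moreover obtain \<psi> where "\<phi> = \<pi> x \<psi>" using pi_surj[OF x] by (metis surjD)
  ultimately have "cinner \<phi> \<phi> = 0" using cinner_adj_right[OF pi_bounded[OF x], of \<psi> \<phi>] by simp
  then show ?thesis by (simp add: cinner_eq_zero_iff)
qed

lemma T_inj: "inj_on T V"
proof (rule inj_onI)
  fix x y assume xy: "x \<in> V" "y \<in> V" "T x = T y"
  have m: "(-1) *\<^sub>C y \<in> V" using xy V_csubspace by (auto simp: csubspace_def)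
  have "T (x + (-1) *\<^sub>C y) = T x + (-1) *\<^sub>C T y" using xy m by (simp add: T_add T_scaleC)
  then have "T (x - y) = 0" using xy by (simp add: scaleC_minus_one)
  then have "x - y = 0" using csubspace_diff[OF V_csubspace xy(1,2)] T_zero_imp_zero by blast
  then show "x = y" by simp
qed

text \<open>By self-adjointness a vector orthogonal to the range lies in the domain and is sent to
  zero, so injectivity applies.\<close>

lemma T_range_dense: "closure (T ` V) = UNIV"
proof (rule dense_csubspace)
  show "csubspace (T ` V)"
    unfolding csubspace_def
  proof (intro conjI ballI allI)
    have "T (0 *\<^sub>C 0) = 0" using V_csubspace T_scaleC[of 0 0] by (simp add: csubspace_def)
    then show "0 \<in> T ` V" using V_csubspace by (metis csubspace_def imageI scaleC_zero_left)
    show "x + y \<in> T ` V" if "x \<in> T ` V" "y \<in> T ` V" for x y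
      using that V_csubspace unfolding csubspace_def by (auto simp flip: T_add)
    show "c *\<^sub>C x \<in> T ` V" if "x \<in> T ` V" for c x
      using that V_csubspace unfolding csubspace_def by (auto simp flip: T_scaleC)
  qed
  fix x assume "\<And>y. y \<in> T ` V \<Longrightarrow> cinner x y = 0"
  then have "\<forall>z\<in>V. cinner (T z) x = cinner z 0"
    by (metis cinner_commute cinner_zero_right complex_cnj_zero imageI)
  then have "x \<in> V" "T x = 0" using T_selfadjoint by blast+
  then show "x = 0" by (rule T_zero_imp_zero)
qed

text \<open>Here \<open>s\<close> is \<open>(A \<D>)\<^sup>*\<close>.  Unlike \<open>FW_domain\<close>, this relation is visibly linear.\<close>

definition wavelet_series :: "('h \<Rightarrow> 'h) \<Rightarrow> ('g \<Rightarrow> complex) \<Rightarrow> bool" where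
  "wavelet_series A f \<longleftrightarrow> (\<exists>s. (\<forall>e\<in>onb. s e \<in> V \<and> T (s e) = adj A e) \<and>
     (\<forall>x\<in>space \<mu>. ((\<lambda>e. wavelet \<pi> (s e) e x) has_sum f x) onb))"

lemma
  assumes A: "A \<in> hilbert_schmidt" and f: "wavelet_series A f"
  shows wavelet_series_L2: "f \<in> L2_fun \<mu>"
    and wavelet_series_norm: "L2_norm \<mu> f = hs_norm A"
proof -
  obtain s where s: "\<And>e. e \<in> onb \<Longrightarrow> s e \<in> V" "\<And>e. e \<in> onb \<Longrightarrow> T (s e) = adj A e"
    and sum: "\<And>x. x \<in> space \<mu> \<Longrightarrow> ((\<lambda>e. wavelet \<pi> (s e) e x) has_sum f x) onb"
    using f by (auto simp: wavelet_series_def)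
  have orth: "L2_inner \<mu> (wavelet \<pi> (s e) e) (wavelet \<pi> (s d) d) =
      (if e = d then complex_of_real ((norm (adj A e))\<^sup>2) else 0)" if "e \<in> onb" "d \<in> onb" for e d
  proof -
    have "cinner e d = (if e = d then 1 else 0)"
      using that orthonormal_onb unfolding orthonormal_def by blast
    then show ?thesis using that by (simp add: wavelet_orthogonality s cinner_self[of "adj A d"])
  qed
  note * = L2_orthogonal_series[OF onb_countable wavelet_L2[OF s(1)] orth hs_adj[OF A] zero_le_power2 sum]
  show "f \<in> L2_fun \<mu>" by (rule *)
  have "(L2_norm \<mu> f)\<^sup>2 = (hs_norm A)\<^sup>2" by (rule *)
  then show "L2_norm \<mu> f = hs_norm A" by (simp add: L2_norm_nonneg hs_norm_nonneg power2_eq_iff_nonneg)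
qed

lemma wavelet_series_scale_add:
  assumes A: "A \<in> hilbert_schmidt" "wavelet_series A f"
    and B: "B \<in> hilbert_schmidt" "wavelet_series B g"
  shows "wavelet_series (\<lambda>x. c *\<^sub>C A x + B x) (\<lambda>x. c * f x + g x)"
proof -
  note bA = hilbert_schmidt_bounded_clinear[OF A(1)] and bB = hilbert_schmidt_bounded_clinear[OF B(1)]
  obtain s where s: "\<And>e. e \<in> onb \<Longrightarrow> s e \<in> V" "\<And>e. e \<in> onb \<Longrightarrow> T (s e) = adj A e"
    and sum_s: "\<And>x. x \<in> space \<mu> \<Longrightarrow> ((\<lambda>e. wavelet \<pi> (s e) e x) has_sum f x) onb"
    using A by (auto simp: wavelet_series_def)
  obtain t where t: "\<And>e. e \<in> onb \<Longrightarrow> t e \<in> V" "\<And>e. e \<in> onb \<Longrightarrow> T (t e) = adj B e"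
    and sum_t: "\<And>x. x \<in> space \<mu> \<Longrightarrow> ((\<lambda>e. wavelet \<pi> (t e) e x) has_sum g x) onb"
    using B by (auto simp: wavelet_series_def)
  \<comment> \<open>The scalar is conjugated by the adjoint and once more by the window, in which
    the wavelet transform is antilinear; the function is therefore multiplied by \<open>c\<close>
    itself.\<close>
  have "adj (\<lambda>x. c *\<^sub>C A x + B x) = (\<lambda>y. cnj c *\<^sub>C adj A y + adj B y)"
    by (rule adjI) (simp add: cinner_add_left cinner_add_right cinner_scaleC_left cinner_scaleC_right
        cinner_adj_right bA bB)
  then have "cnj c *\<^sub>C s e + t e \<in> V \<and> T (cnj c *\<^sub>C s e + t e) = adj (\<lambda>x. c *\<^sub>C A x + B x) e" if "e \<in> onb" for e
    using s[OF that] t[OF that] V_csubspace by (simp add: csubspace_def T_add T_scaleC)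
  moreover have "((\<lambda>e. wavelet \<pi> (cnj c *\<^sub>C s e + t e) e x) has_sum c * f x + g x) onb" if x: "x \<in> space \<mu>" for x
    using has_sum_add[OF has_sum_cmult_right[OF sum_s[OF x]] sum_t[OF x], of c] x
    by (simp add: wavelet_eq cinner_add_right cinner_scaleC_right)
  ultimately show ?thesis unfolding wavelet_series_def by (intro exI[of _ "\<lambda>e. cnj c *\<^sub>C s e + t e"]) blast
qed

text \<open>For \<open>\<phi>\<close> in \<open>V\<close>, \<open><T \<phi>, adj S \<eta>> = <S (T
  \<phi>), \<eta>> = <A \<phi>, \<eta>> = <\<phi>, adj A \<eta>>\<close>. By self-adjointness of
  \<open>T\<close> this is precisely the criterion for \<open>adj S \<eta>\<close> to lie in the
  domain with the stated image.\<close>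

lemma adj_extends_AD:
  assumes A: "bounded_clinear A" and S: "extends_AD V T A S"
  shows "adj S \<eta> \<in> V \<and> T (adj S \<eta>) = adj A \<eta>"
proof -
  have bS: "bounded_clinear S" using S by (simp add: extends_AD_def trace_class_def)
  have "S (T \<phi>) = A \<phi>" if "\<phi> \<in> V" for \<phi>
    using S that by (simp add: extends_AD_def inv_into_f_f[OF T_inj])
  then show ?thesis
    unfolding T_selfadjoint by (simp add: cinner_adj_right A bS)
qed

text \<open>Injectivity of \<open>T\<close> determines \<open>adj S\<close> from
  \<open>adj A\<close>. This justifies the definite description in
  \<open>Fourier_Wigner\<close>.\<close>

lemma extends_AD_unique:
  assumes A: "bounded_clinear A" and "extends_AD V T A S" "extends_AD V T A S'"
  shows "S = S'"
proof -
  have "adj S \<eta> = adj S' \<eta>" for \<eta>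
    using adj_extends_AD[OF assms(1,2), of \<eta>] adj_extends_AD[OF assms(1,3), of \<eta>] T_inj
    by (metis inj_onD)
  then have "adj S = adj S'" by blast
  moreover have "bounded_clinear S" "bounded_clinear S'" using assms by (auto simp: extends_AD_def trace_class_def)
  ultimately show ?thesis using adj_adj by metis
qed

text \<open>The trace class property makes the series converge at every point, not merely in mean,
  which is what \<open>L2_orthogonal_series\<close> needs in order to identify the sum.\<close>

lemma Fourier_Wigner_wavelet_series:
  assumes "A \<in> FW_domain V T"
  shows "wavelet_series A (Fourier_Wigner \<pi> V T A)"
proof -
  obtain S where A: "bounded_clinear A" and S: "extends_AD V T A S"
    using assms by (auto simp: FW_domain_def hilbert_schmidt_def)
  have the_S: "(THE S. extends_AD V T A S) = S"
    using S extends_AD_unique[OF A] by blast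
  have S_tr: "S \<in> trace_class" and bS: "bounded_clinear S" using S by (auto simp: extends_AD_def trace_class_def)
  have "((\<lambda>e. wavelet \<pi> (adj S e) e x) has_sum Fourier_Wigner \<pi> V T A x) onb" if x: "x \<in> space \<mu>" for x
  proof -
    have "wavelet \<pi> (adj S e) e x = cinner (S (\<pi> x e)) e" for e
      by (simp add: wavelet_eq x cinner_adj_right bS)
    then show ?thesis
      using trace_class_comp_summable[OF S_tr pi_bounded[OF x] norm_adj_pi[OF x]]
      by (simp add: Fourier_Wigner_def op_trace_def the_S)
  qed
  then show ?thesis
    unfolding wavelet_series_def using adj_extends_AD[OF A S] by (intro exI[of _ "adj S"]) blast
qed

section \<open>Density of the domain and closure of the graph\<close>

lemma FW_domain_hs: "A \<in> FW_domain V T \<Longrightarrow> A \<in> hilbert_schmidt"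
  by (simp add: FW_domain_def)

lemma FW_domain_dense:
  assumes A: "A \<in> hilbert_schmidt" and "\<epsilon> > 0"
  shows "\<exists>B\<in>FW_domain V T. hs_norm (\<lambda>x. A x - B x) < \<epsilon>"
proof -
  obtain F and v :: "'h \<Rightarrow> 'h" where F: "finite F" and v: "\<And>e. e \<in> F \<Longrightarrow> v e \<in> T ` V"
    and close: "hs_norm (\<lambda>x. A x - (\<Sum>e\<in>F. cinner x (v e) *\<^sub>C A e)) < \<epsilon>"
    by (rule finite_rank_dense_hs[OF A T_range_dense \<open>\<epsilon> > 0\<close>]) (rule that)
  define w where "w e = inv_into V T (v e)" for e
  have w: "w e \<in> V" "T (w e) = v e" if "e \<in> F" for e
    using v[OF that] by (auto simp: w_def inv_into_into f_inv_into_f)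
  let ?B = "\<lambda>x. \<Sum>e\<in>F. cinner x (v e) *\<^sub>C A e"
  \<comment> \<open>Formally \<open>?B\<close> composed with \<open>\<D>\<close>: self-adjointness
    moves \<open>T\<close> from \<open>\<phi>\<close> to \<open>w e\<close>, so the unbounded factor
    is absorbed into the finitely many vectors \<open>w e\<close>.\<close>
  let ?S = "\<lambda>x. \<Sum>e\<in>F. cinner x (w e) *\<^sub>C A e"
  have "?S (T \<phi>) = ?B \<phi>" if "\<phi> \<in> V" for \<phi>
  proof (rule sum.cong[OF refl])
    fix e assume "e \<in> F"
    then have "cinner (T \<phi>) (w e) = cinner \<phi> (v e)" using w T_selfadjoint that by blast
    then show "cinner (T \<phi>) (w e) *\<^sub>C A e = cinner \<phi> (v e) *\<^sub>C A e" by simp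
  qed
  then have "extends_AD V T ?B ?S"
    by (auto simp: extends_AD_def inv_into_f_f[OF T_inj] finite_rank_trace_class[OF F])
  moreover have "?B \<in> hilbert_schmidt" using finite_rank_hs[OF F, of v A] by blast
  ultimately have "?B \<in> FW_domain V T" by (auto simp: FW_domain_def)
  with close show ?thesis by (rule bexI[where x="?B"])
qed

text \<open>The closure of the graph of the transform in the product of the two norms. It is a
  relation because an element of \<open>L2\<close> has many representing functions.\<close>

definition FW_limit :: "('h \<Rightarrow> 'h) \<Rightarrow> ('g \<Rightarrow> complex) \<Rightarrow> bool" where
  "FW_limit A f \<longleftrightarrow> f \<in> L2_fun \<mu> \<and> (\<forall>\<epsilon>>0. \<exists>B g. B \<in> hilbert_schmidt \<and> wavelet_series B g \<and>
     hs_norm (\<lambda>x. A x - B x) < \<epsilon> \<and> L2_norm \<mu> (\<lambda>x. f x - g x) < \<epsilon>)"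

lemma FW_limit_L2: "FW_limit A f \<Longrightarrow> f \<in> L2_fun \<mu>"
  by (simp add: FW_limit_def)

lemma wavelet_series_FW_limit:
  assumes "A \<in> hilbert_schmidt" "wavelet_series A f"
  shows "FW_limit A f"
proof -
  have "hs_norm (\<lambda>x. A x - A x) = 0" "L2_norm \<mu> (\<lambda>x. f x - f x) = 0"
    by (simp_all add: hs_norm_def L2_norm_def)
  then show ?thesis using assms wavelet_series_L2[OF assms] unfolding FW_limit_def by metis
qed

lemma FW_limit_norm:
  assumes A: "A \<in> hilbert_schmidt" and f: "FW_limit A f"
  shows "L2_norm \<mu> f = hs_norm A"
proof -
  have "\<bar>L2_norm \<mu> f - hs_norm A\<bar> \<le> 0 + \<epsilon>" if "\<epsilon> > 0" for \<epsilon>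
  proof -
    obtain B g where B: "B \<in> hilbert_schmidt" "wavelet_series B g"
      and close: "hs_norm (\<lambda>x. A x - B x) < \<epsilon> / 2" "L2_norm \<mu> (\<lambda>x. f x - g x) < \<epsilon> / 2"
      using f \<open>\<epsilon> > 0\<close> unfolding FW_limit_def by (meson half_gt_zero)
    show ?thesis
      using L2_norm_diff_le[OF FW_limit_L2[OF f] wavelet_series_L2[OF B]] hs_norm_diff_le[OF A B(1)]
        wavelet_series_norm[OF B] close by linarith
  qed
  then have "\<bar>L2_norm \<mu> f - hs_norm A\<bar> \<le> 0" by (rule field_le_epsilon)
  then show ?thesis by simp
qed

lemma FW_limit_scale_add:
  assumes A: "A \<in> hilbert_schmidt" "FW_limit A f" and B: "B \<in> hilbert_schmidt" "FW_limit B g"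
  shows "FW_limit (\<lambda>x. c *\<^sub>C A x + B x) (\<lambda>x. c * f x + g x)"
  unfolding FW_limit_def
proof (intro conjI allI impI)
  note fL = FW_limit_L2[OF A(2)] and gL = FW_limit_L2[OF B(2)]
  show "(\<lambda>x. c * f x + g x) \<in> L2_fun \<mu>" by (rule L2_fun_scale_add[OF fL gL])
  fix \<epsilon> :: real assume "\<epsilon> > 0"
  \<comment> \<open>Chosen so that \<open>cmod c * \<delta> + \<delta> = \<epsilon>\<close>, which
    also covers \<open>c = 0\<close>.\<close>
  define \<delta> where "\<delta> = \<epsilon> / (cmod c + 1)"
  have c: "cmod c + 1 > 0" by (simp add: add_nonneg_pos)
  have "\<delta> > 0" using \<open>\<epsilon> > 0\<close> c by (simp add: \<delta>_def)
  moreover have "(cmod c + 1) * \<delta> = \<epsilon>" using c by (simp add: \<delta>_def)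
  ultimately have \<delta>: "\<delta> > 0" "cmod c * \<delta> + \<delta> = \<epsilon>" by (simp_all add: distrib_right)
  obtain A' f' where A': "A' \<in> hilbert_schmidt" "wavelet_series A' f'"
    and cA: "hs_norm (\<lambda>x. A x - A' x) < \<delta>" "L2_norm \<mu> (\<lambda>x. f x - f' x) < \<delta>"
    using A(2) \<delta>(1) unfolding FW_limit_def by meson
  obtain B' g' where B': "B' \<in> hilbert_schmidt" "wavelet_series B' g'"
    and cB: "hs_norm (\<lambda>x. B x - B' x) < \<delta>" "L2_norm \<mu> (\<lambda>x. g x - g' x) < \<delta>"
    using B(2) \<delta>(1) unfolding FW_limit_def by meson
  note dA = hilbert_schmidt_diff[OF A(1) A'(1)] and dB = hilbert_schmidt_diff[OF B(1) B'(1)]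
  note df = L2_fun_diff[OF fL wavelet_series_L2[OF A']] and dg = L2_fun_diff[OF gL wavelet_series_L2[OF B']]
  have bound: "cmod c * s + t < \<epsilon>" if "s < \<delta>" "t < \<delta>" for s t
    using mult_left_mono[of s \<delta> "cmod c"] that \<delta>(2) by (simp add: less_imp_le)
  have "(\<lambda>x. c *\<^sub>C A x + B x - (c *\<^sub>C A' x + B' x)) = (\<lambda>x. c *\<^sub>C (A x - A' x) + (B x - B' x))"
    by (simp add: scaleC_diff_right algebra_simps)
  then have "hs_norm (\<lambda>x. c *\<^sub>C A x + B x - (c *\<^sub>C A' x + B' x)) < \<epsilon>"
    using hs_norm_triangle[OF hilbert_schmidt_scale[OF dA] dB, of c] bound[OF cA(1) cB(1)]
    by (simp add: hs_norm_scale)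
  moreover have "(\<lambda>x. c * f x + g x - (c * f' x + g' x)) = (\<lambda>x. c * (f x - f' x) + (g x - g' x))"
    by (simp add: algebra_simps)
  then have "L2_norm \<mu> (\<lambda>x. c * f x + g x - (c * f' x + g' x)) < \<epsilon>"
    using L2_norm_triangle[OF L2_fun_scale[OF df] dg, of c] bound[OF cA(2) cB(2)]
    by (simp add: L2_norm_scale)
  ultimately show "\<exists>C h. C \<in> hilbert_schmidt \<and> wavelet_series C h \<and>
      hs_norm (\<lambda>x. c *\<^sub>C A x + B x - C x) < \<epsilon> \<and> L2_norm \<mu> (\<lambda>x. c * f x + g x - h x) < \<epsilon>"
    using hilbert_schmidt_scale_add[OF A'(1) B'(1), of c] wavelet_series_scale_add[OF A' B', of c] by blast
qed

text \<open>Isometry combined with linearity at the scalar \<open>- 1\<close>. Uniqueness,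
  continuity, injectivity and the Cauchy property of approximations are all read off from
  it.\<close>

lemma FW_limit_diff_norm:
  assumes "A \<in> hilbert_schmidt" "FW_limit A f" "B \<in> hilbert_schmidt" "FW_limit B g"
  shows "L2_norm \<mu> (\<lambda>x. f x - g x) = hs_norm (\<lambda>x. A x - B x)"
  using FW_limit_norm[OF hilbert_schmidt_scale_add[OF assms(3,1)] FW_limit_scale_add[OF assms(3,4,1,2)], of "-1"]
  by (simp add: scaleC_minus_one)

lemma FW_limit_unique:
  assumes "A \<in> hilbert_schmidt" "FW_limit A f" "FW_limit A g"
  shows "AE x in \<mu>. f x = g x"
proof (rule L2_norm_diff_zero_AE)
  show "L2_norm \<mu> (\<lambda>x. f x - g x) = 0"
    using FW_limit_diff_norm[OF assms(1,2,1,3)] by (simp add: hs_norm_def)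
qed (use assms in \<open>auto intro: FW_limit_L2\<close>)

lemma FW_limit_exists:
  assumes A: "A \<in> hilbert_schmidt"
  shows "\<exists>f. FW_limit A f"
proof -
  \<comment> \<open>With exponent \<open>Suc n\<close>, the errors of two successive approximations
    add up to at most \<open>(1 / 2) ^ n\<close>, the rate required for rapid convergence.\<close>
  have "\<exists>B\<in>FW_domain V T. hs_norm (\<lambda>x. A x - B x) < (1 / 2) ^ Suc n" for n
    by (rule FW_domain_dense[OF A]) simp
  then obtain B where B: "\<And>n. B n \<in> FW_domain V T" and close: "\<And>n. hs_norm (\<lambda>x. A x - B n x) < (1 / 2) ^ Suc n"
    by metis
  define g where "g n = Fourier_Wigner \<pi> V T (B n)" for n
  note hB = FW_domain_hs[OF B]
  have g: "wavelet_series (B n) (g n)" for n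
    unfolding g_def by (rule Fourier_Wigner_wavelet_series[OF B])
  note gL = wavelet_series_L2[OF hB g]
  have "L2_norm \<mu> (\<lambda>x. g (Suc n) x - g n x) \<le> (1 / 2) ^ n" for n
  proof -
    have "L2_norm \<mu> (\<lambda>x. g (Suc n) x - g n x) = hs_norm (\<lambda>x. B (Suc n) x - B n x)"
      by (intro FW_limit_diff_norm hB wavelet_series_FW_limit g)
    also have "\<dots> \<le> hs_norm (\<lambda>x. A x - B (Suc n) x) + hs_norm (\<lambda>x. A x - B n x)"
      using hs_norm_triangle[OF hilbert_schmidt_diff[OF hB A] hilbert_schmidt_diff[OF A hB], of "Suc n" n]
      by (simp add: hs_norm_minus_commute[of A "B (Suc n)"])
    also have "\<dots> \<le> (1 / 2) ^ n" using close[of n] close[of "Suc n"]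
      hs_norm_nonneg[of "\<lambda>x. A x - B n x"] hs_norm_nonneg[of "\<lambda>x. A x - B (Suc n) x"] by simp
    finally show ?thesis .
  qed
  from L2_rapidly_Cauchy_convergent[OF gL this]
  obtain f where f: "f \<in> L2_fun \<mu>" and fg: "\<And>n. L2_norm \<mu> (\<lambda>x. f x - g n x) \<le> 2 * (1 / 2) ^ n"
    by blast
  have "\<exists>n. 2 * (1 / 2) ^ n < \<epsilon>" if "\<epsilon> > 0" for \<epsilon> :: real
    using real_arch_pow_inv[of "\<epsilon> / 2" "1 / 2"] that by (auto simp: field_simps)
  then have "\<exists>C h. C \<in> hilbert_schmidt \<and> wavelet_series C h \<and>
      hs_norm (\<lambda>x. A x - C x) < \<epsilon> \<and> L2_norm \<mu> (\<lambda>x. f x - h x) < \<epsilon>" if "\<epsilon> > 0" for \<epsilon>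
  proof -
    obtain n where n: "2 * (1 / 2) ^ n < \<epsilon>" using \<open>\<And>\<epsilon>. \<epsilon> > 0 \<Longrightarrow> _\<close> \<open>\<epsilon> > 0\<close> by blast
    moreover have "hs_norm (\<lambda>x. A x - B n x) < 2 * (1 / 2) ^ n"
      by (rule order_less_trans[OF close]) simp
    ultimately have "hs_norm (\<lambda>x. A x - B n x) < \<epsilon>" "L2_norm \<mu> (\<lambda>x. f x - g n x) < \<epsilon>"
      using fg[of n] by linarith+
    then show ?thesis using hB[of n] g[of n] by blast
  qed
  then show ?thesis using f unfolding FW_limit_def by blast
qed

section \<open>The isometric extension\<close>

theorem Fourier_Wigner_extension:
  shows "(\<forall>A\<in>FW_domain V T. Fourier_Wigner \<pi> V T A \<in> L2_fun \<mu>) \<and>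
    (\<exists>\<Phi>. continuous_FW_extension \<mu> \<pi> V T \<Phi> \<and>
      (\<forall>\<Psi>. continuous_FW_extension \<mu> \<pi> V T \<Psi> \<longrightarrow>
         (\<forall>A\<in>hilbert_schmidt. AE x in \<mu>. \<Psi> A x = \<Phi> A x)) \<and>
      (\<forall>A\<in>hilbert_schmidt. \<forall>B\<in>hilbert_schmidt. \<forall>c.
         AE x in \<mu>. \<Phi> (\<lambda>\<psi>. c *\<^sub>C A \<psi> + B \<psi>) x = c * \<Phi> A x + \<Phi> B x) \<and>
      (\<forall>A\<in>hilbert_schmidt. \<forall>B\<in>hilbert_schmidt. (AE x in \<mu>. \<Phi> A x = \<Phi> B x) \<longrightarrow> A = B) \<and>
      (\<forall>A\<in>hilbert_schmidt. hs_norm A = L2_norm \<mu> (\<Phi> A)))"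
proof -
  \<comment> \<open>An arbitrary representative is chosen for each operator, so linearity and
    agreement with the transform hold almost everywhere.\<close>
  define \<Phi> where "\<Phi> A = (SOME f. FW_limit A f)" for A
  have \<Phi>: "FW_limit A (\<Phi> A)" if "A \<in> hilbert_schmidt" for A
    unfolding \<Phi>_def by (rule someI_ex[OF FW_limit_exists[OF that]])
  note \<Phi>L = FW_limit_L2[OF \<Phi>]
  have \<Phi>_diff: "L2_norm \<mu> (\<lambda>x. \<Phi> A x - \<Phi> B x) = hs_norm (\<lambda>x. A x - B x)"
    if "A \<in> hilbert_schmidt" "B \<in> hilbert_schmidt" for A B
    using FW_limit_diff_norm[OF that(1) \<Phi>[OF that(1)] that(2) \<Phi>[OF that(2)]] .
  have \<Phi>_FW: "AE x in \<mu>. \<Phi> A x = Fourier_Wigner \<pi> V T A x" if "A \<in> FW_domain V T" for A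
    using FW_limit_unique[OF FW_domain_hs[OF that] \<Phi>[OF FW_domain_hs[OF that]]
        wavelet_series_FW_limit[OF FW_domain_hs[OF that] Fourier_Wigner_wavelet_series[OF that]]] .
  have ext: "continuous_FW_extension \<mu> \<pi> V T \<Phi>"
    unfolding continuous_FW_extension_def
  proof (intro conjI ballI allI impI)
    fix A :: "'h \<Rightarrow> 'h" and \<epsilon> :: real assume "A \<in> hilbert_schmidt" "\<epsilon> > 0"
    then show "\<exists>\<delta>>0. \<forall>B\<in>hilbert_schmidt. hs_norm (\<lambda>\<psi>. B \<psi> - A \<psi>) < \<delta> \<longrightarrow>
        L2_norm \<mu> (\<lambda>x. \<Phi> B x - \<Phi> A x) < \<epsilon>"
      by (intro exI[of _ \<epsilon>]) (simp add: \<Phi>_diff)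
  qed (use \<Phi>L \<Phi>_FW in auto)
  have unique: "AE x in \<mu>. \<Psi> A x = \<Phi> A x"
    if \<Psi>: "continuous_FW_extension \<mu> \<pi> V T \<Psi>" and A: "A \<in> hilbert_schmidt" for \<Psi> A
  proof (rule L2_norm_diff_zero_AE)
    have \<Psi>L: "\<Psi> B \<in> L2_fun \<mu>" if "B \<in> hilbert_schmidt" for B
      using \<Psi> that by (simp add: continuous_FW_extension_def)
    show "\<Psi> A \<in> L2_fun \<mu>" "\<Phi> A \<in> L2_fun \<mu>" using \<Psi>L \<Phi>L A by auto
    \<comment> \<open>Comparison through a domain element \<open>B\<close> near \<open>A\<close>:
      half of \<open>\<epsilon>\<close> goes to the continuity of \<open>\<Psi>\<close>, half to the
      isometry of \<open>\<Phi>\<close>, and at \<open>B\<close> the two extensions agree almost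
      everywhere.\<close>
    have "L2_norm \<mu> (\<lambda>x. \<Psi> A x - \<Phi> A x) \<le> 0 + \<epsilon>" if "\<epsilon> > 0" for \<epsilon>
    proof -
      have "\<exists>\<delta>>0. \<forall>B\<in>hilbert_schmidt. hs_norm (\<lambda>\<psi>. B \<psi> - A \<psi>) < \<delta> \<longrightarrow>
          L2_norm \<mu> (\<lambda>x. \<Psi> B x - \<Psi> A x) < \<epsilon> / 2"
        using \<Psi> A half_gt_zero[OF \<open>\<epsilon> > 0\<close>] unfolding continuous_FW_extension_def by blast
      then obtain \<delta> where \<delta>: "\<delta> > 0" "\<And>B. B \<in> hilbert_schmidt \<Longrightarrow> hs_norm (\<lambda>\<psi>. B \<psi> - A \<psi>) < \<delta> \<Longrightarrow>
          L2_norm \<mu> (\<lambda>x. \<Psi> B x - \<Psi> A x) < \<epsilon> / 2" by blast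
      obtain B where B: "B \<in> FW_domain V T" and close: "hs_norm (\<lambda>x. A x - B x) < min \<delta> (\<epsilon> / 2)"
        using FW_domain_dense[OF A, of "min \<delta> (\<epsilon> / 2)"] \<delta>(1) \<open>\<epsilon> > 0\<close> by auto
      note hB = FW_domain_hs[OF B]
      have "AE x in \<mu>. \<Psi> B x = Fourier_Wigner \<pi> V T B x"
        using \<Psi> B by (simp add: continuous_FW_extension_def)
      then have "AE x in \<mu>. \<Psi> B x - \<Phi> A x = \<Phi> B x - \<Phi> A x"
        using \<Phi>_FW[OF B] by eventually_elim simp
      then have "L2_norm \<mu> (\<lambda>x. \<Psi> B x - \<Phi> A x) = L2_norm \<mu> (\<lambda>x. \<Phi> B x - \<Phi> A x)"
        by (intro L2_norm_cong_AE L2_fun_diff \<Psi>L \<Phi>L hB A)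
      then have "L2_norm \<mu> (\<lambda>x. \<Psi> B x - \<Phi> A x) < \<epsilon> / 2"
        using \<Phi>_diff[OF hB A] close by (simp add: hs_norm_minus_commute[of B])
      moreover have "L2_norm \<mu> (\<lambda>x. \<Psi> A x - \<Psi> B x) < \<epsilon> / 2"
        using \<delta>(2)[OF hB] close by (simp add: hs_norm_minus_commute[of B] L2_norm_minus_commute[of \<mu> "\<Psi> A"])
      ultimately show ?thesis
        using L2_norm_triangle_diff[OF \<Psi>L[OF A] \<Psi>L[OF hB] \<Phi>L[OF A]] by linarith
    qed
    then have "L2_norm \<mu> (\<lambda>x. \<Psi> A x - \<Phi> A x) \<le> 0" by (rule field_le_epsilon)
    then show "L2_norm \<mu> (\<lambda>x. \<Psi> A x - \<Phi> A x) = 0" using L2_norm_nonneg by (metis antisym)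
  qed
  have linear: "AE x in \<mu>. \<Phi> (\<lambda>\<psi>. c *\<^sub>C A \<psi> + B \<psi>) x = c * \<Phi> A x + \<Phi> B x"
    if "A \<in> hilbert_schmidt" "B \<in> hilbert_schmidt" for A B c
    using that by (intro FW_limit_unique[of "\<lambda>\<psi>. c *\<^sub>C A \<psi> + B \<psi>"] \<Phi> FW_limit_scale_add hilbert_schmidt_scale_add)
  have inj: "A = B" if "A \<in> hilbert_schmidt" "B \<in> hilbert_schmidt" "AE x in \<mu>. \<Phi> A x = \<Phi> B x" for A B
  proof (rule hs_norm_zero_imp_eq[OF that(1,2)])
    have "AE x in \<mu>. \<Phi> A x - \<Phi> B x = 0" using that(3) by eventually_elim simp
    then have "L2_norm \<mu> (\<lambda>x. \<Phi> A x - \<Phi> B x) = L2_norm \<mu> (\<lambda>x. 0)"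
      by (intro L2_norm_cong_AE L2_fun_diff L2_fun_zero \<Phi>L that)
    then show "hs_norm (\<lambda>x. A x - B x) = 0" using \<Phi>_diff[OF that(1,2)] by (simp add: L2_norm_def)
  qed
  have iso: "hs_norm A = L2_norm \<mu> (\<Phi> A)" if "A \<in> hilbert_schmidt" for A
    using FW_limit_norm[OF that \<Phi>[OF that]] by simp
  have FW_L2: "Fourier_Wigner \<pi> V T A \<in> L2_fun \<mu>" if "A \<in> FW_domain V T" for A
    using wavelet_series_L2[OF FW_domain_hs[OF that] Fourier_Wigner_wavelet_series[OF that]] .
  show ?thesis
    using ext unique linear inj iso FW_L2 by (intro conjI exI[of _ \<Phi>]) blast+
qed

end

theorem proposition3p4:
  fixes G :: "('g, 'm) monoid_scheme"
    and Exp :: "'a::real_normed_vector \<Rightarrow> 'g"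
    and F :: "'a \<Rightarrow> real"
    and \<hh> :: "'a set"
    and \<mu> :: "'g measure"
    and \<pi> :: "'g \<Rightarrow> 'h::complex_hilbert_space \<Rightarrow> 'h"
    and V :: "'h set" and Dinv :: "'h \<Rightarrow> 'h"
  assumes "exponential_Lie_group G Exp"
    and "right_Haar G Exp (carrier G) \<mu>"
    and "linear F"
    and "{g \<in> carrier G. coadjoint G Exp g F = F} = {\<one>\<^bsub>G\<^esub>}"
    and "Pukanszky_polarization G Exp F \<hh>"
    and "unitary_representation G Exp \<pi>"
    and "is_induced_representation G Exp \<mu> (Exp ` \<hh>) (orbit_character Exp F) \<pi>"
    and "irreducible_representation G \<pi>"
    and "square_integrable_representation \<mu> \<pi>"
    and "is_Duflo_Moore \<mu> \<pi> V Dinv"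
  shows "(\<forall>A\<in>FW_domain V Dinv. Fourier_Wigner \<pi> V Dinv A \<in> L2_fun \<mu>) \<and>
    (\<exists>\<Phi>. continuous_FW_extension \<mu> \<pi> V Dinv \<Phi> \<and>
      (\<forall>\<Psi>. continuous_FW_extension \<mu> \<pi> V Dinv \<Psi> \<longrightarrow>
         (\<forall>A\<in>hilbert_schmidt. AE x in \<mu>. \<Psi> A x = \<Phi> A x)) \<and>
      (\<forall>A\<in>hilbert_schmidt. \<forall>B\<in>hilbert_schmidt. \<forall>c.
         AE x in \<mu>. \<Phi> (\<lambda>\<psi>. c *\<^sub>C A \<psi> + B \<psi>) x = c * \<Phi> A x + \<Phi> B x) \<and>
      (\<forall>A\<in>hilbert_schmidt. \<forall>B\<in>hilbert_schmidt. (AE x in \<mu>. \<Phi> A x = \<Phi> B x) \<longrightarrow> A = B) \<and>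
      (\<forall>A\<in>hilbert_schmidt. hs_norm A = L2_norm \<mu> (\<Phi> A)))"
proof -
  interpret Duflo_Moore \<mu> \<pi> V Dinv
  proof
    have space: "space \<mu> = carrier G" using assms(2) by (simp add: right_Haar_def)
    note U = assms(6)[unfolded unitary_representation_def]
    show inner: "cinner (\<pi> x \<psi>) (\<pi> x \<phi>) = cinner \<psi> \<phi>" if "x \<in> space \<mu>" for x \<psi> \<phi>
      using U that space by simp
    show "surj (\<pi> x)" if "x \<in> space \<mu>" for x using U that space by simp
    show "bounded_clinear (\<pi> x)" if x: "x \<in> space \<mu>" for x
    proof -
      have "(norm (\<pi> x \<psi>))\<^sup>2 = (norm \<psi>)\<^sup>2" for \<psi> by (simp add: norm_sq_eq_cinner inner x)
      then have "norm (\<pi> x \<psi>) \<le> 1 * norm \<psi>" for \<psi> by simp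
      then show ?thesis using U x space unfolding bounded_clinear_def by blast
    qed
    show "is_Duflo_Moore \<mu> \<pi> V Dinv" by (rule assms(10))
    \<comment> \<open>Separability comes from irreducibility and the parametrisation of the group by
      a finite-dimensional space.\<close>
    show "countable (onb :: 'h set)" by (rule countable_onb[OF assms(1,6,8)])
    show "emeasure \<mu> (space \<mu>) \<noteq> 0" using assms(2) by (simp add: right_Haar_def)
  qed
  show ?thesis by (rule Fourier_Wigner_extension)
qed

end
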